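(* For every $n\ge1$, $\widehat{\mathrm{P}}^{\mathrm{VAL}_n}=\widehat{\mathrm{P}}^{\mathrm{SAT}_n}$.
   Context: $\Sigma=\{0,1\}$, $\Sigma^*$ the finite nonempty binary strings; for $x\in\Sigma^m$, $\pi_1(x)=x_1$. $\mathbb{P}_+\Sigma=\{\{0\},\{1\},\Sigma\}$. A promise problem is $\phi:\Sigma^*\to\mathbb{P}_+\Sigma$; a problem $\psi:\Sigma^*\to\Sigma$ is identified with $x\mapsto\{\psi(x)\}$. A $\phi$-oracle Turing machine may, given $x$, obtain in unit time some $y\in\phi(x)$; when $\phi(x)=\Sigma$ the returned value is nondeterministic (adversarial), independently on each call. $\phi_1\propto_T\phi_2$ means there is a $\phi_2$-oracle Turing machine $M$ and a polynomial $p$ such that on every input $x$ every possible computation path halts within $p(|x|)$ steps and outputs an element of $\phi_1(x)$. $\widehat{\mathrm{P}}^{\phi}=\{\phi_1:\phi_1\propto_T\phi\}$. Level-$n$ problems: the input encodes (e.g. as a Boolean formula) $f:\Sigma^{m_1}\times\dots\times\Sigma^{m_n}\to\Sigma$, written $f(x,\dots)$ with $x\in\Sigma^{m_1}$; $f_x$ is $f$ with $x$ fixed. For a constant $c$, $\mathrm{SAT}_0(c)=\overline{\mathrm{SAT}}_0(c)=c$; for $n\ge1$, $\mathrm{SAT}_n(f)=1\iff\exists x:\overline{\mathrm{SAT}}_{n-1}(f_x)=1$, $\overline{\mathrm{SAT}}_n(f)=1\iff\forall x,\ \mathrm{SAT}_{n-1}(f_x)=1$, and $\mathrm{VAL}_n(f)=\{\pi_1x:\overline{\mathrm{SAT}}_{n-1}(f_x)=1\}$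 if $\mathrm{SAT}_n(f)=1$, else $\Sigma$. *)

theory Defs
  imports Main "HOL-Computational_Algebra.Polynomial"
begin

text \<open>Sigma = {0,1} is rendered as bool (0 = False, 1 = True); Sigma* (finite nonempty
  strings) as bool lists, with the nonemptiness imposed wherever inputs are quantified.
  A promise problem is a map bool list => bool set whose values (on nonempty strings)
  are nonempty subsets of bool, i.e. elements of P_+ Sigma.\<close>

type_synonym problem = "bool list \<Rightarrow> bool set"

definition promise_problem :: "problem \<Rightarrow> bool" where
  "promise_problem \<phi> \<longleftrightarrow> (\<forall>x. x \<noteq> [] \<longrightarrow> \<phi> x \<noteq> {})"

text \<open>Single tape, two-way infinite, tape alphabet {blank, 0, 1} (blank = None).
  Finitely many states 0..<n_states.  A query state: the query string is the maximal
  block of non-blank cells starting at the head; in one step the oracle returns some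
  y in phi(query) (any such y: nondeterministic / adversarial) and the machine goes to
  state q_yes (y = 1) or q_no (y = 0), the tape being unchanged.  Two halting states
  q_out0 / q_out1 output 0 / 1.\<close>

datatype move = MLeft | MRight | MStay

type_synonym tape = "int \<Rightarrow> bool option"

record otm =
  n_states :: nat
  delta :: "nat \<Rightarrow> bool option \<Rightarrow> nat \<times> bool option \<times> move"
  q_start :: nat
  q_query :: nat
  q_yes :: nat
  q_no :: nat
  q_out0 :: nat
  q_out1 :: nat

definition wf_otm :: "otm \<Rightarrow> bool" where
  "wf_otm M \<longleftrightarrow>
     q_start M < n_states M \<and> q_query M < n_states M \<and> q_yes M < n_states M \<and>
     q_no M < n_states M \<and> q_out0 M < n_states M \<and> q_out1 M < n_states M \<and>
     q_out0 M \<noteq> q_out1 M \<and> q_query M \<noteq> q_out0 M \<and> q_query M \<noteq> q_out1 M \<and>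
     (\<forall>q s. q < n_states M \<longrightarrow> fst (delta M q s) < n_states M)"

type_synonym config = "nat \<times> tape \<times> int"

fun move_offset :: "move \<Rightarrow> int" where
  "move_offset MLeft = -1"
| "move_offset MRight = 1"
| "move_offset MStay = 0"

definition query_string :: "tape \<Rightarrow> int \<Rightarrow> bool list" where
  "query_string t h =
     (let k = (LEAST k::nat. t (h + int k) = None)
      in map (\<lambda>i. the (t (h + int i))) [0..<k])"

definition init_config :: "otm \<Rightarrow> bool list \<Rightarrow> config" where
  "init_config M x =
     (q_start M,
      (\<lambda>i. if 0 \<le> i \<and> nat i < length x then Some (x ! nat i) else None),
      0)"

definition is_halting :: "otm \<Rightarrow> config \<Rightarrow> bool" where
  "is_halting M c \<longleftrightarrow> fst c = q_out0 M \<or> fst c = q_out1 M"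

definition succs :: "problem \<Rightarrow> otm \<Rightarrow> config \<Rightarrow> config set" where
  "succs \<phi> M c =
     (case c of (q, t, h) \<Rightarrow>
        if q = q_out0 M \<or> q = q_out1 M then {}
        else if q = q_query M then
          {(if y then q_yes M else q_no M, t, h) | y. y \<in> \<phi> (query_string t h)}
        else (case delta M q (t h) of (q', s', m) \<Rightarrow>
                {(q', t(h := s'), h + move_offset m)}))"

primrec reach :: "problem \<Rightarrow> otm \<Rightarrow> bool list \<Rightarrow> nat \<Rightarrow> config set" where
  "reach \<phi> M x 0 = {init_config M x}"
| "reach \<phi> M x (Suc k) = (\<Union>c \<in> reach \<phi> M x k. succs \<phi> M c)"

definition output_in :: "otm \<Rightarrow> config \<Rightarrow> bool set \<Rightarrow> bool" where
  "output_in M c S \<longleftrightarrow> (fst c = q_out0 M \<and> False \<in> S) \<or> (fst c = q_out1 M \<and> True \<in> S)"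

definition solves_in_time :: "otm \<Rightarrow> nat poly \<Rightarrow> problem \<Rightarrow> problem \<Rightarrow> bool" where
  "solves_in_time M p \<phi>1 \<phi>2 \<longleftrightarrow>
     (\<forall>x. x \<noteq> [] \<longrightarrow>
        (\<forall>k c. c \<in> reach \<phi>2 M x k \<longrightarrow>
            k \<le> poly p (length x) \<and>
            (succs \<phi>2 M c = {} \<longrightarrow> is_halting M c \<and> output_in M c (\<phi>1 x))))"

definition turing_reduces :: "problem \<Rightarrow> problem \<Rightarrow> bool" (infix "\<propto>\<^sub>T" 50) where
  "\<phi>1 \<propto>\<^sub>T \<phi>2 \<longleftrightarrow> (\<exists>M p. wf_otm M \<and> solves_in_time M p \<phi>1 \<phi>2)"

definition Phat :: "problem \<Rightarrow> problem set" where
  "Phat \<phi> = {\<phi>1. promise_problem \<phi>1 \<and> \<phi>1 \<propto>\<^sub>T \<phi>}"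

datatype bform = FVar nat | FConst bool | FNot bform | FAnd bform bform | FOr bform bform

primrec beval :: "bform \<Rightarrow> (nat \<Rightarrow> bool) \<Rightarrow> bool" where
  "beval (FVar i) a = a i"
| "beval (FConst b) a = b"
| "beval (FNot f) a = (\<not> beval f a)"
| "beval (FAnd f g) a = (beval f a \<and> beval g a)"
| "beval (FOr f g) a = (beval f a \<or> beval g a)"

primrec bvars :: "bform \<Rightarrow> nat set" where
  "bvars (FVar i) = {i}"
| "bvars (FConst b) = {}"
| "bvars (FNot f) = bvars f"
| "bvars (FAnd f g) = bvars f \<union> bvars g"
| "bvars (FOr f g) = bvars f \<union> bvars g"

text \<open>Prefix-free binary encoding of formulas (Polish notation).\<close>
primrec enc_form :: "bform \<Rightarrow> bool list" where
  "enc_form (FVar i) = [False, False] @ replicate i True @ [False]"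
| "enc_form (FConst b) = [False, True, b]"
| "enc_form (FNot f) = [True, False] @ enc_form f"
| "enc_form (FAnd f g) = [True, True, False] @ enc_form f @ enc_form g"
| "enc_form (FOr f g) = [True, True, True] @ enc_form f @ enc_form g"

text \<open>A level-n instance: block lengths m_1..m_n (each >= 1) and a Boolean formula over
  the variables 0..<m_1+...+m_n; variable i is the i-th bit of the concatenation
  x_1 x_2 ... x_n.  Encoding: unary block lengths, then the formula.\<close>
definition valid_inst :: "nat \<Rightarrow> nat list \<Rightarrow> bform \<Rightarrow> bool" where
  "valid_inst n ms f \<longleftrightarrow> length ms = n \<and> (\<forall>m \<in> set ms. 1 \<le> m) \<and> bvars f \<subseteq> {..<sum_list ms}"

definition enc_inst :: "nat list \<Rightarrow> bform \<Rightarrow> bool list" where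
  "enc_inst ms f = concat (map (\<lambda>m. replicate m True @ [False]) ms) @ enc_form f"

definition encodes :: "nat \<Rightarrow> bool list \<Rightarrow> bool" where
  "encodes n s \<longleftrightarrow> (\<exists>ms f. valid_inst n ms f \<and> s = enc_inst ms f)"

definition decode :: "nat \<Rightarrow> bool list \<Rightarrow> nat list \<times> bform" where
  "decode n s = (THE (ms, f). valid_inst n ms f \<and> s = enc_inst ms f)"

definition form_fun :: "bform \<Rightarrow> bool list list \<Rightarrow> bool" where
  "form_fun f xs = beval f (\<lambda>i. concat xs ! i)"

fun sat_sem :: "nat list \<Rightarrow> (bool list list \<Rightarrow> bool) \<Rightarrow> bool"
and cosat_sem :: "nat list \<Rightarrow> (bool list list \<Rightarrow> bool) \<Rightarrow> bool" where
  "sat_sem [] g = g []"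
| "sat_sem (m # ms) g = (\<exists>x. length x = m \<and> cosat_sem ms (\<lambda>xs. g (x # xs)))"
| "cosat_sem [] g = g []"
| "cosat_sem (m # ms) g = (\<forall>x. length x = m \<longrightarrow> sat_sem ms (\<lambda>xs. g (x # xs)))"

definition val_sem :: "nat list \<Rightarrow> (bool list list \<Rightarrow> bool) \<Rightarrow> bool set" where
  "val_sem ms g =
     (if sat_sem ms g then
        {hd x | x. length x = hd ms \<and> cosat_sem (tl ms) (\<lambda>xs. g (x # xs))}
      else UNIV)"

text \<open>Strings not encoding a level-n instance are treated as unsatisfiable instances:
  SAT_n = 0 and hence VAL_n = Sigma on them.\<close>
definition SAT :: "nat \<Rightarrow> problem" where
  "SAT n s = (if encodes n s
              then (case decode n s of (ms, f) \<Rightarrow> {sat_sem ms (form_fun f)})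
              else {False})"

definition VAL :: "nat \<Rightarrow> problem" where
  "VAL n s = (if encodes n s
              then (case decode n s of (ms, f) \<Rightarrow> val_sem ms (form_fun f))
              else UNIV)"

end

theory Submission
  imports Defs
begin

text \<open>A VAL query f is answered with one SAT query, on f and not x0: if it succeeds then 0 is an
  admissible answer, and otherwise 1 is. Conversely, SAT is decided by playing the quantifier
  game. The players determine their moves bit by bit, each bit being the answer of VAL on the
  remaining game from the perspective of the player to move: variable 0 is replaced by the answer,
  and when a block is used up the formula is negated and a dummy block is appended, so that the
  game is again of level n. None of these moves turns a won position into a lost one or vice versa, so the
  value of the game is the value of f at the end of the play. On strings that do not encode an
  instance the syntax check hidden in the final evaluation fails.

  Both arguments become oracle machines in two steps. Finitely many stacks of bits can be kept on
  one tape, separated by blanks, with polynomial overhead; and a machine using one oracle can be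
  run on stacks, with each query delegated to a subroutine using the other oracle.\<close>


subsection \<open>Bounded inevitability in transition systems\<close>

text \<open>\<open>VAL n\<close> constrains its answer only if the leading existential block can be
  won; it says nothing directly about a universal block. Duality closes the gap: \<open>f\<close>
  wins under a leading universal block iff its negation does not win under a leading existential
  one. Each such switch uses up a block, while the oracle accepts only n blocks of positive length;
  this is what forces the dummies. Their length 1 is well chosen: the unary code 10 is also the code
  of a negation, so leftover dummies can be evaluated along with the formula, and the parity comes
  out right (\<open>pos_value_final\<close>).

  Formulas are never parsed while the game is played. Rewriting works token by token on strings not
  known to be formulas, and \<open>pos_value\<close> is False on every token list that is not a
  formula in range. Substitution neither repairs nor breaks a formula, so form and truth can be
  decided together at the end.

  Oracle answers are adversarial: different paths may play different moves, and only the value is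
  common to them. Run times are therefore stated for all paths at once.\<close>

text \<open>A bounded form of inevitability: all branches must meet \<open>Q\<close>. Demanding a
  successor keeps a dead end from succeeding vacuously.\<close>

primrec ensures :: "('c \<Rightarrow> 'c set) \<Rightarrow> ('c \<Rightarrow> bool) \<Rightarrow> nat \<Rightarrow> 'c \<Rightarrow> bool" where
  "ensures S Q 0 c = Q c"
| "ensures S Q (Suc t) c = (Q c \<or> S c \<noteq> {} \<and> (\<forall>c'\<in>S c. ensures S Q t c'))"

lemma ensures_here: "Q c \<Longrightarrow> ensures S Q t c"
  by (cases t) auto

lemma ensures_mono:
  "ensures S Q t c \<Longrightarrow> t \<le> t' \<Longrightarrow> (\<And>c. Q c \<Longrightarrow> Q' c) \<Longrightarrow> ensures S Q' t' c"
proof (induction t arbitrary: c t')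
  case 0
  then show ?case by (auto intro: ensures_here)
next
  case (Suc t)
  then obtain u where u: "t' = Suc u" "t \<le> u" by (cases t') auto
  with Suc show ?case by auto
qed

lemma ensures_trans:
  assumes "ensures S Q t c" and "\<And>c'. Q c' \<Longrightarrow> ensures S Q' t' c'"
  shows "ensures S Q' (t + t') c"
  using assms(1)
proof (induction t arbitrary: c)
  case 0
  then show ?case using assms(2) by simp
next
  case (Suc t)
  then show ?case
    using ensures_mono[OF assms(2), of c "Suc t + t'" Q'] by auto
qed

lemma ensures_trans':
  assumes "ensures S Q t c" and "\<And>c'. Q c' \<Longrightarrow> ensures S Q' t' c'" and "t + t' \<le> u"
  shows "ensures S Q' u c"
  using ensures_mono[OF ensures_trans[OF assms(1,2)] assms(3)] by blast

lemma ensures_step: "S c = {c'} \<Longrightarrow> ensures S Q t c' \<Longrightarrow> ensures S Q (Suc t) c"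
  by simp

text \<open>The index of the simulation relation is the number of source steps still allowed, so that
  the relation can bound the growth of configurations along a run.\<close>

lemma ensures_sim:
  assumes step: "\<And>t c d. R (Suc t) c d \<Longrightarrow> \<not> Q c \<Longrightarrow> S c \<noteq> {} \<Longrightarrow>
      ensures S' (\<lambda>d'. \<exists>c'\<in>S c. R t c' d') T d"
  shows "ensures S Q t c \<Longrightarrow> R t c d \<Longrightarrow> ensures S' (\<lambda>d'. \<exists>c' t'. Q c' \<and> R t' c' d') (t * T) d"
proof (induction t arbitrary: c d)
  case 0
  then show ?case by auto
next
  case (Suc t)
  show ?case
  proof (cases "Q c")
    case True
    then show ?thesis using Suc.prems by (intro ensures_here) auto
  next
    case False
    with Suc.prems have ne: "S c \<noteq> {}" and all: "\<forall>c'\<in>S c. ensures S Q t c'" by auto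
    show ?thesis
      by (rule ensures_trans'[OF step[OF Suc.prems(2) False ne], where t' = "t * T"])
        (use Suc.IH all in auto)
  qed
qed

definition accepts :: "otm \<Rightarrow> bool set \<Rightarrow> config \<Rightarrow> bool" where
  "accepts M A c \<longleftrightarrow> is_halting M c \<and> output_in M c A"

text \<open>\<open>reach\<close> looks forward from the start, \<open>ensures\<close> backward from
  the goal. They agree because accepting configurations have no successors: a path that continues
  has not met the goal yet, so each step uses one unit of the remaining budget.\<close>

lemma solves_in_time_iff_ensures:
  "solves_in_time M p \<phi>1 \<phi>2 \<longleftrightarrow>
    (\<forall>x. x \<noteq> [] \<longrightarrow> ensures (succs \<phi>2 M) (accepts M (\<phi>1 x)) (poly p (length x)) (init_config M x))"
proof -
  have halt: "succs \<phi>2 M c = {}" if "is_halting M c" for c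
    using that by (cases c) (auto simp: succs_def is_halting_def)
  have "(\<forall>k c. c \<in> reach \<phi>2 M x k \<longrightarrow> k \<le> b \<and>
          (succs \<phi>2 M c = {} \<longrightarrow> is_halting M c \<and> output_in M c A))
      \<longleftrightarrow> ensures (succs \<phi>2 M) (accepts M A) b (init_config M x)" (is "?L \<longleftrightarrow> ?R") for x b A
  proof
    assume L: ?L
    then have fin: "accepts M A c" if "c \<in> reach \<phi>2 M x k" "succs \<phi>2 M c = {}" for k c
      unfolding accepts_def using that by blast
    have "ensures (succs \<phi>2 M) (accepts M A) j c" if "c \<in> reach \<phi>2 M x k" "k + j = b" for j k c
      using that
    proof (induction j arbitrary: k c)
      case 0
      \<comment> \<open>At depth \<open>b\<close> a successor would be reached after
        \<open>b + 1\<close> steps, against the time bound.\<close>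
      have "succs \<phi>2 M c = {}"
      proof (rule ccontr)
        assume "succs \<phi>2 M c \<noteq> {}"
        then obtain c' where "c' \<in> reach \<phi>2 M x (Suc k)" using 0 by auto
        with L have "Suc k \<le> b" by blast
        with 0 show False by simp
      qed
      with 0 fin show ?case by simp
    next
      case (Suc j)
      have "ensures (succs \<phi>2 M) (accepts M A) j c'" if "c' \<in> succs \<phi>2 M c" for c'
        using that Suc.prems by (intro Suc.IH[of c' "Suc k"]) auto
      moreover have "accepts M A c" if "succs \<phi>2 M c = {}"
        using fin Suc.prems(1) that by blast
      ultimately show ?case by auto
    qed
    from this[of "init_config M x" 0 b] show ?R by simp
  next
    assume R: ?R
    have "k \<le> b \<and> ensures (succs \<phi>2 M) (accepts M A) (b - k) c" if "c \<in> reach \<phi>2 M x k" for k c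
      using that
    proof (induction k arbitrary: c)
      case 0
      then show ?case using R by simp
    next
      case (Suc k)
      then obtain d where d: "d \<in> reach \<phi>2 M x k" "c \<in> succs \<phi>2 M d" by auto
      from Suc.IH[OF d(1)] have "k \<le> b" and w: "ensures (succs \<phi>2 M) (accepts M A) (b - k) d"
        by auto
      have "\<not> accepts M A d" using halt[of d] d(2) by (auto simp: accepts_def)
      with w d(2) obtain j where "b - k = Suc j" "ensures (succs \<phi>2 M) (accepts M A) j c"
        by (cases "b - k") auto
      then show ?case by (metis Suc_diff_Suc Suc_leI diff_Suc_eq_diff_pred diff_diff_left
            diff_is_0_eq nat.simps(3) not_le plus_1_eq_Suc add.commute diff_Suc_1)
    qed
    moreover have "is_halting M c \<and> output_in M c A"
      if "ensures (succs \<phi>2 M) (accepts M A) j c" "succs \<phi>2 M c = {}" for j c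
      using that by (cases j) (auto simp: accepts_def)
    ultimately show ?L by blast
  qed
  then show ?thesis unfolding solves_in_time_def by blast
qed


subsection \<open>Tapes as pairs of lists\<close>

text \<open>Reading past the end gives a blank, so lists that differ in trailing blanks describe the
  same half tape.\<close>

definition cell :: "bool option list \<Rightarrow> nat \<Rightarrow> bool option" where
  "cell xs i = (if i < length xs then xs ! i else None)"

lemma cell_Nil [simp]: "cell [] i = None"
  and cell_Cons_0 [simp]: "cell (x # xs) 0 = x"
  and cell_Cons_Suc [simp]: "cell (x # xs) (Suc i) = cell xs i"
  by (auto simp: cell_def)

lemma cell_append_None [simp]: "cell (xs @ [None]) = cell xs"
  by (rule ext) (auto simp: cell_def nth_append)

text \<open>A zipper around the head: \<open>ls\<close> lists the cells on the left, nearest first,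
  and \<open>rs\<close> starts with the scanned cell.\<close>

definition tape_of :: "bool option list \<Rightarrow> bool option list \<Rightarrow> int \<Rightarrow> tape" where
  "tape_of ls rs h = (\<lambda>i. if h \<le> i then cell rs (nat (i - h)) else cell ls (nat (h - 1 - i)))"

text \<open>The head position is forgotten because runs are invariant under translation.\<close>

definition cfg :: "nat \<Rightarrow> bool option list \<Rightarrow> bool option list \<Rightarrow> config \<Rightarrow> bool" where
  "cfg q ls rs c \<longleftrightarrow> (\<exists>h. c = (q, tape_of ls rs h, h))"

lemma cfg_pad_right: "cfg q ls (rs @ [None]) = cfg q ls rs"
  by (simp add: cfg_def tape_of_def fun_eq_iff)

lemma cfg_pad_left: "cfg q (ls @ [None]) rs = cfg q ls rs"
  by (simp add: cfg_def tape_of_def fun_eq_iff)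

lemma cfg_pads [simp]: "cfg q ls [None] = cfg q ls []" "cfg q [None] rs = cfg q [] rs"
  using cfg_pad_right[of q ls "[]"] cfg_pad_left[of q "[]" rs] by auto

definition hd0 :: "bool option list \<Rightarrow> bool option" where
  "hd0 xs = cell xs 0"

lemma hd0_simps [simp]: "hd0 [] = None" "hd0 (x # xs) = x"
  by (auto simp: hd0_def)

text \<open>Here \<open>rs\<close> is the part beyond the scanned cell, and \<open>s\<close> is the
  symbol written into that cell.\<close>

fun shift :: "move \<Rightarrow> bool option \<Rightarrow> bool option list \<Rightarrow> bool option list \<Rightarrow>
    bool option list \<times> bool option list" where
  "shift MStay s ls rs = (ls, s # rs)"
| "shift MRight s ls rs = (s # ls, rs)"
| "shift MLeft s ls rs = (tl ls, hd0 ls # s # rs)"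

lemma tape_of_head [simp]: "tape_of ls rs h h = hd0 rs"
  by (simp add: tape_of_def hd0_def)

lemma cell_Cons: "cell (x # xs) i = (case i of 0 \<Rightarrow> x | Suc j \<Rightarrow> cell xs j)"
  by (cases i) auto

lemma cell_tl: "cell (tl xs) i = cell xs (Suc i)"
  by (cases xs) auto

lemma tape_of_shift:
  "shift m s ls (tl rs) = (ls', rs') \<Longrightarrow>
    (tape_of ls rs h)(h := s) = tape_of ls' rs' (h + move_offset m)"
proof (induction m s ls "tl rs" rule: shift.induct)
  case (1 s ls)
  have "nat (x - h) = Suc (nat (x - h - 1))" if "h < x" for x using that by simp
  with 1 show ?case
    by (auto simp: tape_of_def fun_eq_iff cell_tl)
next
  case (2 s ls)
  have "nat (x - h) = Suc (nat (x - h - 1))" if "h < x" for x using that by simp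
  moreover have "nat (h - x) = Suc (nat (h - x - 1))" if "x < h" for x using that by simp
  ultimately show ?case using 2
    by (auto simp: tape_of_def fun_eq_iff cell_tl cell_Cons split: nat.split)
      (auto simp: algebra_simps)
next
  case (3 s ls)
  have *: "nat (x - h + 1) = Suc (Suc (nat (x - h - 1)))" "nat (x - h) = Suc (nat (x - h - 1))"
    if "h < x" for x using that by auto
  have **: "nat (h - x - 1) = Suc (nat (h - x - 2))" if "x < h - 1" for x using that by auto
  show ?case using 3
    apply (clarsimp simp: tape_of_def fun_eq_iff)
    subgoal for x
      using *[of x] **[of x]
      by (cases "x = h"; cases "x = h - 1"; cases "x < h") 
         (auto simp: cell_tl hd0_def algebra_simps)
    done
qed

text \<open>The blank padding in \<open>cell\<close> ends the block even if \<open>rs\<close> has no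
  blank of its own, so the \<open>LEAST\<close> is attained.\<close>

lemma query_string_tape_of:
  "query_string (tape_of ls rs h) h = map the (takeWhile (\<lambda>s. s \<noteq> None) rs)"
proof -
  define w where "w = takeWhile (\<lambda>s. s \<noteq> None) rs"
  have t: "tape_of ls rs h (h + int k) = cell rs k" for k
    by (simp add: tape_of_def)
  have le: "length w \<le> length rs" by (simp add: w_def length_takeWhile_le)
  have lt: "cell rs k = w ! k \<and> w ! k \<noteq> None" if "k < length w" for k
    using that le nth_mem[OF that] set_takeWhileD[of "w ! k" _ rs] unfolding w_def
    by (auto simp: cell_def takeWhile_nth)
  have "cell rs (length w) = None"
    using nth_length_takeWhile[of "\<lambda>s. s \<noteq> None" rs] by (auto simp: cell_def w_def)
  then have "(LEAST k. cell rs k = None) = length w"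
    using lt by (intro Least_equality) (metis leI)+
  then show ?thesis
    unfolding query_string_def t Let_def w_def[symmetric]
    by (intro nth_equalityI) (auto simp: lt)
qed

lemma cfg_init: "cfg (q_start M) [] (map Some x) (init_config M x)"
  unfolding cfg_def init_config_def
  by (intro exI[of _ 0]) (auto simp: tape_of_def cell_def fun_eq_iff)

lemma succs_cfg:
  assumes "cfg q ls rs c" "q \<noteq> q_out0 M" "q \<noteq> q_out1 M" "q \<noteq> q_query M"
    and "delta M q (hd0 rs) = (q', s', m)" and "shift m s' ls (tl rs) = (ls', rs')"
  shows "\<exists>c'. succs \<psi> M c = {c'} \<and> cfg q' ls' rs' c'"
  using assms tape_of_shift[OF assms(6)] by (auto simp: cfg_def succs_def)

lemma succs_cfg_query:
  assumes "cfg q ls rs c" "q \<noteq> q_out0 M" "q \<noteq> q_out1 M" "q = q_query M"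
  shows "succs \<psi> M c = (\<lambda>y. (if y then q_yes M else q_no M, snd c)) ` 
      \<psi> (map the (takeWhile (\<lambda>s. s \<noteq> None) rs))"
    and "cfg (if y then q_yes M else q_no M) ls rs (if y then q_yes M else q_no M, snd c)"
proof -
  obtain h where c: "c = (q, tape_of ls rs h, h)" using assms(1) by (auto simp: cfg_def)
  have "succs \<psi> M c = {(if y then q_yes M else q_no M, tape_of ls rs h, h) | y.
      y \<in> \<psi> (query_string (tape_of ls rs h) h)}"
    unfolding succs_def c using assms(2-4) by simp
  then show "succs \<psi> M c = (\<lambda>y. (if y then q_yes M else q_no M, snd c)) ` 
      \<psi> (map the (takeWhile (\<lambda>s. s \<noteq> None) rs))"
    unfolding query_string_tape_of c snd_conv by blast
  show "cfg (if y then q_yes M else q_no M) ls rs (if y then q_yes M else q_no M, snd c)"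
    using c by (auto simp: cfg_def)
qed


subsection \<open>Stack machines\<close>

text \<open>Every label pops one register, branches on the popped bit (None if the register is empty),
  pushes a list of bits onto registers and continues at the next label. Queries are made on
  register 0.\<close>

record 'l smach =
  code :: "'l \<Rightarrow> nat \<times> (bool option \<Rightarrow> (nat \<times> bool) list \<times> 'l)"
  l_start :: 'l
  l_query :: 'l
  l_yes :: 'l
  l_no :: 'l
  l_out0 :: 'l
  l_out1 :: 'l

definition top :: "bool list \<Rightarrow> bool option" where
  "top w = (case w of [] \<Rightarrow> None | b # _ \<Rightarrow> Some b)"

lemma top_simps [simp]: "top [] = None" "top (b # w) = Some b"
  by (auto simp: top_def)

definition push :: "nat \<times> bool \<Rightarrow> bool list list \<Rightarrow> bool list list" where
  "push = (\<lambda>(r, b) regs. regs[r := b # regs ! r])"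

text \<open>The last push ends on top, so a string that is to be read off in order has to be pushed
  reversed.\<close>

definition sstep :: "'l smach \<Rightarrow> 'l \<times> bool list list \<Rightarrow> 'l \<times> bool list list" where
  "sstep P = (\<lambda>(l, regs). case code P l of (r, g) \<Rightarrow> case g (top (regs ! r)) of (ps, l') \<Rightarrow>
     (l', fold push ps (regs[r := tl (regs ! r)])))"

definition ssuccs :: "problem \<Rightarrow> 'l smach \<Rightarrow> 'l \<times> bool list list \<Rightarrow> ('l \<times> bool list list) set" where
  "ssuccs \<psi> P = (\<lambda>(l, regs).
     if l = l_out0 P \<or> l = l_out1 P then {}
     else if l = l_query P then (\<lambda>y. (if y then l_yes P else l_no P, regs)) ` \<psi> (regs ! 0)
     else {sstep P (l, regs)})"

definition saccepts :: "'l smach \<Rightarrow> bool set \<Rightarrow> 'l \<times> bool list list \<Rightarrow> bool" where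
  "saccepts P A = (\<lambda>(l, regs). l = l_out0 P \<and> False \<in> A \<or> l = l_out1 P \<and> True \<in> A)"

text \<open>Label types may be infinite, since labels carry numbers. \<open>L\<close> is a finite
  part closed under \<open>code\<close>, from which the finite control is built.\<close>

definition wf_smach :: "'l smach \<Rightarrow> 'l set \<Rightarrow> nat \<Rightarrow> bool" where
  "wf_smach P L K \<longleftrightarrow> finite L \<and> {l_start P, l_query P, l_yes P, l_no P, l_out0 P, l_out1 P} \<subseteq> L \<and>
     l_out0 P \<noteq> l_out1 P \<and> l_query P \<noteq> l_out0 P \<and> l_query P \<noteq> l_out1 P \<and> 0 < K \<and>
     (\<forall>l\<in>L. case code P l of (r, g) \<Rightarrow> r < K \<and>
        (\<forall>s. case g s of (ps, l') \<Rightarrow> l' \<in> L \<and> set ps \<subseteq> {..<K} \<times> UNIV))"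

lemma length_push [simp]: "length (push p regs) = length regs"
  by (simp add: push_def split: prod.split)

lemma length_fold_push [simp]: "length (fold push ps regs) = length regs"
  by (induction ps arbitrary: regs) auto


subsection \<open>Compilation of stack machines to oracle Turing machines\<close>

text \<open>The registers are laid out from left to right, each followed by a blank. A pop deletes the
  first cell of a register and a push inserts a cell in front of it, shifting the rest of the
  tape. Blanks are counted to find the registers and both ends of the layout; a state carries
  the list of pending pushes and the label at which to continue.\<close>

definition layout :: "bool list list \<Rightarrow> bool option list" where
  "layout regs = concat (map (\<lambda>w. map Some w @ [None]) regs)"

definition blanks :: "bool option list \<Rightarrow> nat" where
  "blanks xs = length (filter (\<lambda>s. s = None) xs)"

lemma layout_simps [simp]:
  "layout [] = []" "layout (w # regs) = map Some w @ None # layout regs"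
  "layout (regs @ regs') = layout regs @ layout regs'"
  by (auto simp: layout_def)

lemma blanks_simps [simp]:
  "blanks [] = 0" "blanks (None # xs) = Suc (blanks xs)" "blanks (Some b # xs) = blanks xs"
  "blanks (xs @ ys) = blanks xs + blanks ys" "blanks (rev xs) = blanks xs"
  "blanks (map Some w) = 0"
  by (auto simp: blanks_def simp flip: rev_filter)

lemma blanks_layout [simp]: "blanks (layout regs) = length regs"
  by (induction regs) auto

lemma layout_butlast: "regs \<noteq> [] \<Longrightarrow> layout regs = butlast (layout regs) @ [None]"
  by (induction regs rule: rev_induct) (auto simp: butlast_append)

text \<open>\<open>Walk j\<close> has \<open>j\<close> blanks to cross before its target register.
  \<open>Insert\<close> carries the displaced symbol to the right; \<open>Fetch\<close>,
  \<open>Store\<close> and \<open>Next\<close> form a three-step loop that copies each cell one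
  place to the left. Their number counts the blanks up to the right end. \<open>Return j\<close>
  goes left and leaves the layout at the blank met with \<open>j = 0\<close>.\<close>

datatype 'l st =
    Walk nat "(nat \<times> bool) list" 'l
  | Insert "bool option" nat "(nat \<times> bool) list" 'l
  | Fetch nat "(nat \<times> bool) list" 'l
  | Store "bool option" nat "(nat \<times> bool) list" 'l
  | Next nat "(nat \<times> bool) list" 'l
  | Return nat "(nat \<times> bool) list" 'l

text \<open>The head is on the first cell of register 0. The target of the coming walk is the
  register of the next pending push or, if there is none, the one popped by
  \<open>l\<close>.\<close>

definition home :: "'l smach \<Rightarrow> (nat \<times> bool) list \<Rightarrow> 'l \<Rightarrow> 'l st" where
  "home P ps l = Walk (case ps of [] \<Rightarrow> fst (code P l) | p # _ \<Rightarrow> fst p) ps l"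

fun micro :: "'l smach \<Rightarrow> nat \<Rightarrow> 'l st \<Rightarrow> bool option \<Rightarrow> 'l st \<times> bool option \<times> move" where
  "micro P K (Walk (Suc j) ps l) s = (Walk (if s = None then j else Suc j) ps l, s, MRight)"
| "micro P K (Walk 0 (p # ps) l) s = (Insert (Some (snd p)) (K - fst p) ps l, s, MStay)"
| "micro P K (Walk 0 [] l) s = (case code P l of (r, g) \<Rightarrow> case g s of (ps, l') \<Rightarrow>
     if s = None then (Return (Suc r) ps l', s, MStay) else (Fetch (K - r) ps l', s, MRight))"
| "micro P K (Insert a c ps l) s =
     (if s = None \<and> c = 1 then Return K ps l else Insert s (if s = None then c - 1 else c) ps l,
      a, MRight)"
| "micro P K (Fetch c ps l) s = (Store s c ps l, s, MLeft)"
| "micro P K (Store a c ps l) s =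
     (if a = None \<and> c = 1 then (Return K ps l, a, MStay)
      else (Next (if a = None then c - 1 else c) ps l, a, MRight))"
| "micro P K (Next c ps l) s = (Fetch c ps l, s, MRight)"
| "micro P K (Return j ps l) s =
     (if s \<noteq> None then (Return j ps l, s, MLeft)
      else if j = 0 then (home P ps l, s, MRight) else (Return (j - 1) ps l, s, MLeft))"

locale stack_compiler =
  fixes P :: "'l smach" and L :: "'l set" and K W :: nat
  assumes wf: "wf_smach P L K"
    and pushes_le: "l \<in> L \<Longrightarrow> code P l = (r, g) \<Longrightarrow> g s = (ps, l') \<Longrightarrow> length ps \<le> W"
begin

section \<open>Finite control of the compiled machine\<close>

definition pend :: "(nat \<times> bool) list set" where
  "pend = {ps. set ps \<subseteq> {..<K} \<times> UNIV \<and> length ps \<le> W}"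

fun legal :: "'l st \<Rightarrow> bool" where
  "legal (Walk j ps l) \<longleftrightarrow> j \<le> K \<and> ps \<in> pend \<and> l \<in> L"
| "legal (Insert a j ps l) \<longleftrightarrow> j \<le> K \<and> ps \<in> pend \<and> l \<in> L"
| "legal (Fetch j ps l) \<longleftrightarrow> j \<le> K \<and> ps \<in> pend \<and> l \<in> L"
| "legal (Store a j ps l) \<longleftrightarrow> j \<le> K \<and> ps \<in> pend \<and> l \<in> L"
| "legal (Next j ps l) \<longleftrightarrow> j \<le> K \<and> ps \<in> pend \<and> l \<in> L"
| "legal (Return j ps l) \<longleftrightarrow> j \<le> K \<and> ps \<in> pend \<and> l \<in> L"

lemma finite_legal: "finite (Collect legal)"
proof -
  let ?B = "{..K} \<times> pend \<times> L"
  let ?C = "(UNIV :: bool option set) \<times> ?B"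
  have "finite pend"
    using finite_lists_length_le[of "{..<K} \<times> (UNIV :: bool set)" W] by (simp add: pend_def)
  then have fin: "finite ?B" "finite ?C" using wf by (auto simp: wf_smach_def)
  have "Collect legal \<subseteq> (\<lambda>(j, ps, l). Walk j ps l) ` ?B \<union> (\<lambda>(a, j, ps, l). Insert a j ps l) ` ?C \<union>
      (\<lambda>(j, ps, l). Fetch j ps l) ` ?B \<union> (\<lambda>(a, j, ps, l). Store a j ps l) ` ?C \<union>
      (\<lambda>(j, ps, l). Next j ps l) ` ?B \<union> (\<lambda>(j, ps, l). Return j ps l) ` ?B" (is "_ \<subseteq> ?R")
  proof
    fix st assume "st \<in> Collect legal"
    then show "st \<in> ?R" by (cases st) (force simp: image_iff)+
  qed
  then show ?thesis by (rule finite_subset) (intro finite_UnI finite_imageI fin)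
qed

lemma pend_Nil [simp]: "[] \<in> pend"
  by (auto simp: pend_def)

lemma pend_Cons: "p # ps \<in> pend \<Longrightarrow> fst p < K \<and> ps \<in> pend"
  by (auto simp: pend_def)

lemma code_ok:
  assumes "l \<in> L" "code P l = (r, g)"
  shows "r < K" "g s = (ps, l') \<Longrightarrow> l' \<in> L \<and> ps \<in> pend"
proof -
  have "case code P l of (r, g) \<Rightarrow> r < K \<and>
        (\<forall>s. case g s of (ps, l') \<Rightarrow> l' \<in> L \<and> set ps \<subseteq> {..<K} \<times> UNIV)"
    using wf[unfolded wf_smach_def] assms(1) by (elim conjE) (erule bspec)
  then have *: "r < K" "\<forall>s. case g s of (ps, l') \<Rightarrow> l' \<in> L \<and> set ps \<subseteq> {..<K} \<times> UNIV"
    by (simp_all add: assms(2))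
  show "r < K" by (fact *)
  show "l' \<in> L \<and> ps \<in> pend" if "g s = (ps, l')"
    using spec[OF *(2), of s] that pushes_le[OF assms that] by (auto simp: pend_def)
qed

lemma legal_home: "l \<in> L \<Longrightarrow> ps \<in> pend \<Longrightarrow> legal (home P ps l)"
  using code_ok(1)[of l] pend_Cons[of "hd ps" "tl ps"]
  by (cases "code P l"; cases ps) (auto simp: home_def less_imp_le)

lemma legal_micro:
  assumes "legal st"
  shows "legal (fst (micro P K st s))"
proof (cases "(P, K, st, s)" rule: micro.cases)
  case (2 P' K' p ps l s)
  from 2 have "st = Walk 0 (p # ps) l" by simp
  then show ?thesis using assms pend_Cons[of p ps] by auto
next
  case (3 P' K' l s')
  obtain r g where rg: "code P l = (r, g)" by fastforce
  obtain ps l' where g: "g s = (ps, l')" by fastforce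
  from 3 have "st = Walk 0 [] l" "s' = s" by auto
  then show ?thesis
    using assms code_ok(1)[OF _ rg] code_ok(2)[OF _ rg g] rg g by auto
qed (use assms in \<open>auto simp: legal_home\<close>)

definition enc :: "'l st \<Rightarrow> nat" where
  "enc = (SOME h. bij_betw h (Collect legal) {0..<card (Collect legal)})"

lemma enc_bij: "bij_betw enc (Collect legal) {0..<card (Collect legal)}"
  unfolding enc_def using ex_bij_betw_finite_nat[OF finite_legal] by (rule someI_ex)

lemma enc_inj [simp]: "legal s \<Longrightarrow> legal s' \<Longrightarrow> enc s = enc s' \<longleftrightarrow> s = s'"
  using enc_bij by (auto simp: bij_betw_def inj_on_def)

lemma enc_less: "legal s \<Longrightarrow> enc s < card (Collect legal)"
  using enc_bij by (auto simp: bij_betw_def)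

definition machine :: otm where
  "machine = \<lparr> n_states = card (Collect legal),
     delta = (\<lambda>q s. case micro P K (inv_into (Collect legal) enc q) s of (st, s', m) \<Rightarrow> (enc st, s', m)),
     q_start = enc (home P [] (l_start P)), q_query = enc (home P [] (l_query P)),
     q_yes = enc (home P [] (l_yes P)), q_no = enc (home P [] (l_no P)),
     q_out0 = enc (home P [] (l_out0 P)), q_out1 = enc (home P [] (l_out1 P)) \<rparr>"

lemma labels_in [simp]:
  "l_start P \<in> L" "l_query P \<in> L" "l_yes P \<in> L" "l_no P \<in> L" "l_out0 P \<in> L" "l_out1 P \<in> L"
  and K_pos: "0 < K"
  and labels_neq: "l_out0 P \<noteq> l_out1 P" "l_query P \<noteq> l_out0 P" "l_query P \<noteq> l_out1 P"
  using wf by (auto simp: wf_smach_def)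

lemma home_inj [simp]: "home P ps l = home P ps' l' \<longleftrightarrow> ps = ps' \<and> l = l'"
  by (auto simp: home_def)

lemma wf_machine: "wf_otm machine"
proof -
  have "inv_into (Collect legal) enc q \<in> Collect legal" if "q < card (Collect legal)" for q
    using that enc_bij by (intro inv_into_into) (auto simp: bij_betw_def)
  then have "fst (delta machine q s) < n_states machine" if "q < n_states machine" for q s
    using that legal_micro[of "inv_into (Collect legal) enc q" s]
    by (auto simp: machine_def enc_less split: prod.split)
  then show ?thesis
    using labels_neq unfolding wf_otm_def
    by (auto simp: machine_def legal_home intro!: enc_less)
qed

section \<open>Sweeps of the compiled machine over the layout\<close>

definition active :: "'l \<Rightarrow> bool" where
  "active l \<longleftrightarrow> l \<notin> {l_out0 P, l_out1 P, l_query P}"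

text \<open>The \<open>home\<close> states of output and query labels are the special states of
  \<open>machine\<close>, to which \<open>delta\<close> is not applied; \<open>busy\<close> excludes
  them.\<close>

definition busy :: "'l st \<Rightarrow> bool" where
  "busy st \<longleftrightarrow> legal st \<and> (\<forall>j l. st = Walk j [] l \<longrightarrow> active l)"

fun loc :: "'l st \<times> bool option list \<times> bool option list \<Rightarrow> config \<Rightarrow> bool" where
  "loc (st, ls, rs) = cfg (enc st) ls rs"

definition goes :: "problem \<Rightarrow> 'l st \<times> bool option list \<times> bool option list \<Rightarrow> nat \<Rightarrow>
    'l st \<times> bool option list \<times> bool option list \<Rightarrow> bool" where
  "goes \<psi> a k b \<longleftrightarrow> (\<forall>c. loc a c \<longrightarrow> ensures (succs \<psi> machine) (loc b) k c)"

lemma goes_refl: "goes \<psi> a k a"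
  by (auto simp: goes_def intro: ensures_here)

lemma goes_trans: "goes \<psi> a j b \<Longrightarrow> goes \<psi> b k c \<Longrightarrow> goes \<psi> a (j + k) c"
  unfolding goes_def by (blast intro: ensures_trans)

lemma goes_mono: "goes \<psi> a j b \<Longrightarrow> j \<le> k \<Longrightarrow> goes \<psi> a k b"
  unfolding goes_def by (blast intro: ensures_mono)

lemma goes_step:
  assumes "busy st"
    and "goes \<psi> (case micro P K st (hd0 rs) of (st', s', m) \<Rightarrow> (st', shift m s' ls (tl rs))) k b"
  shows "goes \<psi> (st, ls, rs) (Suc k) b"
proof -
  obtain st' s' m where mi: "micro P K st (hd0 rs) = (st', s', m)" by (metis prod_cases3)
  obtain ls' rs' where sh: "shift m s' ls (tl rs) = (ls', rs')" by fastforce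
  have lg: "legal st" using assms(1) by (simp add: busy_def)
  have inv: "inv_into (Collect legal) enc (enc st) = st"
    using lg enc_bij by (intro inv_into_f_f) (auto simp: bij_betw_def)
  have ne: "st \<noteq> home P [] l" if "l \<in> {l_out0 P, l_out1 P, l_query P}" for l
    using assms(1) that by (auto simp: busy_def active_def home_def)
  have "\<exists>c'. succs \<psi> machine c = {c'} \<and> cfg (enc st') ls' rs' c'" if "cfg (enc st) ls rs c" for c
    by (rule succs_cfg[OF that _ _ _ _ sh])
      (use lg ne in \<open>auto simp: machine_def legal_home inv mi\<close>)
  then show ?thesis
    using assms(2) by (fastforce simp: goes_def mi sh)
qed

lemma goes_walk1:
  assumes "busy (Walk (Suc j) ps l)"
  shows "goes \<psi> (Walk (Suc j) ps l, ls, map Some x @ None # ws) (Suc (length x))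
    (Walk j ps l, None # rev (map Some x) @ ls, ws)"
proof (induction x arbitrary: ls)
  case Nil
  show ?case by (rule goes_step[OF assms]) (simp add: goes_refl)
next
  case (Cons b x)
  show ?case by (simp, rule goes_step[OF assms]) (use Cons in simp)
qed

lemma goes_walk:
  assumes "busy (Walk (length xs) ps l)"
  shows "goes \<psi> (Walk (length xs) ps l, ls, layout xs @ ws) (length (layout xs))
    (Walk 0 ps l, rev (layout xs) @ ls, ws)"
  using assms
proof (induction xs arbitrary: ls)
  case Nil
  show ?case by (simp add: goes_refl)
next
  case (Cons x xs)
  have "busy (Walk (length xs) ps l)" using Cons.prems by (auto simp: busy_def)
  from goes_trans[OF goes_walk1[OF Cons.prems[simplified]] Cons.IH[OF this]]
  show ?case by simp
qed

text \<open>The counter starts with the number of blanks at or left of the head, so it is 0 exactly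
  when the head steps onto the blank in front of the layout.\<close>

lemma goes_return:
  assumes "legal (Return (blanks (a # ls)) ps l)"
  shows "goes \<psi> (Return (blanks (a # ls)) ps l, ls, a # rs) (length ls + 2)
    (home P ps l, [], rev ls @ a # rs)"
  using assms
proof (induction ls arbitrary: a rs)
  case Nil
  \<comment> \<open>Turning back at the left end leaves an explicit blank in the left list, which is
    mere padding.\<close>
  have pad: "goes \<psi> (home P ps l, [None], a # rs) 0 (home P ps l, [], a # rs)"
    by (auto simp: goes_def)
  have "goes \<psi> (Return 0 ps l, [], None # a # rs) (Suc 0) (home P ps l, [], a # rs)"
    by (rule goes_step) (use Nil pad in \<open>auto simp: busy_def\<close>)
  then show ?case
    using Nil by (cases a) (auto intro!: goes_step[where k = "Suc 0"] simp: busy_def)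
next
  case (Cons s ls)
  have "legal (Return (blanks (s # ls)) ps l)" using Cons.prems by (cases a) auto
  from Cons.IH[OF this, of "a # rs"] Cons.prems show ?case
    by (cases a) (auto intro!: goes_step[where k = "Suc (Suc (length ls))"] simp: busy_def)
qed

text \<open>Every cell is exchanged with the carried symbol. The last blank of the layout is
  overwritten too; whatever follows it must supply the new one.\<close>

lemma goes_insert:
  assumes "legal (Insert a (Suc (blanks U)) ps l)"
  shows "goes \<psi> (Insert a (Suc (blanks U)) ps l, ls, U @ None # ws) (Suc (length U))
    (Return K ps l, rev U @ a # ls, ws)"
  using assms
proof (induction U arbitrary: a ls)
  case Nil
  show ?case by (rule goes_step) (use Nil in \<open>auto simp: busy_def goes_refl\<close>)
next
  case (Cons s U)
  have "legal (Insert s (Suc (blanks U)) ps l)" using Cons.prems by (cases s) auto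
  from Cons.IH[OF this, of "a # ls"] Cons.prems show ?case
    by (cases s) (auto intro!: goes_step[where k = "Suc (length U)"] simp: busy_def)
qed

text \<open>\<open>x\<close> is the cell to be deleted: \<open>U\<close> and its final blank move
  one place to the left, at three steps per cell, and the old final blank stays behind as
  padding.\<close>

lemma goes_fetch:
  assumes "legal (Fetch (Suc (blanks U)) ps l)"
  shows "goes \<psi> (Fetch (Suc (blanks U)) ps l, x # ls, U @ None # ws) (3 * length U + 2)
    (Return K ps l, rev U @ ls, None # None # ws)"
  using assms
proof (induction U arbitrary: x ls)
  case Nil
  have "goes \<psi> (Store None (Suc 0) ps l, ls, x # None # ws) (Suc 0) (Return K ps l, ls, None # None # ws)"
    by (rule goes_step) (use Nil in \<open>auto simp: busy_def goes_refl\<close>)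
  then show ?case 
    using Nil by (auto intro!: goes_step[where k = "Suc 0"] simp: busy_def)
next
  case (Cons s U)
  have lg: "legal (Fetch (Suc (blanks U)) ps l)" using Cons.prems by (cases s) auto
  have "goes \<psi> (Next (Suc (blanks U)) ps l, s # ls, s # U @ None # ws) (Suc (3 * length U + 2))
    (Return K ps l, rev U @ s # ls, None # None # ws)"
    by (rule goes_step) (use Cons.IH[OF lg] lg in \<open>auto simp: busy_def\<close>)
  then have "goes \<psi> (Store s (blanks (s # U) + 1) ps l, ls, x # s # U @ None # ws)
     (Suc (Suc (3 * length U + 2))) (Return K ps l, rev U @ s # ls, None # None # ws)"
    by (intro goes_step) (use lg Cons.prems in \<open>cases s; auto simp: busy_def\<close>)+
  then have "goes \<psi> (Fetch (Suc (blanks (s # U))) ps l, x # ls, s # U @ None # ws)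
      (Suc (Suc (Suc (3 * length U + 2)))) (Return K ps l, rev U @ s # ls, None # None # ws)"
    by (intro goes_step) (use Cons.prems in \<open>auto simp: busy_def\<close>)
  then show ?case by (simp add: goes_mono)
qed

lemma loc_pad: "loc (st, ls, []) = loc (st, ls, [None])" "loc (st, ls, rs @ [None]) = loc (st, ls, rs)"
  by (auto simp: cfg_pad_right)

text \<open>\<open>U\<close> is the layout from register \<open>r\<close> on, without its final
  blank. In this form a push puts a cell in front of \<open>U\<close> and a pop removes the first
  cell of \<open>U\<close>.\<close>

lemma layout_split:
  assumes "r < K" "length regs = K"
  obtains U where "layout (drop r regs) = U @ [None]" "blanks U = K - Suc r"
    "layout regs = layout (take r regs) @ U @ [None]"
    "\<And>b. layout (push (r, b) regs) = layout (take r regs) @ Some b # U @ [None]"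
    "\<And>b w. regs ! r = b # w \<Longrightarrow> \<exists>U'. U = Some b # U' \<and>
        layout (regs[r := w]) = layout (take r regs) @ U' @ [None]"
    "regs ! r = [] \<Longrightarrow> hd (U @ [None]) = None"
proof -
  define D where "D = layout (drop (Suc r) regs)"
  have d: "drop r regs = regs ! r # drop (Suc r) regs" using assms by (simp add: Cons_nth_drop_Suc)
  have "layout (drop r regs) = butlast (layout (drop r regs)) @ [None]"
    using assms by (intro layout_butlast) simp
  then obtain U where U: "layout (drop r regs) = U @ [None]" by blast
  then have mU: "map Some (regs ! r) @ None # D = U @ [None]"
    unfolding d by (simp add: D_def)
  have upd: "layout (regs[r := w]) = layout (take r regs) @ map Some w @ None # D" for w
    using assms by (simp add: upd_conv_take_nth_drop D_def)
  show ?thesis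
  proof (rule that[OF U])
    have "blanks (U @ [None]) = K - r" using assms by (simp flip: U)
    then show "blanks U = K - Suc r" by simp
    show "layout regs = layout (take r regs) @ U @ [None]"
      by (metis U append_take_drop_id layout_simps(3))
    show "layout (push (r, b) regs) = layout (take r regs) @ Some b # U @ [None]" for b
      by (simp add: push_def upd mU)
    show "\<exists>U'. U = Some b # U' \<and> layout (regs[r := w]) = layout (take r regs) @ U' @ [None]"
      if "regs ! r = b # w" for b w
      using mU that upd[of w] by (cases U) auto
    show "hd (U @ [None]) = None" if "regs ! r = []"
      by (simp flip: mU add: that)
  qed
qed

lemma goes_push:
  assumes "p # ps \<in> pend" "l \<in> L" "length regs = K"
  shows "goes \<psi> (home P (p # ps) l, [], layout regs) (2 * length (layout regs) + 5)
    (home P ps l, [], layout (push p regs))"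
proof -
  obtain r b where p: "p = (r, b)" by (cases p)
  have r: "r < K" and ps: "ps \<in> pend" using pend_Cons[OF assms(1)] by (auto simp: p)
  obtain U where U: "layout (drop r regs) = U @ [None]" "blanks U = K - Suc r"
    "layout regs = layout (take r regs) @ U @ [None]"
    "layout (push (r, b) regs) = layout (take r regs) @ Some b # U @ [None]"
    using layout_split[OF r assms(3)] by metis
  let ?T = "take r regs"
  have len: "length ?T = r" using r assms(3) by simp
  have bl: "Suc (blanks U) = K - r" using U(2) r by simp
  have busyW: "busy (Walk j (p # ps) l)" if "j \<le> r" for j
    using that r assms by (simp add: busy_def)
  have 1: "goes \<psi> (home P (p # ps) l, [], layout regs) (length (layout ?T))
      (Walk 0 (p # ps) l, rev (layout ?T), U @ [None])"
    using goes_walk[of ?T "p # ps" l \<psi> "[]" "U @ [None]"] busyW[of r] len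
    by (simp add: home_def p U(3))
  have "goes \<psi> (Insert (Some b) (Suc (blanks U)) ps l, rev (layout ?T), U @ None # []) (Suc (length U))
      (Return K ps l, rev U @ Some b # rev (layout ?T), [])"
    by (rule goes_insert) (use ps assms bl in auto)
  then have 2: "goes \<psi> (Walk 0 (p # ps) l, rev (layout ?T), U @ [None]) (Suc (Suc (length U)))
      (Return K ps l, rev U @ Some b # rev (layout ?T), [])"
    by (intro goes_step; cases U) (use busyW[of 0] bl in \<open>auto simp: p\<close>)
  \<comment> \<open>The blank under the head replaces the final blank lost in the insertion, so the
    count to the left is \<open>K\<close> again.\<close>
  have K: "blanks (None # rev U @ Some b # rev (layout ?T)) = K"
    using bl len r by simp
  have "goes \<psi> (Return K ps l, rev U @ Some b # rev (layout ?T), [None])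
     (length (rev U @ Some b # rev (layout ?T)) + 2) (home P ps l, [], layout (push p regs))"
    using goes_return[of None "rev U @ Some b # rev (layout ?T)" ps l \<psi> "[]", unfolded K] ps assms(2) U(4)
    by (simp add: p)
  then have 3: "goes \<psi> (Return K ps l, rev U @ Some b # rev (layout ?T), [])
     (length (rev U @ Some b # rev (layout ?T)) + 2) (home P ps l, [], layout (push p regs))"
    by (simp only: goes_def loc_pad(1))
  show ?thesis
    by (rule goes_mono[OF goes_trans[OF goes_trans[OF 1 2] 3]]) (simp add: U(3))
qed

text \<open>The walk and the return cost one step per cell and the shift three, which gives the
  factor 5.\<close>

lemma goes_pop:
  assumes "l \<in> L" "active l" "length regs = K" "code P l = (r, g)" "g (top (regs ! r)) = (ps, l')"
  shows "goes \<psi> (home P [] l, [], layout regs) (5 * length (layout regs) + 5)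
    (home P ps l', [], layout (regs[r := tl (regs ! r)]))"
proof -
  have r: "r < K" and ps: "ps \<in> pend" and l': "l' \<in> L" 
    using code_ok[OF assms(1,4)] assms(5) by auto
  obtain U where U: "layout (drop r regs) = U @ [None]" "blanks U = K - Suc r"
    "layout regs = layout (take r regs) @ U @ [None]"
    "\<And>b w. regs ! r = b # w \<Longrightarrow> \<exists>U'. U = Some b # U' \<and>
        layout (regs[r := w]) = layout (take r regs) @ U' @ [None]"
    "regs ! r = [] \<Longrightarrow> hd (U @ [None]) = None"
    using layout_split[OF r assms(3)] by metis
  let ?T = "take r regs"
  have len: "length ?T = r" using r assms(3) by simp
  have bl: "Suc (blanks U) = K - r" using U(2) r by simp
  have busyW: "busy (Walk j [] l)" if "j \<le> r" for j
    using that r assms by (simp add: busy_def)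
  have 1: "goes \<psi> (home P [] l, [], layout regs) (length (layout ?T))
      (Walk 0 [] l, rev (layout ?T), U @ [None])"
    using goes_walk[of ?T "[]" l \<psi> "[]" "U @ [None]"] busyW[of r] len
    by (simp add: home_def assms(4) U(3))
  show ?thesis
  proof (cases "regs ! r")
    case Nil
    then obtain V where V: "U @ [None] = None # V" using U(5) by (cases "U @ [None]") auto
    have same: "regs[r := tl (regs ! r)] = regs" using Nil by (metis list.sel(2) list_update_id)
    \<comment> \<open>The head stands on the blank of the empty register \<open>r\<close> itself,
      hence one more than the blanks of the registers before it.\<close>
    have R: "blanks (None # rev (layout ?T)) = Suc r" using len by simp
    have "goes \<psi> (Return (Suc r) ps l', rev (layout ?T), None # V)
       (length (rev (layout ?T)) + 2) (home P ps l', [], layout regs)"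
      using goes_return[of None "rev (layout ?T)" ps l' \<psi> V, unfolded R] ps l' r U(3) V by simp
    then have 2: "goes \<psi> (Walk 0 [] l, rev (layout ?T), U @ [None])
       (Suc (length (rev (layout ?T)) + 2)) (home P ps l', [], layout regs)"
      by (intro goes_step) (use busyW[of 0] assms(4,5) Nil V in auto)
    show ?thesis
      unfolding same by (rule goes_mono[OF goes_trans[OF 1 2]]) (simp add: U(3))
  next
    case (Cons b w)
    then obtain U' where U': "U = Some b # U'" "layout (regs[r := w]) = layout ?T @ U' @ [None]"
      using U(4) by blast
    have bl': "Suc (blanks U') = K - r" using bl U'(1) by simp
    have "goes \<psi> (Fetch (Suc (blanks U')) ps l', Some b # rev (layout ?T), U' @ None # [])
        (3 * length U' + 2) (Return K ps l', rev U' @ rev (layout ?T), [None, None])"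
      by (rule goes_fetch) (use ps l' bl' in auto)
    then have 2: "goes \<psi> (Walk 0 [] l, rev (layout ?T), U @ [None])
        (Suc (3 * length U' + 2)) (Return K ps l', rev U' @ rev (layout ?T), [None, None])"
      by (intro goes_step) (use busyW[of 0] assms(4,5) Cons U' bl' in auto)
    have K: "blanks (None # rev U' @ rev (layout ?T)) = K" using bl' len r by simp
    have "goes \<psi> (Return K ps l', rev U' @ rev (layout ?T), [None, None])
       (length (rev U' @ rev (layout ?T)) + 2) (home P ps l', [], layout (regs[r := w]) @ [None])"
      using goes_return[of None "rev U' @ rev (layout ?T)" ps l' \<psi> "[None]", unfolded K] ps l' U'(2)
      by simp
    then have 3: "goes \<psi> (Return K ps l', rev U' @ rev (layout ?T), [None, None])
       (length (rev U' @ rev (layout ?T)) + 2) (home P ps l', [], layout (regs[r := w]))"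
      by (simp only: goes_def loc_pad(2))
    show ?thesis
      using goes_mono[OF goes_trans[OF goes_trans[OF 1 2] 3], of "5 * length (layout regs) + 5"]
      by (simp add: Cons U(3) U'(1))
  qed
qed

lemma length_layout_push: "r < length regs \<Longrightarrow> length (layout (push (r, b) regs)) = Suc (length (layout regs))"
  by (simp add: push_def upd_conv_take_nth_drop)
     (metis Cons_nth_drop_Suc append_take_drop_id id_take_nth_drop layout_simps(2,3) length_append length_Cons length_map add_Suc_right)

lemma length_layout_pop: "r < length regs \<Longrightarrow> length (layout (regs[r := tl (regs ! r)])) \<le> length (layout regs)"
  by (subst (2) id_take_nth_drop[of r regs]) (auto simp: upd_conv_take_nth_drop)

lemma goes_pushes:
  assumes "ps \<in> pend" "l \<in> L" "length regs = K" "length (layout regs) + length ps \<le> B"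
  shows "goes \<psi> (home P ps l, [], layout regs) (length ps * (5 * B + 5))
    (home P [] l, [], layout (fold push ps regs))"
  using assms
proof (induction ps arbitrary: regs)
  case Nil
  show ?case by (simp add: goes_refl)
next
  case (Cons p ps)
  have p: "fst p < K" "ps \<in> pend" using pend_Cons[OF Cons.prems(1)] by auto
  have "length (layout (push p regs)) = Suc (length (layout regs))"
    using length_layout_push[of "fst p" regs "snd p"] p Cons.prems(3) by simp
  then have 1: "goes \<psi> (home P ps l, [], layout (push p regs)) (length ps * (5 * B + 5))
      (home P [] l, [], layout (fold push (p # ps) regs))"
    using Cons.IH[of "push p regs"] Cons.prems p by simp
  show ?case
    by (rule goes_mono[OF goes_trans[OF goes_push[OF Cons.prems(1-3)] 1]]) (use Cons.prems(4) in simp)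
qed

text \<open>One pop and at most \<open>W\<close> pushes, each linear in a length bound
  \<open>B\<close> that already allows for these pushes.\<close>

lemma goes_sstep:
  assumes "l \<in> L" "active l" "length regs = K" "length (layout regs) + W \<le> B"
    and "sstep P (l, regs) = (l', regs')"
  shows "goes \<psi> (home P [] l, [], layout regs) (Suc W * (5 * B + 5)) (home P [] l', [], layout regs')"
    and "l' \<in> L" and "length regs' = K" and "length (layout regs') \<le> length (layout regs) + W"
proof -
  obtain r g where rg: "code P l = (r, g)" by fastforce
  obtain ps l'' where g: "g (top (regs ! r)) = (ps, l'')" by fastforce
  have eq: "l'' = l'" "regs' = fold push ps (regs[r := tl (regs ! r)])"
    using assms(5) by (auto simp: sstep_def rg g)
  have r: "r < K" and l': "l' \<in> L" "ps \<in> pend"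
    using code_ok[OF assms(1) rg] g eq by auto
  have W: "length ps \<le> W" using l'(2) by (simp add: pend_def)
  have le: "length (layout (regs[r := tl (regs ! r)])) \<le> length (layout regs)"
    using length_layout_pop r assms(3) by simp
  have "goes \<psi> (home P ps l', [], layout (regs[r := tl (regs ! r)])) (length ps * (5 * B + 5))
     (home P [] l', [], layout regs')"
    unfolding eq by (rule goes_pushes) (use l' W le assms in auto)
  then have "goes \<psi> (home P [] l, [], layout regs) (5 * length (layout regs) + 5 + length ps * (5 * B + 5))
     (home P [] l', [], layout regs')"
    using goes_trans[OF goes_pop[OF assms(1-3) rg] ] g eq by auto
  moreover have "5 * length (layout regs) + 5 + length ps * (5 * B + 5) \<le> Suc W * (5 * B + 5)"
    using assms(4) W by (simp add: add_mono mult_le_mono1 del: mult_Suc_right add_mult_distrib2 )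
  ultimately show "goes \<psi> (home P [] l, [], layout regs) (Suc W * (5 * B + 5)) (home P [] l', [], layout regs')"
    by (rule goes_mono)
  show "l' \<in> L" "length regs' = K" using l' assms(3) by (auto simp: eq)
  have "length (layout (fold push qs rs)) = length (layout rs) + length qs"
    if "length rs = K" "qs \<in> pend" for qs rs
    using that
  proof (induction qs arbitrary: rs)
    case (Cons q qs)
    then show ?case 
      using pend_Cons[of q qs] length_layout_push[of "fst q" rs "snd q"] by simp
  qed simp
  from this[of "regs[r := tl (regs ! r)]" ps] show "length (layout regs') \<le> length (layout regs) + W"
    using le l'(2) W assms(3) by (simp add: eq)
qed

section \<open>Simulation of whole runs\<close>

lemma cfg_pad_replicate: "cfg q ls (rs @ replicate k None) = cfg q ls rs"
proof (induction k)
  case (Suc k)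
  have "rs @ replicate (Suc k) None = (rs @ replicate k None) @ [None]"
    by (simp add: replicate_append_same)
  then show ?case using Suc cfg_pad_right by metis
qed simp

text \<open>This is why queries are made on register 0: at the home position it is the query string
  without any preparation.\<close>

lemma takeWhile_layout:
  "regs \<noteq> [] \<Longrightarrow> map the (takeWhile (\<lambda>s. s \<noteq> None) (layout regs)) = regs ! 0"
proof -
  have "takeWhile (\<lambda>s. s \<noteq> None) (map Some w @ None # xs) = map Some w" for w :: "bool list" and xs
    by (induction w) auto
  then show "regs \<noteq> [] \<Longrightarrow> ?thesis" by (cases regs) (simp_all add: comp_def del: not_None_eq)
qed

text \<open>The relation \<open>R\<close> reserves \<open>W\<close> cells for every source step
  still allowed; hence one bound \<open>B\<close> on the layout serves the whole run.\<close>

lemma machine_simulates: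
  assumes "ensures (ssuccs \<psi> P) (saccepts P A) t (l_start P, x # replicate (K - 1) [])"
    and "B = length x + K + t * W"
  shows "ensures (succs \<psi> machine) (accepts machine A) (t * (Suc W * (5 * B + 5))) (init_config machine x)"
proof -
  define R where "R j lr c \<longleftrightarrow> (case lr of (l, regs) \<Rightarrow>
      loc (home P [] l, [], layout regs) c \<and> l \<in> L \<and> length regs = K \<and>
      length (layout regs) + j * W \<le> B)" for j lr c
  have sim: "ensures (succs \<psi> machine) (\<lambda>d'. \<exists>lr'\<in>ssuccs \<psi> P lr. R j lr' d') (Suc W * (5 * B + 5)) d"
    if R: "R (Suc j) lr d" and ne: "ssuccs \<psi> P lr \<noteq> {}" for j lr d
  proof -
    obtain l regs where lr: "lr = (l, regs)" by (cases lr)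
    have d: "loc (home P [] l, [], layout regs) d" "l \<in> L" "length regs = K"
      "length (layout regs) + (W + j * W) \<le> B" using R by (auto simp: R_def lr)
    have out: "l \<noteq> l_out0 P" "l \<noteq> l_out1 P" using ne by (auto simp: lr ssuccs_def)
    show ?thesis
    proof (cases "l = l_query P")
      case True
      have ss: "ssuccs \<psi> P lr = (\<lambda>y. (if y then l_yes P else l_no P, regs)) ` \<psi> (regs ! 0)"
        using out True by (simp add: ssuccs_def lr)
      have "regs \<noteq> []" using d(3) K_pos by auto
      note q = succs_cfg_query[OF d(1)[unfolded loc.simps], of machine, unfolded takeWhile_layout[OF this]]
      have h: "enc (home P [] l) \<noteq> q_out0 machine" "enc (home P [] l) \<noteq> q_out1 machine"
         "enc (home P [] l) = q_query machine"
        using out True d(2) by (auto simp: machine_def legal_home)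
      have "\<exists>lr'\<in>ssuccs \<psi> P lr. R j lr' d'" if d': "d' \<in> succs \<psi> machine d" for d'
      proof -
        from d' obtain y where y: "y \<in> \<psi> (regs ! 0)" "d' = (if y then q_yes machine else q_no machine, snd d)"
          unfolding q(1)[OF h] by blast
        then have "loc (home P [] (if y then l_yes P else l_no P), [], layout regs) d'"
          using q(2)[OF h, of y] by (cases y) (simp_all add: machine_def)
        then have "R j (if y then l_yes P else l_no P, regs) d'" using d by (simp add: R_def)
        then show ?thesis using y(1) unfolding ss by blast
      qed
      moreover have "succs \<psi> machine d \<noteq> {}" using ne unfolding q(1)[OF h] ss by blast
      ultimately have "ensures (succs \<psi> machine) (\<lambda>d'. \<exists>lr'\<in>ssuccs \<psi> P lr. R j lr' d') (Suc 0) d"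
        by simp
      then show ?thesis by (rule ensures_mono) auto
    next
      case False
      then have act: "active l" using out by (simp add: active_def)
      obtain l' regs' where st: "sstep P (l, regs) = (l', regs')" by fastforce
      have ss: "ssuccs \<psi> P lr = {(l', regs')}" using out False st by (simp add: ssuccs_def lr)
      have B: "length (layout regs) + W \<le> B" using d(4) by simp
      note g = goes_sstep[OF d(2) act d(3) B st]
      have "ensures (succs \<psi> machine) (loc (home P [] l', [], layout regs')) (Suc W * (5 * B + 5)) d"
        using g(1) d(1) unfolding goes_def by blast
      then show ?thesis
        by (rule ensures_mono) (use g(2-4) d(4) in \<open>auto simp: ss R_def\<close>)
    qed
  qed
  \<comment> \<open>Empty registers contribute only blanks, so the bare input is already the initial
    layout.\<close>
  have lay: "layout (x # replicate (K - 1) []) = map Some x @ replicate K None"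
  proof -
    have "layout (replicate k []) = replicate k None" for k by (induction k) auto
    then show ?thesis using K_pos by (cases K) auto
  qed
  have start: "q_start machine = enc (home P [] (l_start P))" by (simp add: machine_def)
  have "R t (l_start P, x # replicate (K - 1) []) (init_config machine x)"
    using cfg_init[of machine x] K_pos unfolding R_def prod.case loc.simps lay cfg_pad_replicate
    by (simp add: assms(2) start)
  from ensures_sim[where R = R, OF sim assms(1) this]
  show ?thesis
  proof (rule ensures_mono)
    fix c assume "\<exists>lr t'. saccepts P A lr \<and> R t' lr c"
    then show "accepts machine A c"
      by (auto simp: R_def saccepts_def accepts_def is_halting_def output_in_def cfg_def machine_def)
  qed auto
qed

end

theorem stack_machine_reduction:
  assumes wf: "wf_smach P L K"
    and run: "\<And>x. x \<noteq> [] \<Longrightarrow>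
      ensures (ssuccs \<psi> P) (saccepts P (\<phi> x)) (poly p (length x)) (l_start P, x # replicate (K - 1) [])"
  shows "\<phi> \<propto>\<^sub>T \<psi>"
proof -
  \<comment> \<open>There are finitely many pairs of label and symbol, so push lists have a maximal
    length, which serves as \<open>W\<close>.\<close>
  define F where "F = (\<lambda>(l, s). length (fst (snd (code P l) s))) ` (L \<times> UNIV)"
  have "finite F" using wf by (simp add: F_def wf_smach_def)
  have le: "length ps \<le> Max F" if "l \<in> L" "code P l = (r, g)" "g s = (ps, l')" for l r g s ps l'
  proof -
    have "length ps \<in> F" unfolding F_def
      by (rule image_eqI[of _ _ "(l, s)"]) (use that in auto)
    then show ?thesis using \<open>finite F\<close> by simp
  qed
  interpret stack_compiler P L K "Max F" by unfold_locales (use wf le in auto)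
  define q where "q = p * [:Suc (Max F):] * ([:5:] * ([:0, 1:] + [:K:] + p * [:Max F:]) + [:5:])"
  have "poly q (length x) = poly p (length x) * (Suc (Max F) *
      (5 * (length x + K + poly p (length x) * Max F) + 5))" for x :: "bool list"
    by (simp add: q_def algebra_simps)
  then have "solves_in_time machine q \<phi> \<psi>"
    unfolding solves_in_time_iff_ensures using machine_simulates[OF run refl] by simp
  then show ?thesis unfolding turing_reduces_def using wf_machine by blast
qed


section \<open>Step rules for runs of stack programs\<close>

declare ensures.simps(2) [simp del]

lemma ensures_sstep:
  assumes "l \<noteq> l_out0 P" "l \<noteq> l_out1 P" "l \<noteq> l_query P"
    and "ensures (ssuccs \<psi> P) Q t (sstep P (l, regs))"
  shows "ensures (ssuccs \<psi> P) Q (Suc t) (l, regs)"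
  using assms by (intro ensures_step) (simp_all add: ssuccs_def)

lemma ensures_ask:
  assumes "l_query P \<noteq> l_out0 P" "l_query P \<noteq> l_out1 P" "\<psi> (regs ! 0) \<noteq> {}"
    and "\<And>y. y \<in> \<psi> (regs ! 0) \<Longrightarrow>
      ensures (ssuccs \<psi> P) Q t (if y then l_yes P else l_no P, regs)"
  shows "ensures (ssuccs \<psi> P) Q (Suc t) (l_query P, regs)"
proof -
  have "ssuccs \<psi> P (l_query P, regs) = (\<lambda>y. (if y then l_yes P else l_no P, regs)) ` \<psi> (regs ! 0)"
    using assms(1,2) by (simp add: ssuccs_def)
  then show ?thesis using assms(3,4) by (simp add: ensures.simps(2))
qed

lemma poly_nat_mono: "x \<le> y \<Longrightarrow> poly p x \<le> poly (p :: nat poly) y"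
  by (induction p) (auto simp: intro!: add_mono mult_mono)


subsection \<open>Replacing an oracle by a subroutine\<close>

text \<open>A subroutine gets its query in register 0 and must leave registers 0 to 3 empty. Registers 4
  and 5 belong to the caller: they hold the tape to the left of the head (reversed) and from the
  head onwards, two bits per cell.\<close>

definition answers :: "'s smach \<Rightarrow> problem \<Rightarrow> problem \<Rightarrow> nat poly \<Rightarrow> bool" where
  "answers S \<psi> \<phi> q \<longleftrightarrow> (\<forall>s u v. ensures (ssuccs \<psi> S)
     (\<lambda>c. \<exists>y\<in>\<phi> s. c = (if y then l_out1 S else l_out0 S, [[], [], [], [], u, v]))
     (poly q (length s)) (l_start S, [s, [], [], [], u, v]))"

text \<open>Registers hold two symbols, the tape three. The first bit tells whether the cell is
  nonblank; an exhausted register is read as a blank, as in \<open>cell\<close>.\<close>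

fun bits :: "bool option \<Rightarrow> bool list" where
  "bits None = [False, False]"
| "bits (Some b) = [True, b]"

definition codes :: "bool option list \<Rightarrow> bool list" where
  "codes xs = concat (map bits xs)"

lemma codes_simps [simp]:
  "codes [] = []" "codes (x # xs) = bits x @ codes xs" "codes (xs @ ys) = codes xs @ codes ys"
  by (auto simp: codes_def)

definition push_cell :: "nat \<Rightarrow> bool option \<Rightarrow> (nat \<times> bool) list" where
  "push_cell r s = map (Pair r) (rev (bits s))"

text \<open>\<open>Load\<close> and \<open>Spread\<close> turn the input into cells on register 5.
  \<open>Read q\<close> is state \<open>q\<close> of the simulated machine, and
  \<open>Move q\<close> completes a left move by fetching a cell from register 4. At the query
  state, \<open>Read\<close> and \<open>Extract\<close> alternate to collect the query in register
  1; \<open>Restore\<close> puts it back and copies it to register 0.\<close>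

datatype 's sim =
    Load | Spread | Read nat | Read_Val nat bool | Move nat | Move_Val nat bool
  | Extract | Restore | Sub 's

fun act :: "nat \<times> bool option \<times> move \<Rightarrow> (nat \<times> bool) list \<times> 's sim" where
  "act (q, s, MStay) = (push_cell 5 s, Read q)"
| "act (q, s, MRight) = (push_cell 4 s, Read q)"
| "act (q, s, MLeft) = (push_cell 5 s, Move q)"

fun sim_code :: "otm \<Rightarrow> 's smach \<Rightarrow> 's sim \<Rightarrow> nat \<times> (bool option \<Rightarrow> (nat \<times> bool) list \<times> 's sim)" where
  "sim_code M S Load = (0, \<lambda>s. case s of None \<Rightarrow> ([], Spread) | Some b \<Rightarrow> ([(1, b)], Load))"
| "sim_code M S Spread =
     (1, \<lambda>s. case s of None \<Rightarrow> ([], Read (q_start M)) | Some b \<Rightarrow> (push_cell 5 (Some b), Spread))"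
| "sim_code M S (Read q) = (5, \<lambda>s.
     if q = q_query M then
       (case s of None \<Rightarrow> ([], Restore) | Some f \<Rightarrow> if f then ([], Extract) else ([(5, f)], Restore))
     else (case s of None \<Rightarrow> act (delta M q None) | Some f \<Rightarrow> ([], Read_Val q f)))"
| "sim_code M S (Read_Val q f) = (5, \<lambda>s. act (delta M q (if f then s else None)))"
| "sim_code M S (Move q) =
     (4, \<lambda>s. case s of None \<Rightarrow> (push_cell 5 None, Read q) | Some f \<Rightarrow> ([], Move_Val q f))"
| "sim_code M S (Move_Val q f) = (4, \<lambda>s. (push_cell 5 (if f then s else None), Read q))"
| "sim_code M S Extract =
     (5, \<lambda>s. case s of None \<Rightarrow> ([], Restore) | Some b \<Rightarrow> ([(1, b)], Read (q_query M)))"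
| "sim_code M S Restore = (1, \<lambda>s. case s of None \<Rightarrow> ([], Sub (l_start S))
     | Some b \<Rightarrow> (push_cell 5 (Some b) @ [(0, b)], Restore))"
| "sim_code M S (Sub l) =
     (if l = l_out0 S then (0, \<lambda>s. ([], Read (q_no M)))
      else if l = l_out1 S then (0, \<lambda>s. ([], Read (q_yes M)))
      else (case code S l of (r, g) \<Rightarrow> (r, \<lambda>s. map_prod id Sub (g s))))"

definition sim :: "otm \<Rightarrow> 's smach \<Rightarrow> 's sim smach" where
  "sim M S = \<lparr> code = sim_code M S, l_start = Load, l_query = Sub (l_query S),
     l_yes = Sub (l_yes S), l_no = Sub (l_no S), l_out0 = Read (q_out0 M), l_out1 = Read (q_out1 M) \<rparr>"

lemma sim_sel [simp]:
  "code (sim M S) = sim_code M S" "l_start (sim M S) = Load" "l_query (sim M S) = Sub (l_query S)"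
  "l_yes (sim M S) = Sub (l_yes S)" "l_no (sim M S) = Sub (l_no S)"
  "l_out0 (sim M S) = Read (q_out0 M)" "l_out1 (sim M S) = Read (q_out1 M)"
  by (simp_all add: sim_def)

definition sim_labels :: "otm \<Rightarrow> 's set \<Rightarrow> 's sim set" where
  "sim_labels M L = {Load, Spread, Extract, Restore} \<union> Read ` {..<n_states M} \<union> Move ` {..<n_states M} \<union>
     (\<lambda>(q, f). Read_Val q f) ` ({..<n_states M} \<times> UNIV) \<union>
     (\<lambda>(q, f). Move_Val q f) ` ({..<n_states M} \<times> UNIV) \<union> Sub ` L"

lemma sim_labels_iff:
  "Load \<in> sim_labels M L" "Spread \<in> sim_labels M L" "Extract \<in> sim_labels M L"
  "Restore \<in> sim_labels M L"
  "Read q \<in> sim_labels M L \<longleftrightarrow> q < n_states M" "Move q \<in> sim_labels M L \<longleftrightarrow> q < n_states M"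
  "Read_Val q f \<in> sim_labels M L \<longleftrightarrow> q < n_states M"
  "Move_Val q f \<in> sim_labels M L \<longleftrightarrow> q < n_states M" "Sub l \<in> sim_labels M L \<longleftrightarrow> l \<in> L"
  by (auto simp: sim_labels_def)

lemma set_push_cell: "set (push_cell r s) \<subseteq> {r} \<times> UNIV"
  by (auto simp: push_cell_def)

lemma wf_sim:
  assumes M: "wf_otm M" and S: "wf_smach S L 6"
  shows "wf_smach (sim M S) (sim_labels M L) 6"
proof -
  let ?ok = "\<lambda>(ps, l'). l' \<in> sim_labels M L \<and> set ps \<subseteq> {..<6} \<times> (UNIV :: bool set)"
  have q: "q_start M < n_states M" "q_query M < n_states M" "q_yes M < n_states M"
    "q_no M < n_states M" "q_out0 M < n_states M" "q_out1 M < n_states M"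
    "q_out0 M \<noteq> q_out1 M"
    using M by (auto simp: wf_otm_def)
  have d: "fst (delta M q s) < n_states M" if "q < n_states M" for q s
    using M that by (auto simp: wf_otm_def)
  have pc: "set (push_cell r s) \<subseteq> {..<6} \<times> UNIV" if "r < 6" for r s
    using set_push_cell[of r s] that by auto
  have w: "?ok (act (q', s, m))" if "q' < n_states M" for q' s m
    using that pc by (cases m) (auto simp: sim_labels_iff)
  then have wd: "?ok (act (delta M q s))" if "q < n_states M" for q s
    using d[OF that, of s] by (cases "delta M q s") auto
  have sl: "l_start S \<in> L" "l_query S \<in> L" "l_yes S \<in> L" "l_no S \<in> L"
    using S by (auto simp: wf_smach_def)
  have "case sim_code M S l of (r, g) \<Rightarrow> r < 6 \<and> (\<forall>s. ?ok (g s))" if "l \<in> sim_labels M L" for l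
  proof (cases l)
    case (Sub l0)
    have l0: "l0 \<in> L" using that by (simp add: Sub sim_labels_iff)
    obtain r g where rg: "code S l0 = (r, g)" by fastforce
    have "case code S l0 of (r, g) \<Rightarrow> r < 6 \<and>
        (\<forall>s. case g s of (ps, l') \<Rightarrow> l' \<in> L \<and> set ps \<subseteq> {..<6} \<times> UNIV)"
      using S[unfolded wf_smach_def] l0 by (elim conjE) (erule bspec)
    then have r: "r < 6" and g: "\<And>s. case g s of (ps, l') \<Rightarrow> l' \<in> L \<and> set ps \<subseteq> {..<6} \<times> UNIV"
      by (simp_all add: rg)
    have "?ok (map_prod id Sub (g s))" for s
      using g[of s] by (cases "g s") (auto simp: sim_labels_iff)
    then show ?thesis using r q(3,4) by (auto simp: Sub rg sim_labels_iff)
  qed (use that pc wd q sl in \<open>auto simp: sim_labels_iff split: option.split\<close>)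
  moreover have "finite (sim_labels M L)" using S by (simp add: sim_labels_def wf_smach_def)
  ultimately show ?thesis unfolding wf_smach_def using q S sl
    by (auto simp: sim_labels_iff)
qed

text \<open>A simulation in lockstep: \<open>Sub\<close> copies the code of \<open>S\<close> except
  at its output labels, where \<open>S\<close> has no successors.\<close>

lemma ensures_sub:
  assumes S: "wf_smach S L 6" and run: "ensures (ssuccs \<psi> S) Q t (l, regs)"
    and Q: "\<And>c. Q c \<Longrightarrow> fst c \<in> {l_out0 S, l_out1 S}"
  shows "ensures (ssuccs \<psi> (sim M S)) (\<lambda>c. \<exists>l regs. Q (l, regs) \<and> c = (Sub l, regs)) t (Sub l, regs)"
proof -
  have "ensures (ssuccs \<psi> (sim M S))
     (\<lambda>d. \<exists>c' (t' :: nat). Q c' \<and> d = map_prod Sub id c') (t * 1) (map_prod Sub id (l, regs))"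
  proof (rule ensures_sim[where R = "\<lambda>t c d. d = map_prod Sub id c" and S = "ssuccs \<psi> S"])
    show "ensures (ssuccs \<psi> S) Q t (l, regs)" by (fact run)
  next
    fix t c d
    assume d: "d = map_prod Sub id c" and ne: "ssuccs \<psi> S c \<noteq> {}"
    obtain l regs where c: "c = (l, regs)" by (cases c)
    have out: "l \<noteq> l_out0 S" "l \<noteq> l_out1 S" using ne by (auto simp: c ssuccs_def)
    have "ssuccs \<psi> (sim M S) d = map_prod Sub id ` ssuccs \<psi> S c"
    proof (cases "l = l_query S")
      case True
      then show ?thesis using out by (auto simp: ssuccs_def c d image_iff)
    next
      case False
      then show ?thesis using out
        by (auto simp: ssuccs_def c d sstep_def split: prod.split)
    qed
    then show "ensures (ssuccs \<psi> (sim M S)) (\<lambda>d'. \<exists>c'\<in>ssuccs \<psi> S c. d' = map_prod Sub id c') 1 d"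
      using ne by (auto simp: ensures.simps(2))
  qed simp
  then show ?thesis by (auto elim!: ensures_mono)
qed

lemmas sim_step = sstep_def push_def push_cell_def

lemma ensures_extract:
  assumes "q_query M \<noteq> q_out0 M" "q_query M \<noteq> q_out1 M" "rest = [] \<or> hd rest = None"
    and "ensures (ssuccs \<psi> (sim M S)) Q t (Restore, [[], rev w @ a, [], [], u, codes rest])"
  shows "ensures (ssuccs \<psi> (sim M S)) Q (2 * length w + Suc t)
    (Read (q_query M), [[], a, [], [], u, codes (map Some w @ rest)])"
  using assms(4)
proof (induction w arbitrary: a)
  case Nil
  show ?case 
    by (simp, rule ensures_sstep) (use assms Nil in \<open>cases rest; auto simp: sim_step\<close>)+
next
  case (Cons b w)
  have "ensures (ssuccs \<psi> (sim M S)) Q (Suc (2 * length w + Suc t))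
     (Extract, [[], a, [], [], u, b # codes (map Some w @ rest)])"
    by (rule ensures_sstep) (use Cons in \<open>auto simp: sim_step\<close>)
  then have "ensures (ssuccs \<psi> (sim M S)) Q (Suc (Suc (2 * length w + Suc t)))
     (Read (q_query M), [[], a, [], [], u, codes (map Some (b # w) @ rest)])"
    by (intro ensures_sstep) (use assms in \<open>auto simp: sim_step\<close>)
  then show ?case by simp
qed

lemma ensures_restore:
  assumes "ensures (ssuccs \<psi> (sim M S)) Q t
      (Sub (l_start S), [rev w @ b, [], [], [], u, codes (map Some (rev w)) @ v])"
  shows "ensures (ssuccs \<psi> (sim M S)) Q (length w + Suc t) (Restore, [b, w, [], [], u, v])"
  using assms
proof (induction w arbitrary: b v)
  case Nil
  show ?case by (simp, rule ensures_sstep) (use Nil in \<open>auto simp: sim_step\<close>)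
next
  case (Cons c w)
  show ?case by (simp, rule ensures_sstep) (use Cons in \<open>auto simp: sim_step\<close>)
qed

text \<open>Extraction reverses the query and restoration reverses it again, both onto register 0
  for the subroutine and onto register 5, so the simulated tape is unchanged.\<close>

lemma ensures_query:
  assumes M: "wf_otm M" and S: "wf_smach S L 6" and ans: "answers S \<psi> \<phi> q"
    and w: "w = map the (takeWhile (\<lambda>s. s \<noteq> None) rs)"
  shows "ensures (ssuccs \<psi> (sim M S))
    (\<lambda>d. \<exists>y\<in>\<phi> w. d = (Read (if y then q_yes M else q_no M), [[], [], [], [], u, codes rs]))
    (3 * length w + 3 + poly q (length w)) (Read (q_query M), [[], [], [], [], u, codes rs])"
    (is "ensures ?S ?Q _ _")
proof -
  define rest where "rest = dropWhile (\<lambda>s. s \<noteq> None) rs"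
  have "map Some w = takeWhile (\<lambda>s. s \<noteq> None) rs"
    unfolding w map_map by (rule map_idI) (auto dest: set_takeWhileD)
  then have rs: "rs = map Some w @ rest" by (simp add: rest_def)
  have rest: "rest = [] \<or> hd rest = None"
    unfolding rest_def using hd_dropWhile by blast
  have neq: "q_query M \<noteq> q_out0 M" "q_query M \<noteq> q_out1 M" "l_out0 S \<noteq> l_out1 S"
    "l_query S \<noteq> l_out0 S" "l_query S \<noteq> l_out1 S"
    using M S by (auto simp: wf_otm_def wf_smach_def)
  let ?regs = "[[], [], [], [], u, codes rs]"
  have "ensures ?S (\<lambda>c. \<exists>l regs. (\<exists>y\<in>\<phi> w. (l, regs) = (if y then l_out1 S else l_out0 S, ?regs))
      \<and> c = (Sub l, regs)) (poly q (length w)) (Sub (l_start S), [w, [], [], [], u, codes rs])"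
    by (rule ensures_sub[OF S ans[unfolded answers_def, rule_format]]) auto
  then have "ensures ?S ?Q (poly q (length w) + 1) (Sub (l_start S), [w, [], [], [], u, codes rs])"
  proof (rule ensures_trans)
    fix c assume "\<exists>l regs. (\<exists>y\<in>\<phi> w. (l, regs) = (if y then l_out1 S else l_out0 S, ?regs))
      \<and> c = (Sub l, regs)"
    then obtain y where y: "y \<in> \<phi> w" "c = (Sub (if y then l_out1 S else l_out0 S), ?regs)"
      by blast
    have "ensures ?S ?Q (Suc 0) (Sub (if y then l_out1 S else l_out0 S), ?regs)"
      by (rule ensures_sstep) (use neq y in \<open>auto simp: sim_step intro!: bexI[of _ y]\<close>)
    then show "ensures ?S ?Q 1 c" by (simp add: y)
  qed
  then have "ensures ?S ?Q (length (rev w) + Suc (poly q (length w) + 1))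
      (Restore, [[], rev w, [], [], u, codes rest])"
    by (intro ensures_restore) (simp add: rs)
  then have "ensures ?S ?Q (2 * length w + Suc (length (rev w) + Suc (poly q (length w) + 1)))
      (Read (q_query M), ?regs)"
    unfolding rs by (intro ensures_extract[OF neq(1,2) rest]) simp
  then show ?thesis by (rule ensures_mono) auto
qed

text \<open>Two pops read a cell; a move to the left takes two more to fetch a cell from register 4.
  Hence the 4.\<close>

lemma ensures_move:
  assumes "q \<noteq> q_out0 M" "q \<noteq> q_out1 M" "q \<noteq> q_query M"
    and d: "delta M q (hd0 rs) = (q', s', m)" and sh: "shift m s' ls (tl rs) = (ls', rs')"
  shows "ensures (ssuccs \<psi> (sim M S))
    (\<lambda>d. d = (Read q', [[], [], [], [], codes ls', codes rs'])) 4
    (Read q, [[], [], [], [], codes ls, codes rs])" (is "ensures ?S ?Q _ _")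
proof -
  let ?end = "case act (q', s', m) of (ps, l) \<Rightarrow> (l, fold push ps [[], [], [], [], codes ls, codes (tl rs)])"
  have mv: "ensures ?S ?Q 2 ?end"
  proof (cases m)
    case MLeft
    have pc: "fold push (push_cell 5 s) [[], [], [], [], u, v] = [[], [], [], [], u, bits s @ v]" for s u v
      by (cases s) (simp_all add: push_cell_def push_def)
    have "ensures ?S ?Q 2 (Move q', [[], [], [], [], codes ls, bits s' @ codes (tl rs)])"
    proof (cases ls)
      case Nil
      have "ensures ?S ?Q (Suc 1) (Move q', [[], [], [], [], codes ls, bits s' @ codes (tl rs)])"
        by (rule ensures_sstep) (use sh in \<open>auto simp: sstep_def Nil pc MLeft intro!: ensures_here\<close>)
      then show ?thesis by (simp add: numeral_2_eq_2)
    next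
      case (Cons a us)
      have "ensures ?S ?Q (Suc 0) (Move_Val q' (a \<noteq> None),
          [[], [], [], [], tl (bits a) @ codes us, bits s' @ codes (tl rs)])"
        by (rule ensures_sstep)
          (use sh in \<open>cases a; auto simp: sstep_def Cons pc MLeft\<close>)+
      then have "ensures ?S ?Q (Suc (Suc 0)) (Move q', [[], [], [], [], codes ls, bits s' @ codes (tl rs)])"
        by (intro ensures_sstep; cases a) (auto simp: sstep_def Cons)
      then show ?thesis by (simp add: numeral_2_eq_2)
    qed
    then show ?thesis by (simp add: MLeft pc)
  qed (use sh in \<open>cases s'; auto simp: push_cell_def push_def intro!: ensures_here\<close>)+
  have eq: "Suc (Suc 2) = 4" by simp
  have "ensures ?S ?Q 4 (Read q, [[], [], [], [], codes ls, codes rs])"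
  proof (cases rs)
    case Nil
    have "ensures ?S ?Q (Suc 2) (Read q, [[], [], [], [], codes ls, codes rs])"
      by (rule ensures_sstep) (use assms(1-3) d mv in \<open>auto simp: sstep_def Nil\<close>)
    then show ?thesis by (rule ensures_mono) auto
  next
    case (Cons a us)
    have "ensures ?S ?Q (Suc 2) (Read_Val q (a \<noteq> None),
        [[], [], [], [], codes ls, tl (bits a) @ codes us])"
      by (rule ensures_sstep; cases a) (use d mv in \<open>auto simp: sstep_def Cons\<close>)
    then have "ensures ?S ?Q (Suc (Suc 2)) (Read q, [[], [], [], [], codes ls, codes rs])"
      by (intro ensures_sstep; cases a) (use assms(1-3) in \<open>auto simp: sstep_def Cons\<close>)
    then show ?thesis by (simp add: eq)
  qed
  then show ?thesis .
qed

lemma ensures_load: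
  "ensures (ssuccs \<psi> (sim M S)) Q t (Spread, [[], rev w @ a, [], [], u, v]) \<Longrightarrow>
    ensures (ssuccs \<psi> (sim M S)) Q (length w + Suc t) (Load, [w, a, [], [], u, v])"
proof (induction w arbitrary: a)
  case Nil
  show ?case by (simp, rule ensures_sstep) (use Nil in \<open>auto simp: sim_step\<close>)
next
  case (Cons b w)
  show ?case by (simp, rule ensures_sstep) (use Cons in \<open>auto simp: sim_step\<close>)
qed

lemma ensures_spread:
  "ensures (ssuccs \<psi> (sim M S)) Q t (Read (q_start M), [[], [], [], [], u, codes (map Some (rev w)) @ v]) \<Longrightarrow>
    ensures (ssuccs \<psi> (sim M S)) Q (length w + Suc t) (Spread, [[], w, [], [], u, v])"
proof (induction w arbitrary: v)
  case Nil
  show ?case by (simp, rule ensures_sstep) (use Nil in \<open>auto simp: sim_step\<close>)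
next
  case (Cons b w)
  show ?case by (simp, rule ensures_sstep) (use Cons in \<open>auto simp: sim_step\<close>)
qed

theorem turing_reduces_subroutine:
  fixes S :: "'s smach"
  assumes red: "\<phi>1 \<propto>\<^sub>T \<phi>" and S: "wf_smach S L 6" and ans: "answers S \<psi> \<phi> q"
  shows "\<phi>1 \<propto>\<^sub>T \<psi>"
proof -
  from red obtain M p where M: "wf_otm M" and "solves_in_time M p \<phi>1 \<phi>"
    by (auto simp: turing_reduces_def)
  then have run: "ensures (succs \<phi> M) (accepts M (\<phi>1 x)) (poly p (length x)) (init_config M x)"
    if "x \<noteq> []" for x using that by (simp add: solves_in_time_iff_ensures)
  have neq: "q_query M \<noteq> q_out0 M" "q_query M \<noteq> q_out1 M" using M by (auto simp: wf_otm_def)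
  \<comment> \<open>A query costs \<open>3 * N + 3 + poly q N\<close> by
    \<open>ensures_query\<close>; the constant 4 also covers an ordinary move.\<close>
  define T where "T N = 3 * N + 4 + poly q N" for N
  have "ensures (ssuccs \<psi> (sim M S)) (saccepts (sim M S) (\<phi>1 x))
      (poly p (length x) * T (length x + 2 * poly p (length x)) + 2 * length x + 2)
      (Load, [x, [], [], [], [], []])" if "x \<noteq> []" for x
  proof -
    define t where "t = poly p (length x)"
    \<comment> \<open>A step lengthens the right half by at most two cells, so \<open>N\<close>
      bounds it, and with it every query, throughout the run.\<close>
    define N where "N = length x + 2 * t"
    define R where "R j c d \<longleftrightarrow> (\<exists>q ls rs. cfg q ls rs c \<and>
        d = (Read q, [[], [], [], [], codes ls, codes rs]) \<and> length rs + 2 * j \<le> N)"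
      for j and c :: config and d :: "'s sim \<times> bool list list"
    have sim: "ensures (ssuccs \<psi> (sim M S)) (\<lambda>d'. \<exists>c'\<in>succs \<phi> M c. R j c' d') (T N) d"
      if R: "R (Suc j) c d" and ne: "succs \<phi> M c \<noteq> {}" for j c d
    proof -
      obtain q0 ls rs where c: "cfg q0 ls rs c"
        and d: "d = (Read q0, [[], [], [], [], codes ls, codes rs])" and len: "length rs + 2 * Suc j \<le> N"
        using R by (auto simp: R_def)
      have out: "q0 \<noteq> q_out0 M" "q0 \<noteq> q_out1 M" using ne c by (auto simp: succs_def cfg_def)
      show ?thesis
      proof (cases "q0 = q_query M")
        case True
        let ?w = "map the (takeWhile (\<lambda>s. s \<noteq> None) rs)"
        have "length ?w \<le> N" using len length_takeWhile_le[of "\<lambda>s. s \<noteq> None" rs] by simp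
        then have t: "3 * length ?w + 3 + poly q (length ?w) \<le> T N"
          unfolding T_def by (intro add_mono poly_nat_mono) auto
        note sq = succs_cfg_query[OF c out True]
        show ?thesis unfolding d True
        proof (rule ensures_mono[OF ensures_query[OF M S ans refl] t])
          fix d' :: "'s sim \<times> bool list list"
          assume "\<exists>y\<in>\<phi> ?w. d' = (Read (if y then q_yes M else q_no M),
              [[], [], [], [], codes ls, codes rs])"
          then obtain y where y: "y \<in> \<phi> ?w"
            "d' = (Read (if y then q_yes M else q_no M), [[], [], [], [], codes ls, codes rs])" by blast
          have "R j (if y then q_yes M else q_no M, snd c) d'"
            unfolding R_def using sq(2)[of y] y(2) len by fastforce
          then show "\<exists>c'\<in>succs \<phi> M c. R j c' d'" using y(1) unfolding sq(1) by blast
        qed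
      next
        case False
        obtain q' s' m where dl: "delta M q0 (hd0 rs) = (q', s', m)" by (metis prod_cases3)
        obtain ls' rs' where sh: "shift m s' ls (tl rs) = (ls', rs')" by fastforce
        obtain c' where c': "succs \<phi> M c = {c'}" "cfg q' ls' rs' c'"
          using succs_cfg[OF c out False dl sh] by blast
        have "length rs' \<le> length rs + 2" using sh by (cases m) auto
        then have "length rs' + 2 * j \<le> N" using len by simp
        then have "R j c' (Read q', [[], [], [], [], codes ls', codes rs'])"
          using c'(2) by (auto simp: R_def)
        then show ?thesis unfolding d
          by (intro ensures_mono[OF ensures_move[OF out False dl sh]]) (auto simp: c'(1) T_def)
      qed
    qed
    have "R t (init_config M x) (Read (q_start M), [[], [], [], [], codes [], codes (map Some x)])"
      using cfg_init[of M x] unfolding R_def N_def by fastforce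
    from ensures_sim[where R = R, OF sim run[OF \<open>x \<noteq> []\<close>, folded t_def] this]
    have "ensures (ssuccs \<psi> (sim M S)) (saccepts (sim M S) (\<phi>1 x)) (t * T N)
        (Read (q_start M), [[], [], [], [], codes [], codes (map Some x)])"
      by (rule ensures_mono)
        (auto simp: R_def saccepts_def accepts_def is_halting_def output_in_def cfg_def)
    then have "ensures (ssuccs \<psi> (sim M S)) (saccepts (sim M S) (\<phi>1 x)) (t * T N)
        (Read (q_start M), [[], [], [], [], [], codes (map Some (rev (rev x))) @ []])"
      by simp
    from ensures_spread[OF this]
    have "ensures (ssuccs \<psi> (sim M S)) (saccepts (sim M S) (\<phi>1 x)) (length x + Suc (t * T N))
        (Spread, [[], rev x @ [], [], [], [], []])" by simp
    from ensures_load[OF this]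
    show ?thesis unfolding N_def[symmetric] t_def[symmetric]
      by (rule ensures_mono) auto
  qed
  moreover have "\<exists>p'. \<forall>x :: bool list.
      poly p (length x) * T (length x + 2 * poly p (length x)) + 2 * length x + 2 = poly p' (length x)"
    by (rule exI[of _ "p * ([:3:] * ([:0, 1:] + [:2:] * p) + [:4:] + pcompose q ([:0, 1:] + [:2:] * p))
          + [:2, 2:]"]) (simp add: T_def poly_pcompose algebra_simps)
  ultimately obtain p' where "\<And>x. x \<noteq> [] \<Longrightarrow> ensures (ssuccs \<psi> (sim M S)) (saccepts (sim M S) (\<phi>1 x))
      (poly p' (length x)) (Load, [x, [], [], [], [], []])" by metis
  then show ?thesis
    by (intro stack_machine_reduction[OF wf_sim[OF M S]]) (simp add: numeral_eq_Suc)
qed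


subsection \<open>Encodings\<close>

definition unary :: "nat list \<Rightarrow> bool list" where
  "unary ms = concat (map (\<lambda>m. replicate m True @ [False]) ms)"

lemma unary_simps [simp]:
  "unary [] = []" "unary (m # ms) = replicate m True @ False # unary ms"
  "unary (ms @ ms') = unary ms @ unary ms'"
  by (auto simp: unary_def)

lemma replicate_True_append_inj:
  "replicate i True @ False # u = replicate j True @ False # v \<Longrightarrow> i = j \<and> u = v"
proof (induction i arbitrary: j)
  case 0
  then show ?case by (cases j) auto
next
  case (Suc i)
  then show ?case by (cases j) auto
qed

lemma unary_append_inj:
  "length ms = length ms' \<Longrightarrow> unary ms @ u = unary ms' @ v \<Longrightarrow> ms = ms' \<and> u = v"
proof (induction ms arbitrary: ms')
  case (Cons m ms)
  then obtain m' ms'' where ms': "ms' = m' # ms''" by (cases ms') auto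
  have "m = m' \<and> unary ms @ u = unary ms'' @ v"
    using Cons.prems(2) by (intro replicate_True_append_inj) (simp add: ms')
  then show ?case using Cons ms' by auto
qed simp

text \<open>A total parse, since machines must cope with arbitrary strings: either \<open>k\<close>
  block lengths can be read off, or the string ends too early.\<close>

lemma unary_split:
  "(\<exists>ms v. length ms = k \<and> w = unary ms @ v) \<or> (\<exists>ms j. length ms < k \<and> w = unary ms @ replicate j True)"
proof (induction w arbitrary: k)
  case Nil
  show ?case by (cases k) (auto intro!: exI[of _ "[]"] exI[of _ 0])
next
  case (Cons b w)
  show ?case
  proof (cases k)
    case 0
    then show ?thesis by (intro disjI1 exI[of _ "[]"] exI[of _ "b # w"]) auto
  next
    case (Suc k')
    show ?thesis
    proof (cases b)
      case True
      from Cons.IH[of k] show ?thesis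
      proof (elim disjE exE conjE)
        fix ms v assume ms: "length ms = k" "w = unary ms @ v"
        then obtain m ms' where "ms = m # ms'" using Suc by (cases ms) auto
        then show ?thesis using ms True
          by (intro disjI1 exI[of _ "Suc m # ms'"] exI[of _ v]) auto
      next
        fix ms j assume ms: "length ms < k" "w = unary ms @ replicate j True"
        show ?thesis
        proof (cases ms)
          case Nil
          then show ?thesis using ms True by (intro disjI2 exI[of _ "[]"] exI[of _ "Suc j"]) auto
        next
          case (Cons m ms')
          then show ?thesis using ms True
            by (intro disjI2 exI[of _ "Suc m # ms'"] exI[of _ j]) auto
        qed
      qed
    next
      case False
      from Cons.IH[of k'] show ?thesis
      proof (elim disjE exE conjE)
        fix ms v assume "length ms = k'" "w = unary ms @ v"
        then show ?thesis using Suc False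
          by (intro disjI1 exI[of _ "0 # ms"] exI[of _ v]) auto
      next
        fix ms j assume "length ms < k'" "w = unary ms @ replicate j True"
        then show ?thesis using Suc False
          by (intro disjI2 exI[of _ "0 # ms"] exI[of _ j]) auto
      qed
    qed
  qed
qed

lemma enc_inst_unary: "enc_inst ms f = unary ms @ enc_form f"
  by (simp add: enc_inst_def unary_def)

text \<open>Prefix-freeness with arbitrary rests \<open>u\<close> and \<open>v\<close>, because the
  two arguments of a connective follow each other without a separator.\<close>

lemma enc_form_append_inj: "enc_form f @ u = enc_form g @ v \<Longrightarrow> f = g \<and> u = v"
proof (induction f arbitrary: g u v)
  case (FVar i)
  then show ?case using replicate_True_append_inj[of i u _ v] by (cases g) auto
next
  case (FConst b)
  then show ?case by (cases g) auto
next
  case (FNot f)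
  then obtain g' where g: "g = FNot g'" by (cases g) auto
  with FNot.IH[of u g' v] FNot.prems show ?case by simp
next
  case (FAnd f1 f2)
  from FAnd.prems obtain g1 g2 where g: "g = FAnd g1 g2" by (cases g) auto
  then have "enc_form f1 @ (enc_form f2 @ u) = enc_form g1 @ (enc_form g2 @ v)"
    using FAnd.prems by simp
  from FAnd.IH(1)[OF this] FAnd.IH(2)[of u g2 v] show ?case by (simp add: g)
next
  case (FOr f1 f2)
  from FOr.prems obtain g1 g2 where g: "g = FOr g1 g2" by (cases g) auto
  then have "enc_form f1 @ (enc_form f2 @ u) = enc_form g1 @ (enc_form g2 @ v)"
    using FOr.prems by simp
  from FOr.IH(1)[OF this] FOr.IH(2)[of u g2 v] show ?case by (simp add: g)
qed

lemma enc_form_inj: "enc_form f = enc_form g \<Longrightarrow> f = g"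
  using enc_form_append_inj[of f "[]" g "[]"] by simp

lemma decode_enc_inst:
  assumes "valid_inst n ms f"
  shows "decode n (enc_inst ms f) = (ms, f)"
  unfolding decode_def
proof (rule the_equality)
  fix p assume "case p of (ms', f') \<Rightarrow> valid_inst n ms' f' \<and> enc_inst ms f = enc_inst ms' f'"
  then show "p = (ms, f)"
    using assms unary_append_inj[of ms "fst p" "enc_form f" "enc_form (snd p)"] enc_form_inj
    by (auto simp: valid_inst_def enc_inst_unary split: prod.splits)
qed (use assms in simp)

lemma SAT_enc_inst: "valid_inst n ms f \<Longrightarrow> SAT n (enc_inst ms f) = {sat_sem ms (form_fun f)}"
  by (auto simp: SAT_def decode_enc_inst encodes_def)

lemma VAL_enc_inst: "valid_inst n ms f \<Longrightarrow> VAL n (enc_inst ms f) = val_sem ms (form_fun f)"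
  by (auto simp: VAL_def decode_enc_inst encodes_def)

lemma SAT_nonempty: "SAT n s \<noteq> {}"
  by (auto simp: SAT_def split: prod.split)

lemma val_sem_nonempty: "ms \<noteq> [] \<Longrightarrow> val_sem ms g \<noteq> {}"
  by (cases ms) (auto simp: val_sem_def)

text \<open>A query without admissible answer would leave the machine stuck;
  \<open>ensures_ask\<close> asks for this fact.\<close>

lemma VAL_nonempty:
  assumes "1 \<le> n"
  shows "VAL n s \<noteq> {}"
proof (cases "encodes n s")
  case True
  then obtain ms f where "valid_inst n ms f" "s = enc_inst ms f" by (auto simp: encodes_def)
  moreover from this have "ms \<noteq> []" using assms by (auto simp: valid_inst_def)
  ultimately show ?thesis by (simp add: VAL_enc_inst val_sem_nonempty)
qed (simp add: VAL_def)


subsection \<open>Loops of stack machines\<close>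

lemma ensures_transfer01:
  assumes "code P l = (0, case_option (ps, l') (\<lambda>b. ([(1, b)], l)))"
    and "l \<noteq> l_out0 P" "l \<noteq> l_out1 P" "l \<noteq> l_query P"
    and "ensures (ssuccs \<psi> P) Q t (l', fold push ps [[], rev w @ a, c, d, u, v])"
  shows "ensures (ssuccs \<psi> P) Q (length w + Suc t) (l, [w, a, c, d, u, v])"
  using assms(5)
proof (induction w arbitrary: a)
  case Nil
  show ?case by (simp, rule ensures_sstep) (use assms Nil in \<open>auto simp: sstep_def\<close>)
next
  case (Cons b w)
  show ?case by (simp, rule ensures_sstep) (use assms Cons in \<open>auto simp: sstep_def push_def\<close>)
qed

lemma ensures_transfer10:
  assumes "code P l = (1, case_option (ps, l') (\<lambda>b. ([(0, b)], l)))"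
    and "l \<noteq> l_out0 P" "l \<noteq> l_out1 P" "l \<noteq> l_query P"
    and "ensures (ssuccs \<psi> P) Q t (l', fold push ps [rev a @ w, [], c, d, u, v])"
  shows "ensures (ssuccs \<psi> P) Q (length a + Suc t) (l, [w, a, c, d, u, v])"
  using assms(5)
proof (induction a arbitrary: w)
  case Nil
  show ?case by (simp, rule ensures_sstep) (use assms Nil in \<open>auto simp: sstep_def\<close>)
next
  case (Cons b a)
  show ?case by (simp, rule ensures_sstep) (use assms Cons in \<open>auto simp: sstep_def push_def\<close>)
qed

lemma ensures_clear:
  assumes "code P l = (r, case_option ([], l') (\<lambda>b. ([], l)))" "r < length regs"
    and "l \<noteq> l_out0 P" "l \<noteq> l_out1 P" "l \<noteq> l_query P"
    and "ensures (ssuccs \<psi> P) Q t (l', regs[r := []])"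
  shows "ensures (ssuccs \<psi> P) Q (length (regs ! r) + Suc t) (l, regs)"
  using assms(2,6)
proof (induction "regs ! r" arbitrary: regs)
  case Nil
  then have "regs[r := []] = regs" by (metis list_update_id)
  then show ?case
    by (simp flip: Nil.hyps, intro ensures_sstep)
      (use assms Nil in \<open>auto simp: sstep_def simp flip: Nil.hyps\<close>)
next
  case (Cons b w)
  have "ensures (ssuccs \<psi> P) Q (length w + Suc t) (l, regs[r := w])"
    using Cons.hyps(1)[of "regs[r := w]"] Cons.prems by simp
  then show ?case
    by (simp flip: Cons.hyps(2), intro ensures_sstep)
      (use assms Cons in \<open>auto simp: sstep_def simp flip: Cons.hyps(2)\<close>)
qed

text \<open>The label keeps the number of block lengths still to be copied from register 0 to
  register 1. The delimiter of the last one triggers the extra pushes \<open>ps\<close>;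
  \<open>e\<close> is the exit if the string ends too early.\<close>

definition skip_code :: "(nat \<Rightarrow> 'l) \<Rightarrow> (nat \<times> bool) list \<times> 'l \<Rightarrow> (nat \<times> bool) list \<Rightarrow> 'l \<Rightarrow> nat \<Rightarrow>
    nat \<times> (bool option \<Rightarrow> (nat \<times> bool) list \<times> 'l)" where
  "skip_code lab e ps l' j = (0, case_option e (\<lambda>b.
     if b then ([(1, True)], lab j)
     else if j \<le> 1 then ((1, False) # ps, l') else ([(1, False)], lab (j - 1))))"

lemma ensures_skip_ones:
  assumes "code P (lab j) = skip_code lab e ps l' j"
    and "lab j \<noteq> l_out0 P" "lab j \<noteq> l_out1 P" "lab j \<noteq> l_query P"
    and "ensures (ssuccs \<psi> P) Q t (lab j, [w, replicate m True @ a, c, d, u, v])"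
  shows "ensures (ssuccs \<psi> P) Q (m + t) (lab j, [replicate m True @ w, a, c, d, u, v])"
  using assms(5)
proof (induction m arbitrary: a)
  case (Suc m)
  show ?case
    by (simp, rule ensures_sstep)
      (use assms Suc(2) Suc(1)[of "True # a"]
       in \<open>auto simp: sstep_def push_def skip_code_def replicate_app_Cons_same\<close>)
qed simp

lemma ensures_skip:
  assumes "\<And>j. code P (lab j) = skip_code lab e ps l' j"
    and "\<And>j. lab j \<noteq> l_out0 P" "\<And>j. lab j \<noteq> l_out1 P" "\<And>j. lab j \<noteq> l_query P"
    and "ms \<noteq> []"
    and "ensures (ssuccs \<psi> P) Q t (l', fold push ps [w, rev (unary ms) @ a, c, d, u, v])"
  shows "ensures (ssuccs \<psi> P) Q (length (unary ms) + t)
    (lab (length ms), [unary ms @ w, a, c, d, u, v])"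
  using assms(5,6)
proof (induction ms arbitrary: a)
  case (Cons m ms)
  have "ensures (ssuccs \<psi> P) Q (Suc (length (unary ms) + t))
      (lab (Suc (length ms)), [False # unary ms @ w, replicate m True @ a, c, d, u, v])"
  proof (rule ensures_sstep)
    show "ensures (ssuccs \<psi> P) Q (length (unary ms) + t)
        (sstep P (lab (Suc (length ms)), [False # unary ms @ w, replicate m True @ a, c, d, u, v]))"
    proof (cases "ms = []")
      case True
      then show ?thesis using Cons.prems assms(1) by (simp add: sstep_def push_def skip_code_def)
    next
      case False
      then show ?thesis using Cons assms(1)[of "Suc (length ms)"]
        by (simp add: sstep_def push_def skip_code_def Suc_le_eq)
    qed
  qed (use assms in auto)
  from ensures_skip_ones[OF assms(1-4) this] show ?case by (simp add: add.assoc)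
qed simp

lemma ensures_skip_exhausted:
  assumes "\<And>j. code P (lab j) = skip_code lab (ps', l'') ps l' j"
    and "\<And>j. lab j \<noteq> l_out0 P" "\<And>j. lab j \<noteq> l_out1 P" "\<And>j. lab j \<noteq> l_query P"
    and "length ms < k"
    and "ensures (ssuccs \<psi> P) Q t
      (l'', fold push ps' [[], rev (unary ms @ replicate i True) @ a, c, d, u, v])"
  shows "ensures (ssuccs \<psi> P) Q (length (unary ms) + i + Suc t)
    (lab k, [unary ms @ replicate i True, a, c, d, u, v])"
  using assms(5,6)
proof (induction ms arbitrary: a k)
  case Nil
  have "ensures (ssuccs \<psi> P) Q (Suc t) (lab k, [[], replicate i True @ a, c, d, u, v])"
    by (rule ensures_sstep) (use assms Nil in \<open>auto simp: sstep_def skip_code_def\<close>)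
  from ensures_skip_ones[OF assms(1-4) this] show ?case by simp
next
  case (Cons m ms)
  have "ensures (ssuccs \<psi> P) Q (Suc (length (unary ms) + i + Suc t))
      (lab k, [False # unary ms @ replicate i True, replicate m True @ a, c, d, u, v])"
    by (rule ensures_sstep) (use assms Cons in \<open>auto simp: sstep_def push_def skip_code_def\<close>)
  from ensures_skip_ones[OF assms(1-4) this] show ?case by (simp add: add.assoc)
qed


subsection \<open>Answering VAL queries with SAT\<close>

lemma sem_const [simp]: "sat_sem ms (\<lambda>_. b) = b" "cosat_sem ms (\<lambda>_. b) = b"
proof (induction ms)
  case (Cons m ms)
  { case 1 then show ?case using Cons by (auto intro!: exI[of _ "replicate m True"]) }
  { case 2 then show ?case using Cons by (auto intro!: exI[of _ "replicate m True"]) }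
qed auto

text \<open>Once the first block is fixed, the conjunction is either \<open>f\<close> or constantly
  False, which \<open>sem_const\<close> settles. If it is unsatisfiable, all winning moves start
  with 1, or there are none and every bit is admissible.\<close>

lemma val_sem_via_SAT:
  assumes "1 \<le> m"
  shows "(\<not> sat_sem (m # ms) (form_fun (FAnd f (FNot (FVar 0))))) \<in> val_sem (m # ms) (form_fun f)"
proof -
  have "cosat_sem ms (\<lambda>xs. form_fun (FAnd f (FNot (FVar 0))) (x # xs)) \<longleftrightarrow>
      \<not> hd x \<and> cosat_sem ms (\<lambda>xs. form_fun f (x # xs))" if "length x = m" for x
    using that assms by (cases x; cases "hd x") (auto simp: form_fun_def)
  then have "sat_sem (m # ms) (form_fun (FAnd f (FNot (FVar 0)))) \<longleftrightarrow>
      (\<exists>x. length x = m \<and> \<not> hd x \<and> cosat_sem ms (\<lambda>xs. form_fun f (x # xs)))" by auto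
  then show ?thesis
    by (cases "sat_sem (m # ms) (form_fun (FAnd f (FNot (FVar 0))))") (auto simp: val_sem_def)
qed

text \<open>The subroutine rewrites the encoding of f into that of f and not x0, by inserting 110 behind
  the block lengths and appending 10000, and negates the answer.\<close>

datatype val_label =
    V_Append | V_Unappend | V_Skip nat | V_Back | V_Ask | V_Clear bool | V_Done bool

fun val_code :: "nat \<Rightarrow> val_label \<Rightarrow> nat \<times> (bool option \<Rightarrow> (nat \<times> bool) list \<times> val_label)" where
  "val_code n V_Append = (0, case_option
     (map (Pair 0) [False, False, False, False, True], V_Unappend) (\<lambda>b. ([(1, b)], V_Append)))"
| "val_code n V_Unappend = (1, case_option ([], V_Skip n) (\<lambda>b. ([(0, b)], V_Unappend)))"
| "val_code n (V_Skip j) =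
     skip_code V_Skip ([], V_Back) (map (Pair 1) [True, True, False]) V_Back j"
| "val_code n V_Back = (1, case_option ([], V_Ask) (\<lambda>b. ([(0, b)], V_Back)))"
| "val_code n V_Ask = (0, \<lambda>s. ([], V_Ask))"
| "val_code n (V_Clear y) = (0, case_option ([], V_Done y) (\<lambda>b. ([], V_Clear y)))"
| "val_code n (V_Done y) = (0, \<lambda>s. ([], V_Done y))"

definition val_machine :: "nat \<Rightarrow> val_label smach" where
  "val_machine n = \<lparr> code = val_code n, l_start = V_Append, l_query = V_Ask, l_yes = V_Clear False,
     l_no = V_Clear True, l_out0 = V_Done False, l_out1 = V_Done True \<rparr>"

lemma val_machine_sel [simp]:
  "code (val_machine n) = val_code n" "l_start (val_machine n) = V_Append"
  "l_query (val_machine n) = V_Ask" "l_yes (val_machine n) = V_Clear False"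
  "l_no (val_machine n) = V_Clear True" "l_out0 (val_machine n) = V_Done False"
  "l_out1 (val_machine n) = V_Done True"
  by (simp_all add: val_machine_def)

definition val_labels :: "nat \<Rightarrow> val_label set" where
  "val_labels n = {V_Append, V_Unappend, V_Back, V_Ask} \<union> V_Skip ` {..n} \<union> range V_Clear \<union> range V_Done"

lemma wf_val_machine: "wf_smach (val_machine n) (val_labels n) 6"
proof -
  have "case val_code n l of (r, g) \<Rightarrow> r < 6 \<and>
      (\<forall>s. case g s of (ps, l') \<Rightarrow> l' \<in> val_labels n \<and> set ps \<subseteq> {..<6} \<times> UNIV)"
    if "l \<in> val_labels n" for l
    using that by (cases l) (auto simp: val_labels_def skip_code_def split: option.split)
  then show ?thesis unfolding wf_smach_def by (auto simp: val_labels_def)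
qed

lemma answers_val_machine:
  assumes n: "1 \<le> n"
  shows "answers (val_machine n) (SAT n) (VAL n) [:40, 10:]"
  unfolding answers_def
proof (intro allI)
  fix s u v
  let ?S = "ssuccs (SAT n) (val_machine n)"
  let ?E = "[[], [], [], [], u, v] :: bool list list"
  define Q where "Q c \<longleftrightarrow> (\<exists>y\<in>VAL n s. c = (V_Done y, ?E))" for c
  have ask: "ensures ?S Q (length w + 2) (V_Ask, [w, [], [], [], u, v])"
    if w: "\<And>y. y \<in> SAT n w \<Longrightarrow> (\<not> y) \<in> VAL n s" for w
  proof -
    have "ensures ?S Q (length w + 1) (V_Clear (\<not> y), [w, [], [], [], u, v])" if "y \<in> SAT n w" for y
    proof -
      have "ensures ?S Q 0 (V_Done (\<not> y), ?E)"
        using w[OF that] by (auto simp: Q_def)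
      then have "ensures ?S Q (length ([w, [], [], [], u, v] ! 0) + Suc 0) (V_Clear (\<not> y), [w, [], [], [], u, v])"
        by (intro ensures_clear) auto
      then show ?thesis by simp
    qed
    from this[of True] this[of False]
    have "ensures ?S Q (Suc (length w + 1)) (l_query (val_machine n), [w, [], [], [], u, v])"
      using SAT_nonempty[of n w] by (intro ensures_ask) auto
    then show ?thesis by simp
  qed
  define z where "z = s @ [True, False, False, False, False]"
  have "ensures ?S Q (3 * length z + 20) (V_Skip n, [z, [], [], [], u, v])"
    using unary_split[of n z]
  proof (elim disjE exE conjE)
    fix ms w assume ms: "length ms = n" and z: "z = unary ms @ w"
    let ?w = "unary ms @ [True, True, False] @ w"
    have "(\<not> y) \<in> VAL n s" if y: "y \<in> SAT n ?w" for y
    proof (cases "encodes n s")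
      case True
      then obtain ms' f where v: "valid_inst n ms' f" "s = enc_inst ms' f" by (auto simp: encodes_def)
      then have "unary ms' @ enc_form f @ [True, False, False, False, False] = unary ms @ w"
        using z by (simp add: z_def enc_inst_unary)
      then have eq: "ms' = ms" "w = enc_form f @ [True, False, False, False, False]"
        using unary_append_inj[of ms' ms] v(1) ms by (auto simp: valid_inst_def)
      obtain m ms0 where m: "ms = m # ms0" using ms n by (cases ms) auto
      have m1: "1 \<le> m" using v(1) by (simp add: valid_inst_def eq(1) m)
      then have "valid_inst n ms (FAnd f (FNot (FVar 0)))"
        using v(1) by (simp add: valid_inst_def eq(1) m)
      moreover have "?w = enc_inst ms (FAnd f (FNot (FVar 0)))"
        by (simp add: enc_inst_unary eq)
      ultimately have "y = sat_sem ms (form_fun (FAnd f (FNot (FVar 0))))"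
        using y by (simp add: SAT_enc_inst)
      then show ?thesis
        using val_sem_via_SAT[OF m1, of ms0 f] v by (simp add: VAL_enc_inst eq m)
    qed (simp add: VAL_def)
    from ask[OF this] have "ensures ?S Q (length ?w + 2) (V_Ask, [?w, [], [], [], u, v])" .
    then have "ensures ?S Q (length (rev (unary ms @ [True, True, False])) + Suc (length ?w + 2))
        (V_Back, [w, rev (unary ms @ [True, True, False]), [], [], u, v])"
      by (intro ensures_transfer10[where ps = "[]"]) auto
    then have "ensures ?S Q (length (unary ms) +
        (length (rev (unary ms @ [True, True, False])) + Suc (length ?w + 2)))
        (V_Skip (length ms), [z, [], [], [], u, v])"
      unfolding z using ms n
      by (intro ensures_skip[where e = "([], V_Back)" and ps = "map (Pair 1) [True, True, False]"])
        (auto simp: push_def)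
    then show ?thesis unfolding ms by (rule ensures_mono) (auto simp: z)
  next
    fix ms j assume ms: "length ms < n" and z: "z = unary ms @ replicate j True"
    have "VAL n s = UNIV"
    proof (cases "encodes n s")
      case True
      then obtain ms' f where v: "valid_inst n ms' f" "s = enc_inst ms' f" by (auto simp: encodes_def)
      \<comment> \<open>Since \<open>z\<close> ends in 0, no ones are left over and \<open>z\<close>
        has fewer than \<open>n\<close> zeros, whereas an instance has \<open>n\<close>
        delimiters.\<close>
      have "last z = False" by (simp add: z_def)
      then have "j = 0" by (cases j) (auto simp: z simp flip: replicate_append_same)
      have cnt: "length (filter Not (unary ks)) = length ks" for ks by (induction ks) auto
      have "length (filter Not z) = length ms" by (simp add: z \<open>j = 0\<close> cnt)
      moreover have "length (filter Not z) \<ge> length ms'" by (simp add: z_def v enc_inst_unary cnt)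
      ultimately show ?thesis using v(1) ms by (simp add: valid_inst_def)
    qed (simp add: VAL_def)
    then have "ensures ?S Q (length z + 2) (V_Ask, [z, [], [], [], u, v])" by (intro ask) auto
    then have "ensures ?S Q (length (rev z) + Suc (length z + 2)) (V_Back, [[], rev z, [], [], u, v])"
      by (intro ensures_transfer10[where ps = "[]"]) auto
    then have "ensures ?S Q (length (unary ms) + j + Suc (length (rev z) + Suc (length z + 2)))
        (V_Skip n, [z, [], [], [], u, v])"
      unfolding z using ms by (intro ensures_skip_exhausted[where ps' = "[]"]) auto
    then show ?thesis by (rule ensures_mono) (auto simp: z)
  qed
  then have "ensures ?S Q (length (rev s) + Suc (3 * length z + 20))
      (V_Unappend, [[True, False, False, False, False], rev s, [], [], u, v])"
    by (intro ensures_transfer10[where ps = "[]"]) (auto simp: z_def)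
  then have "ensures ?S Q (length s + Suc (length (rev s) + Suc (3 * length z + 20)))
      (V_Append, [s, [], [], [], u, v])"
    by (intro ensures_transfer01[where ps = "map (Pair 0) [False, False, False, False, True]"])
      (auto simp: push_def)
  then have "ensures ?S Q (poly [:40, 10:] (length s)) (V_Append, [s, [], [], [], u, v])"
    by (rule ensures_mono) (auto simp: z_def)
  then show "ensures ?S
      (\<lambda>c. \<exists>y\<in>VAL n s. c = (if y then l_out1 (val_machine n) else l_out0 (val_machine n), ?E))
      (poly [:40, 10:] (length s)) (l_start (val_machine n), [s, [], [], [], u, v])"
    unfolding val_machine_sel by (rule ensures_mono) (auto simp: Q_def)
qed


subsection \<open>Formulas as token strings\<close>

text \<open>Polish notation without its tree structure: a token list need not be well formed, so it
  can be rewritten without parsing.\<close>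

datatype tok = T_Var nat | T_Const bool | T_Not | T_Bin bool

fun str :: "tok \<Rightarrow> bool list" where
  "str (T_Var i) = [False, False] @ replicate i True @ [False]"
| "str (T_Const b) = [False, True, b]"
| "str T_Not = [True, False]"
| "str (T_Bin b) = [True, True, b]"

definition strs :: "tok list \<Rightarrow> bool list" where
  "strs ts = concat (map str ts)"

lemma strs_simps [simp]:
  "strs [] = []" "strs (t # ts) = str t @ strs ts" "strs (ts @ ts') = strs ts @ strs ts'"
  by (auto simp: strs_def)

primrec toks :: "bform \<Rightarrow> tok list" where
  "toks (FVar i) = [T_Var i]"
| "toks (FConst b) = [T_Const b]"
| "toks (FNot f) = T_Not # toks f"
| "toks (FAnd f g) = T_Bin False # toks f @ toks g"
| "toks (FOr f g) = T_Bin True # toks f @ toks g"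

lemma enc_form_toks: "enc_form f = strs (toks f)"
  by (induction f) auto

lemma toks_inj: "toks f = toks g \<Longrightarrow> f = g"
  by (metis enc_form_inj enc_form_toks)

lemma str_append_inj: "str t @ u = str t' @ v \<Longrightarrow> t = t' \<and> u = v"
proof (induction t)
  case (T_Var i)
  then obtain j where "t' = T_Var j" by (cases t') auto
  then show ?case using T_Var replicate_True_append_inj[of i u j v] by simp
qed (cases t', auto)+

text \<open>The nonempty proper prefixes of token codes.\<close>

definition truncated :: "bool list set" where
  "truncated = {[False], [False, True], [True], [True, True]} \<union> range (\<lambda>i. False # False # replicate i True)"

lemma str_append_not_truncated: "str t @ u \<notin> truncated"
proof (cases t)
  case (T_Var i)
  have "replicate i True @ False # u \<noteq> replicate j True" for j
    by (metis in_set_conv_decomp in_set_replicate)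
  then show ?thesis using T_Var by (auto simp: truncated_def)
qed (auto simp: truncated_def)

lemma strs_truncated_inj:
  "e \<in> insert [] truncated \<Longrightarrow> strs ts @ e = strs ts' \<Longrightarrow> ts = ts' \<and> e = []"
proof (induction ts arbitrary: ts')
  case Nil
  then show ?case 
  proof (cases ts')
    case (Cons t ts0)
    then show ?thesis using Nil str_append_not_truncated[of t "strs ts0"] by (cases t) auto
  qed auto
next
  case (Cons t ts)
  show ?case
  proof (cases ts')
    case Nil
    then show ?thesis using Cons.prems by (cases t) auto
  next
    case (Cons t' ts0)
    then have "t = t' \<and> strs ts @ e = strs ts0"
      using Cons.prems by (intro str_append_inj) simp
    then show ?thesis using Cons.IH Cons.prems Cons by auto
  qed
qed

text \<open>The token codes form a complete prefix code: reading a token fails only by running out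
  of bits.\<close>

lemma tok_split1: "w \<noteq> [] \<Longrightarrow> w \<in> truncated \<or> (\<exists>t w'. w = str t @ w')"
proof (induction w rule: induct_list012)
  case (2 b)
  then show ?case by (cases b) (auto simp: truncated_def)
next
  case (3 a b w)
  show ?case
  proof (cases "a = False \<and> b = False")
    case True
    have "(\<exists>i z. w = replicate i True @ False # z) \<or> (\<exists>i. w = replicate i True)"
      using unary_split[of 1 w] by (fastforce simp: length_Suc_conv)
    then show ?thesis
    proof (elim disjE exE)
      fix i z assume "w = replicate i True @ False # z"
      then show ?thesis using True by (intro disjI2 exI[of _ "T_Var i"]) auto
    qed (use True in \<open>auto simp: truncated_def\<close>)
  next
    case False
    show ?thesis
    proof (cases "b = False")
      case True
      then show ?thesis using False by (intro disjI2 exI[of _ T_Not]) auto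
    next
      case b: False
      show ?thesis
      proof (cases w)
        case Nil
        then show ?thesis using b by (cases a) (auto simp: truncated_def)
      next
        case (Cons c w')
        then show ?thesis using b
          by (intro disjI2 exI[of _ "if a then T_Bin c else T_Const c"]) auto
      qed
    qed
  qed
qed auto

lemma tok_split: "\<exists>ts e. w = strs ts @ e \<and> e \<in> insert [] truncated"
proof (induction w rule: length_induct)
  case (1 w)
  show ?case
  proof (cases "w = [] \<or> w \<in> truncated")
    case True
    then show ?thesis by (intro exI[of _ "[]"] exI[of _ w]) auto
  next
    case False
    then obtain t w' where w: "w = str t @ w'" using tok_split1 by blast
    then have "length w' < length w" by (cases t) auto
    with 1 obtain ts e where "w' = strs ts @ e" "e \<in> insert [] truncated" by blast
    then show ?thesis using w by (intro exI[of _ "t # ts"] exI[of _ e]) auto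
  qed
qed

section \<open>Substitution in token lists\<close>

text \<open>The other variables move down because they are numbered along the concatenated blocks,
  and the first block loses its first bit.\<close>

fun plug :: "bool \<Rightarrow> tok \<Rightarrow> tok" where
  "plug y (T_Var 0) = T_Const y"
| "plug y (T_Var (Suc i)) = T_Var i"
| "plug y t = t"

primrec plug_form :: "bool \<Rightarrow> bform \<Rightarrow> bform" where
  "plug_form y (FVar i) = (case i of 0 \<Rightarrow> FConst y | Suc j \<Rightarrow> FVar j)"
| "plug_form y (FConst b) = FConst b"
| "plug_form y (FNot f) = FNot (plug_form y f)"
| "plug_form y (FAnd f g) = FAnd (plug_form y f) (plug_form y g)"
| "plug_form y (FOr f g) = FOr (plug_form y f) (plug_form y g)"

lemma toks_plug_form: "toks (plug_form y f) = map (plug y) (toks f)"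
  by (induction f) (auto split: nat.split)

lemma beval_plug_form: "beval (plug_form y f) a = beval f (case_nat y a)"
  by (induction f) (auto split: nat.split)

lemma bvars_plug_form: "bvars (plug_form y f) \<subseteq> {..<N} \<longleftrightarrow> bvars f \<subseteq> {..<Suc N}"
  by (induction f) (auto split: nat.split)

lemma plug_eq:
  "plug y t = T_Var i \<longleftrightarrow> t = T_Var (Suc i)" "plug y t = T_Not \<longleftrightarrow> t = T_Not"
  "plug y t = T_Bin b \<longleftrightarrow> t = T_Bin b" 
  "plug y t = T_Const b \<longleftrightarrow> t = T_Const b \<or> t = T_Var 0 \<and> b = y"
  by (cases "(y, t)" rule: plug.cases; auto)+

text \<open>\<open>plug\<close> keeps the arity of every token, variables and constants both being
  leaves. A token list that is no formula therefore never becomes one.\<close>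

lemma map_plug_eq_toks: "map (plug y) ts = toks f' \<Longrightarrow> \<exists>f. ts = toks f \<and> f' = plug_form y f"
proof (induction f' arbitrary: ts)
  case (FVar i)
  then show ?case by (intro exI[of _ "FVar (Suc i)"]) (auto simp: plug_eq)
next
  case (FConst b)
  then obtain t where "ts = [t]" "t = T_Const b \<or> t = T_Var 0 \<and> b = y" by (auto simp: plug_eq)
  then have "ts = toks (FConst b) \<and> FConst b = plug_form y (FConst b) \<or>
      ts = toks (FVar 0) \<and> FConst b = plug_form y (FVar 0)" by auto
  then show ?case by blast
next
  case (FNot f)
  then obtain ts' where ts: "ts = T_Not # ts'" "map (plug y) ts' = toks f" by (auto simp: plug_eq)
  from FNot.IH[OF ts(2)] obtain g where "ts' = toks g" "f = plug_form y g" by blast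
  then show ?case using ts by (intro exI[of _ "FNot g"]) auto
next
  case (FAnd f1 f2)
  then obtain ts1 ts2 where ts: "ts = T_Bin False # ts1 @ ts2" "map (plug y) ts1 = toks f1"
    "map (plug y) ts2 = toks f2" by (auto simp: plug_eq map_eq_append_conv)
  from FAnd.IH(1)[OF ts(2)] FAnd.IH(2)[OF ts(3)] obtain g1 g2
    where "ts1 = toks g1" "f1 = plug_form y g1" "ts2 = toks g2" "f2 = plug_form y g2" by blast
  then show ?case using ts by (intro exI[of _ "FAnd g1 g2"]) auto
next
  case (FOr f1 f2)
  then obtain ts1 ts2 where ts: "ts = T_Bin True # ts1 @ ts2" "map (plug y) ts1 = toks f1"
    "map (plug y) ts2 = toks f2" by (auto simp: plug_eq map_eq_append_conv)
  from FOr.IH(1)[OF ts(2)] FOr.IH(2)[OF ts(3)] obtain g1 g2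
    where "ts1 = toks g1" "f1 = plug_form y g1" "ts2 = toks g2" "f2 = plug_form y g2" by blast
  then show ?case using ts by (intro exI[of _ "FOr g1 g2"]) auto
qed

section \<open>Evaluation of closed formulas from right to left\<close>

fun reduce :: "tok \<Rightarrow> bool list \<Rightarrow> bool list option" where
  "reduce (T_Const b) vs = Some (b # vs)"
| "reduce T_Not (b # vs) = Some ((\<not> b) # vs)"
| "reduce (T_Bin d) (b # c # vs) = Some ((if d then b \<or> c else b \<and> c) # vs)"
| "reduce _ _ = None"

definition eval_toks :: "tok list \<Rightarrow> bool list option" where
  "eval_toks ts = foldr (\<lambda>t vs. Option.bind vs (reduce t)) ts (Some [])"

lemma eval_toks_simps [simp]:
  "eval_toks [] = Some []" "eval_toks (t # ts) = Option.bind (eval_toks ts) (reduce t)"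
  by (auto simp: eval_toks_def)

lemma eval_toks_append:
  "bvars f = {} \<Longrightarrow>
    eval_toks (toks f @ ts) = Option.bind (eval_toks ts) (\<lambda>vs. Some (beval f a # vs))"
  by (induction f arbitrary: ts) (auto split: bind_splits)

text \<open>The stack holds one value per formula read, so ending with exactly one value certifies
  that the tokens form a single closed formula.\<close>

lemma eval_toks_Some:
  "eval_toks ts = Some vs \<Longrightarrow>
    \<exists>fs. ts = concat (map toks fs) \<and> vs = map (\<lambda>f. beval f a) fs \<and> (\<forall>f\<in>set fs. bvars f = {})"
proof (induction ts arbitrary: vs)
  case Nil
  then show ?case by (intro exI[of _ "[]"]) auto
next
  case (Cons t ts)
  then obtain us where us: "eval_toks ts = Some us" "reduce t us = Some vs"
    by (auto simp: bind_eq_Some_conv)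
  from Cons.IH[OF us(1)] obtain fs where fs: "ts = concat (map toks fs)"
    "us = map (\<lambda>f. beval f a) fs" "\<forall>f\<in>set fs. bvars f = {}" by blast
  show ?case
  proof (cases t)
    case (T_Const b)
    then show ?thesis using us fs by (intro exI[of _ "FConst b # fs"]) auto
  next
    case T_Not
    then obtain f fs' where "fs = f # fs'" using us fs by (cases fs) auto
    then show ?thesis using us fs T_Not by (intro exI[of _ "FNot f # fs'"]) auto
  next
    case (T_Bin d)
    then obtain f g fs' where "fs = f # g # fs'"
      using us fs by (cases fs; cases "tl fs") auto
    then show ?thesis using us fs T_Bin
      by (intro exI[of _ "(if d then FOr f g else FAnd f g) # fs'"]) auto
  qed (use us in auto)
qed

lemma eval_toks_Var: "T_Var i \<in> set ts \<Longrightarrow> eval_toks ts = None"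
proof (induction ts)
  case (Cons t ts)
  then show ?case by (cases "eval_toks ts") auto
qed simp

text \<open>The dummy blocks left at the end of the play enter the evaluation as such a
  prefix.\<close>

lemma eval_toks_Nots:
  "eval_toks (replicate k T_Not @ ts) = Some [b] \<longleftrightarrow> eval_toks ts = Some [b = even k]"
proof (induction k arbitrary: b)
  case (Suc k)
  have neg: "Option.bind x (reduce T_Not) = Some [b] \<longleftrightarrow> x = Some [\<not> b]" for x
  proof (cases x)
    case (Some vs)
    then show ?thesis by (cases vs) auto
  qed simp
  have "((\<not> b) = even k) = (b = odd k)" by auto
  then show ?case by (simp add: neg Suc)
qed simp


subsection \<open>Playing out the quantifier game\<close>

text \<open>Quantifier duality; thanks to it only positions with an existential player to move need
  to be considered.\<close>

lemma cosat_sem_eq: "cosat_sem ms g \<longleftrightarrow> \<not> sat_sem ms (\<lambda>xs. \<not> g xs)"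
  and sat_sem_eq: "sat_sem ms g \<longleftrightarrow> \<not> cosat_sem ms (\<lambda>xs. \<not> g xs)"
  by (induction ms arbitrary: g) auto

text \<open>Whichever quantifier falls to the last block, it ranges over a nonempty set and
  \<open>g'\<close> ignores its value.\<close>

lemma sem_snoc:
  assumes "\<And>xs z. map length xs = ms \<Longrightarrow> length z = 1 \<Longrightarrow> g' (xs @ [z]) = g xs"
  shows "sat_sem (ms @ [1]) g' = sat_sem ms g" "cosat_sem (ms @ [1]) g' = cosat_sem ms g"
  using assms
proof (induction ms arbitrary: g g')
  case Nil
  { case 1
    then have "g' [z] = g []" if "length z = 1" for z using 1[of "[]" z] that by simp
    then show ?case by (auto intro!: exI[of _ "[True]"]) }
  { case 2
    then have "g' [z] = g []" if "length z = 1" for z using 2[of "[]" z] that by simp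
    then have "(\<forall>z. length z = 1 \<longrightarrow> g' [z]) \<longleftrightarrow> g []"
      by (metis One_nat_def length_Cons list.size(3))
    then show ?case by simp }
next
  case (Cons m ms)
  { case 1
    have "cosat_sem (ms @ [1]) (\<lambda>xs. g' (x # xs)) = cosat_sem ms (\<lambda>xs. g (x # xs))"
      if "length x = m" for x
      by (rule Cons) (use 1[of "x # _"] that in auto)
    then show ?case by auto }
  { case 2
    have "sat_sem (ms @ [1]) (\<lambda>xs. g' (x # xs)) = sat_sem ms (\<lambda>xs. g (x # xs))"
      if "length x = m" for x
      by (rule Cons) (use 2[of "x # _"] that in auto)
    then show ?case by auto }
qed

lemma beval_cong: "(\<And>i. i \<in> bvars f \<Longrightarrow> a i = b i) \<Longrightarrow> beval f a = beval f b"
  by (induction f) auto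

text \<open>If the player to move can win, the oracle's bit starts a winning move; otherwise every bit is
  as good as any other. Either way the value of the game is unchanged.\<close>

lemma sat_sem_plug_form:
  assumes "y \<in> val_sem (Suc m # ms) (form_fun f)"
  shows "sat_sem (m # ms) (form_fun (plug_form y f)) = sat_sem (Suc m # ms) (form_fun f)"
proof -
  have "form_fun (plug_form y f) (x # xs) = form_fun f ((y # x) # xs)" for x xs
  proof -
    have "case_nat y (\<lambda>i. concat (x # xs) ! i) = (\<lambda>i. concat ((y # x) # xs) ! i)"
      by (auto simp: fun_eq_iff split: nat.split)
    then show ?thesis unfolding form_fun_def beval_plug_form by metis
  qed
  then have *: "sat_sem (m # ms) (form_fun (plug_form y f)) \<longleftrightarrow>
      (\<exists>x. length x = m \<and> cosat_sem ms (\<lambda>xs. form_fun f ((y # x) # xs)))" by simp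
  show ?thesis
  proof (cases "sat_sem (Suc m # ms) (form_fun f)")
    case True
    then obtain x where "length x = Suc m" "y = hd x" "cosat_sem ms (\<lambda>xs. form_fun f (x # xs))"
      using assms by (auto simp: val_sem_def)
    then have "\<exists>x. length x = m \<and> cosat_sem ms (\<lambda>xs. form_fun f ((y # x) # xs))"
      by (cases x) auto
    then show ?thesis using * True by simp
  next
    case False
    then have "\<not> cosat_sem ms (\<lambda>xs. form_fun f (x # xs))" if "length x = Suc m" for x
      using that by auto
    then show ?thesis using * False by auto
  qed
qed

text \<open>A block of length 0 leaves only the empty move, so the next, universal block takes the
  lead. Duality makes it existential, and the appended block restores the level.\<close>

lemma sat_sem_rotate:
  assumes "bvars f \<subseteq> {..<sum_list ms}"
  shows "sat_sem (0 # ms) (form_fun f) = (\<not> sat_sem (ms @ [1]) (form_fun (FNot f)))"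
proof -
  have "sat_sem (0 # ms) (form_fun f) = cosat_sem ms (form_fun f)"
  proof -
    have "form_fun f ([] # xs) = form_fun f xs" for xs by (simp add: form_fun_def)
    then show ?thesis by simp
  qed
  moreover have "sat_sem (ms @ [1]) (form_fun (FNot f)) = sat_sem ms (\<lambda>xs. \<not> form_fun f xs)"
  proof (rule sem_snoc)
    fix xs :: "bool list list" and z :: "bool list" assume "map length xs = ms"
    then have "i < length (concat xs)" if "i \<in> bvars f" for i
      using assms that by (auto simp: length_concat)
    then have "beval f (\<lambda>i. concat (xs @ [z]) ! i) = beval f (\<lambda>i. concat xs ! i)"
      by (intro beval_cong) (auto simp: nth_append)
    then show "form_fun (FNot f) (xs @ [z]) = (\<not> form_fun f xs)" by (simp add: form_fun_def)
  qed
  ultimately show ?thesis using cosat_sem_eq[of ms "form_fun f"] by simp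
qed

text \<open>A position is given by block lengths and formula tokens; the first c + 1 blocks are
  those of the original instance, later ones are dummies.\<close>

definition valid_pos :: "nat \<Rightarrow> nat list \<Rightarrow> bform \<Rightarrow> bool" where
  "valid_pos c ms f \<longleftrightarrow> bvars f \<subseteq> {..<sum_list (take (Suc c) ms)} \<and>
     (\<forall>m\<in>set (tl (take (Suc c) ms)). 1 \<le> m)"

text \<open>The value of the original game seen from this position: \<open>n - Suc c\<close>
  rotations lie behind, each complementing the truth value, and \<open>\<noteq>\<close> undoes them
  as an exclusive or. \<open>valid_pos\<close> exempts the first block from positivity, since it is
  being consumed.\<close>

definition pos_value :: "nat \<Rightarrow> nat \<Rightarrow> nat list \<Rightarrow> tok list \<Rightarrow> bool" where
  "pos_value n c ms ts \<longleftrightarrow>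
     (\<exists>f. ts = toks f \<and> valid_pos c ms f \<and> (sat_sem ms (form_fun f) \<noteq> odd (n - Suc c)))"

lemma pos_value_toks:
  "pos_value n c ms (toks f) \<longleftrightarrow> valid_pos c ms f \<and> (sat_sem ms (form_fun f) \<noteq> odd (n - Suc c))"
  unfolding pos_value_def using toks_inj by blast

text \<open>At a valid position the query encodes an instance, the dummies having length 1, and
  \<open>sat_sem_plug_form\<close> applies. Otherwise both sides are False, whatever bit was
  returned.\<close>

lemma pos_value_plug:
  assumes y: "y \<in> VAL n (unary (Suc m # ms) @ strs ts)"
    and len: "Suc (length ms) = n" and dummies: "\<forall>m'\<in>set (drop c ms). m' = 1"
  shows "pos_value n c (m # ms) (map (plug y) ts) = pos_value n c (Suc m # ms) ts"
proof (cases "\<exists>f. ts = toks f")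
  case True
  then obtain f where ts: "ts = toks f" by blast
  have valid: "valid_pos c (m # ms) (plug_form y f) \<longleftrightarrow> valid_pos c (Suc m # ms) f"
    by (auto simp: valid_pos_def bvars_plug_form)
  have "sat_sem (m # ms) (form_fun (plug_form y f)) = sat_sem (Suc m # ms) (form_fun f)"
    if v: "valid_pos c (Suc m # ms) f"
  proof (rule sat_sem_plug_form)
    have "sum_list (take c ms) \<le> sum_list ms"
      using sum_list_append[of "take c ms" "drop c ms"] by simp
    then have "bvars f \<subseteq> {..<sum_list (Suc m # ms)}"
      using v by (force simp: valid_pos_def)
    moreover have "1 \<le> k" if "k \<in> set ms" for k
    proof -
      have "k \<in> set (take c ms) \<union> set (drop c ms)"
        using that by (metis append_take_drop_id set_append)
      then show ?thesis using v dummies by (auto simp: valid_pos_def)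
    qed
    ultimately have "valid_inst n (Suc m # ms) f" using len by (auto simp: valid_inst_def)
    then show "y \<in> val_sem (Suc m # ms) (form_fun f)"
      using y by (simp add: ts VAL_enc_inst[symmetric] enc_inst_unary enc_form_toks)
  qed
  then show ?thesis
    unfolding ts toks_plug_form[symmetric] pos_value_toks valid by blast
next
  case False
  then show ?thesis unfolding pos_value_def using map_plug_eq_toks by metis
qed

text \<open>The negation changes the truth value and the parity together. The new first block leaves
  the scope of positivity in \<open>valid_pos\<close>, hence the assumption
  \<open>1 \<le> hd ms\<close>, which \<open>S_Top\<close> checks.\<close>

lemma pos_value_rotate:
  assumes len: "Suc (length ms) = n" and c: "Suc c \<le> length ms" and hd: "1 \<le> hd ms"
  shows "pos_value n c (ms @ [1]) (T_Not # ts) = pos_value n (Suc c) (0 # ms) ts"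
proof (cases "\<exists>f. ts = toks f")
  case True
  then obtain f where ts: "ts = toks f" by blast
  obtain k ks where ms: "ms = k # ks" using c by (cases ms) auto
  have valid: "valid_pos c (ms @ [1]) (FNot f) \<longleftrightarrow> valid_pos (Suc c) (0 # ms) f"
    using c hd by (auto simp: valid_pos_def ms)
  have "sat_sem (0 # ms) (form_fun f) = (\<not> sat_sem (ms @ [1]) (form_fun (FNot f)))"
    if "valid_pos (Suc c) (0 # ms) f"
  proof (rule sat_sem_rotate)
    have "sum_list (take (Suc c) ms) \<le> sum_list ms"
      using sum_list_append[of "take (Suc c) ms" "drop (Suc c) ms"] by simp
    then have "{..<sum_list (take (Suc c) ms)} \<subseteq> {..<sum_list ms}" by simp
    with _ show "bvars f \<subseteq> {..<sum_list ms}"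
      by (rule subset_trans) (use that in \<open>simp add: valid_pos_def\<close>)
  qed
  moreover have "odd (n - Suc c) \<longleftrightarrow> even (n - Suc (Suc c))"
  proof -
    have "n - Suc c = Suc (n - Suc (Suc c))" using len c by simp
    then show ?thesis by simp
  qed
  moreover have tn: "T_Not # ts = toks (FNot f)" by (simp add: ts)
  ultimately show ?thesis
    unfolding tn unfolding ts pos_value_toks valid by blast
next
  case False
  then have "T_Not # ts \<noteq> toks f" for f by (cases f) auto
  then show ?thesis using False unfolding pos_value_def by blast
qed

text \<open>The \<open>n\<close> dummies read as negations, together with the \<open>T_Not\<close>
  of the last rotation, make \<open>n + 1\<close> negations. This has the parity of the
  \<open>n - 1\<close> earlier rotations that must be undone.\<close>

lemma pos_value_final:
  assumes len: "Suc (length ms) = n"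
  shows "eval_toks (replicate n T_Not @ T_Not # ts) = Some [True] \<longleftrightarrow> pos_value n 0 (0 # ms) ts"
proof -
  have ev: "eval_toks (replicate n T_Not @ T_Not # ts) = Some [True] \<longleftrightarrow> eval_toks ts = Some [odd n]"
    using eval_toks_Nots[of "Suc n" ts True] by (simp add: replicate_app_Cons_same)
  have n: "odd (n - Suc 0) \<longleftrightarrow> even n" using len by (cases n) auto
  show ?thesis
  proof (cases "\<exists>f. ts = toks f \<and> bvars f = {}")
    case True
    then obtain f where f: "ts = toks f" "bvars f = {}" by blast
    have "eval_toks ts = Some [beval f undefined]"
      using eval_toks_append[OF f(2), of "[]" undefined] by (simp add: f)
    moreover have "form_fun f = (\<lambda>_. beval f undefined)"
      unfolding form_fun_def using beval_cong[of f _ undefined] f(2) by blast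
    ultimately show ?thesis
      unfolding ev unfolding f(1) pos_value_toks n by (auto simp: valid_pos_def f(2) simp del: sat_sem.simps)
  next
    case False
    have "eval_toks ts \<noteq> Some [b]" for b
    proof
      assume "eval_toks ts = Some [b]"
      from eval_toks_Some[OF this, of undefined] show False using False by auto
    qed
    moreover have "\<not> pos_value n 0 (0 # ms) ts"
      using False by (auto simp: pos_value_def valid_pos_def)
    ultimately show ?thesis unfolding ev by blast
  qed
qed

text \<open>With \<open>c = n - 1\<close> nothing has been rotated and all blocks are original. The
  conjunct \<open>1 \<le> m\<close> supplies the positivity that \<open>valid_pos\<close> omits for
  the first block.\<close>

lemma SAT_unary_strs:
  assumes len: "length (m # ms) = n"
  shows "SAT n (unary (m # ms) @ strs ts) = {1 \<le> m \<and> pos_value n (n - 1) (m # ms) ts}"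
proof -
  let ?s = "unary (m # ms) @ strs ts"
  have valid: "valid_inst n (m # ms) f \<longleftrightarrow> 1 \<le> m \<and> valid_pos (n - 1) (m # ms) f" for f
    using len by (auto simp: valid_inst_def valid_pos_def)
  have enc: "encodes n ?s \<longleftrightarrow> (\<exists>f. ts = toks f \<and> valid_inst n (m # ms) f)"
  proof
    assume "encodes n ?s"
    then obtain ms' f where v: "valid_inst n ms' f" and "?s = unary ms' @ strs (toks f)"
      by (auto simp: encodes_def enc_inst_unary enc_form_toks)
    then have "m # ms = ms' \<and> strs ts = strs (toks f)"
      using len by (intro unary_append_inj) (auto simp: valid_inst_def)
    then show "\<exists>f. ts = toks f \<and> valid_inst n (m # ms) f"
      using v strs_truncated_inj[of "[]" ts "toks f"] by auto
  next
    assume "\<exists>f. ts = toks f \<and> valid_inst n (m # ms) f"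
    then show "encodes n ?s"
      unfolding encodes_def enc_inst_unary enc_form_toks by blast
  qed
  show ?thesis
  proof (cases "encodes n ?s")
    case True
    then obtain f where f: "ts = toks f" "valid_inst n (m # ms) f" using enc by blast
    have "SAT n ?s = {sat_sem (m # ms) (form_fun f)}"
      using SAT_enc_inst[OF f(2)] by (simp add: enc_inst_unary enc_form_toks f(1))
    moreover have "n - Suc (n - 1) = 0" by simp
    ultimately show ?thesis
      using f(2) unfolding f(1) pos_value_toks valid by (simp del: sat_sem.simps)
  next
    case False
    then have "\<not> (1 \<le> m \<and> pos_value n (n - 1) (m # ms) ts)"
      unfolding enc pos_value_def valid by blast
    then show ?thesis using False by (simp add: SAT_def del: unary_simps)
  qed
qed

section \<open>Strings that cannot be split into block lengths and tokens\<close>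

definition malformed :: "nat \<Rightarrow> bool list \<Rightarrow> bool" where
  "malformed n w \<longleftrightarrow>
     (\<exists>ms ts e. length ms = n \<and> w = unary ms @ strs ts @ e \<and> e \<in> truncated) \<or>
     (\<exists>ms j. length ms < n \<and> w = unary ms @ replicate j True)"

lemma well_or_malformed:
  "(\<exists>ms ts. length ms = n \<and> w = unary ms @ strs ts) \<or> malformed n w"
  using unary_split[of n w]
proof (elim disjE exE conjE)
  fix ms v assume ms: "length ms = n" "w = unary ms @ v"
  obtain ts e where "v = strs ts @ e" "e \<in> insert [] truncated" using tok_split by blast
  then show ?thesis using ms unfolding malformed_def by (cases "e = []") (simp, blast)+
qed (auto simp: malformed_def)

text \<open>\<open>S_Drop\<close> removes the leading bit before the string is scanned; the defect
  has to survive this.\<close>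

lemma malformed_tl:
  assumes "malformed n (True # w)" "1 \<le> n"
  shows "malformed n w"
  using assms(1) unfolding malformed_def
proof (elim disjE exE conjE)
  fix ms ts e assume *: "length ms = n" "True # w = unary ms @ strs ts @ e" "e \<in> truncated"
  then obtain m ms' where "ms = m # ms'" using assms(2) by (cases ms) auto
  with * obtain m' where "ms = Suc m' # ms'" by (cases m) auto
  with * have "length (m' # ms') = n \<and> w = unary (m' # ms') @ strs ts @ e \<and> e \<in> truncated" by simp
  then show "(\<exists>ms ts e. length ms = n \<and> w = unary ms @ strs ts @ e \<and> e \<in> truncated) \<or>
     (\<exists>ms j. length ms < n \<and> w = unary ms @ replicate j True)" by blast
next
  fix ms j assume *: "length ms < n" "True # w = unary ms @ replicate j True"
  have "\<exists>ms j. length ms < n \<and> w = unary ms @ replicate j True"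
  proof (cases ms)
    case Nil
    then show ?thesis using * by (cases j) (auto intro!: exI[of _ "[]"])
  next
    case (Cons m ms')
    with * obtain m' where "ms = Suc m' # ms'" by (cases m) auto
    then show ?thesis using * by (intro exI[of _ "m' # ms'"] exI[of _ j]) auto
  qed
  then show "(\<exists>ms ts e. length ms = n \<and> w = unary ms @ strs ts @ e \<and> e \<in> truncated) \<or>
     (\<exists>ms j. length ms < n \<and> w = unary ms @ replicate j True)" by blast
qed

lemma SAT_malformed:
  assumes "malformed n w"
  shows "SAT n w = {False}"
proof -
  have "\<not> encodes n w"
  proof
    assume "encodes n w"
    then obtain ms' f where ms': "length ms' = n" and w: "w = unary ms' @ strs (toks f)"
      by (auto simp: encodes_def enc_inst_unary enc_form_toks valid_inst_def)
    from assms show False unfolding malformed_def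
    proof (elim disjE exE conjE)
      fix ms ts e assume *: "length ms = n" "w = unary ms @ strs ts @ e" "e \<in> truncated"
      then have "strs ts @ e = strs (toks f)"
        using unary_append_inj[of ms ms'] ms' w by auto
      then have "e = []" using strs_truncated_inj *(3) by blast
      then show False using *(3) by (auto simp: truncated_def)
    next
      fix ms j assume *: "length ms < n" "w = unary ms @ replicate j True"
      have cnt: "length (filter Not (unary ks)) = length ks" for ks by (induction ks) auto
      have "length (filter Not w) = length ms" by (simp add: * cnt)
      moreover have "length (filter Not w) \<ge> n" by (simp add: w cnt ms')
      ultimately show False using * by simp
    qed
  qed
  then show ?thesis by (simp add: SAT_def)
qed


subsection \<open>Answering SAT queries with VAL\<close>

text \<open>Register 0 holds the current position. While the first block is nonempty, S_Ask obtains a bit y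
  and the S_Skip/S_Tok labels plug it in for variable 0, which leaves a variable fewer. An
  exhausted first block is deleted and 1010 is inserted in front of the formula: a dummy block of
  length 1 and a negation, so that again a VAL instance arises. Register 2 counts these
  rotations. After n of them the position is a string of n dummy blocks 10, which read as
  negations, and a closed formula; the E labels evaluate it from right to left with register 3
  as the stack.\<close>

datatype sat_label =
    S_Init | S_Top | S_Check | S_Ask | S_Drop bool | S_Skip bool nat | S_Tok bool | S_Tok0 bool
  | S_Const bool | S_Var bool | S_Index bool | S_Tok1 bool | S_Tok11 bool | S_Back
  | S_Rotate nat | S_Unrotate | S_Count
  | E_Tok | E_Tok0 | E_Const | E_Tok1 | E_Tok11 | E_Reduce | E_Push | E_Op | E_Not | E_Bin
  | E_Bin1 bool | E_Bin2 bool bool | E_End | E_Single bool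
  | S_Fail nat | S_Done bool

abbreviation fail :: "(nat \<times> bool) list \<times> sat_label" where
  "fail \<equiv> ([], S_Fail 0)"

text \<open>Register 2 starts with \<open>n - 1\<close> marks, so \<open>S_Count\<close> finds it
  empty after rotation number \<open>n\<close>. \<open>S_Top\<close> is entered when an original
  block comes first and rejects length 0; at \<open>S_Check\<close> length 0 means that the block is
  used up. For \<open>n \<le> 1\<close> no block remains to be skipped in a rotation.\<close>

fun sat_code :: "nat \<Rightarrow> sat_label \<Rightarrow> nat \<times> (bool option \<Rightarrow> (nat \<times> bool) list \<times> sat_label)" where
  "sat_code n S_Init = (3, \<lambda>s. (replicate (n - 1) (2, True), S_Top))"
| "sat_code n S_Top = (0, case_option fail (\<lambda>b. if b then ([(0, True)], S_Check) else fail))"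
| "sat_code n S_Check = (0, case_option fail (\<lambda>b.
     if b then ([(0, True)], S_Ask)
     else if n \<le> 1 then (map (Pair 1) [True, False, True, False], S_Unrotate)
     else ([], S_Rotate (n - 1))))"
| "sat_code n S_Ask = (0, \<lambda>s. ([], S_Ask))"
| "sat_code n (S_Drop y) = (0, \<lambda>s. ([], S_Skip y n))"
| "sat_code n (S_Skip y j) = skip_code (S_Skip y) fail [] (S_Tok y) j"
| "sat_code n (S_Tok y) = (0, case_option ([], S_Back) (\<lambda>b. ([], if b then S_Tok1 y else S_Tok0 y)))"
| "sat_code n (S_Tok0 y) = (0, case_option fail (\<lambda>b. ([], if b then S_Const y else S_Var y)))"
| "sat_code n (S_Const y) = (0, case_option fail (\<lambda>b. (map (Pair 1) [False, True, b], S_Tok y)))"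
| "sat_code n (S_Var y) = (0, case_option fail (\<lambda>b.
     if b then (map (Pair 1) [False, False], S_Index y)
     else (map (Pair 1) [False, True, y], S_Tok y)))"
| "sat_code n (S_Index y) = (0, case_option fail (\<lambda>b. ([(1, b)], if b then S_Index y else S_Tok y)))"
| "sat_code n (S_Tok1 y) = (0, case_option fail (\<lambda>b.
     if b then ([], S_Tok11 y) else (map (Pair 1) [True, False], S_Tok y)))"
| "sat_code n (S_Tok11 y) = (0, case_option fail (\<lambda>b. (map (Pair 1) [True, True, b], S_Tok y)))"
| "sat_code n S_Back = (1, case_option ([], S_Check) (\<lambda>b. ([(0, b)], S_Back)))"
| "sat_code n (S_Rotate j) =
     skip_code S_Rotate fail (map (Pair 1) [True, False, True, False]) S_Unrotate j"
| "sat_code n S_Unrotate = (1, case_option ([], S_Count) (\<lambda>b. ([(0, b)], S_Unrotate)))"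
| "sat_code n S_Count = (2, case_option ([], E_Tok) (\<lambda>b. ([], S_Top)))"
| "sat_code n E_Tok = (0, case_option ([], E_Reduce) (\<lambda>b. ([], if b then E_Tok1 else E_Tok0)))"
| "sat_code n E_Tok0 = (0, case_option fail (\<lambda>b. if b then ([], E_Const) else fail))"
| "sat_code n E_Const = (0, case_option fail (\<lambda>b. (map (Pair 1) [b, False], E_Tok)))"
| "sat_code n E_Tok1 = (0, case_option fail (\<lambda>b.
     if b then ([], E_Tok11) else (map (Pair 1) [False, True], E_Tok)))"
| "sat_code n E_Tok11 = (0, case_option fail (\<lambda>b. (map (Pair 1) [b, True, True], E_Tok)))"
| "sat_code n E_Reduce = (1, case_option ([], E_End) (\<lambda>b. ([], if b then E_Op else E_Push)))"
| "sat_code n E_Push = (1, case_option fail (\<lambda>b. ([(3, b)], E_Reduce)))"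
| "sat_code n E_Op = (1, case_option fail (\<lambda>b. ([], if b then E_Bin else E_Not)))"
| "sat_code n E_Not = (3, case_option fail (\<lambda>b. ([(3, \<not> b)], E_Reduce)))"
| "sat_code n E_Bin = (1, case_option fail (\<lambda>d. ([], E_Bin1 d)))"
| "sat_code n (E_Bin1 d) = (3, case_option fail (\<lambda>b. ([], E_Bin2 d b)))"
| "sat_code n (E_Bin2 d b) =
     (3, case_option fail (\<lambda>c. ([(3, if d then b \<or> c else b \<and> c)], E_Reduce)))"
| "sat_code n E_End = (3, case_option fail (\<lambda>b. ([], E_Single b)))"
| "sat_code n (E_Single b) = (3, case_option ([], S_Done b) (\<lambda>c. fail))"
| "sat_code n (S_Fail j) =
     (j, case_option ([], if j = 3 then S_Done False else S_Fail (Suc j)) (\<lambda>b. ([], S_Fail j)))"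
| "sat_code n (S_Done b) = (0, \<lambda>s. ([], S_Done b))"

definition sat_machine :: "nat \<Rightarrow> sat_label smach" where
  "sat_machine n = \<lparr> code = sat_code n, l_start = S_Init, l_query = S_Ask, l_yes = S_Drop True,
     l_no = S_Drop False, l_out0 = S_Done False, l_out1 = S_Done True \<rparr>"

lemma sat_machine_sel [simp]:
  "code (sat_machine n) = sat_code n" "l_start (sat_machine n) = S_Init"
  "l_query (sat_machine n) = S_Ask" "l_yes (sat_machine n) = S_Drop True"
  "l_no (sat_machine n) = S_Drop False" "l_out0 (sat_machine n) = S_Done False"
  "l_out1 (sat_machine n) = S_Done True"
  by (simp_all add: sat_machine_def)

definition sat_labels :: "nat \<Rightarrow> sat_label set" where
  "sat_labels n = {S_Init, S_Top, S_Check, S_Ask, S_Back, S_Unrotate, S_Count, E_Tok, E_Tok0, E_Const,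
     E_Tok1, E_Tok11, E_Reduce, E_Push, E_Op, E_Not, E_Bin, E_End} \<union>
     \<Union> (range ` {S_Drop, S_Tok, S_Tok0, S_Const, S_Var, S_Index, S_Tok1, S_Tok11, E_Bin1, E_Single, S_Done})
     \<union> range (\<lambda>(d, b). E_Bin2 d b) \<union> (\<lambda>(y, j). S_Skip y j) ` (UNIV \<times> {..n}) \<union> S_Rotate ` {..n} \<union> S_Fail ` {..3}"

lemma wf_sat_machine: "wf_smach (sat_machine n) (sat_labels n) 6"
proof -
  have "case sat_code n l of (r, g) \<Rightarrow> r < 6 \<and>
      (\<forall>s. case g s of (ps, l') \<Rightarrow> l' \<in> sat_labels n \<and> set ps \<subseteq> {..<6} \<times> UNIV)"
    if "l \<in> sat_labels n" for l
    using that by (cases l) (auto simp: sat_labels_def skip_code_def split: option.split)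
  then show ?thesis unfolding wf_smach_def by (auto simp: sat_labels_def)
qed

section \<open>Runs: failure and the substitution pass\<close>

abbreviation sat_run :: "nat \<Rightarrow> (sat_label \<times> bool list list \<Rightarrow> bool) \<Rightarrow> nat \<Rightarrow>
    sat_label \<times> bool list list \<Rightarrow> bool" where
  "sat_run n \<equiv> ensures (ssuccs (VAL n) (sat_machine n))"

abbreviation halts :: "bool \<Rightarrow> bool list \<Rightarrow> bool list \<Rightarrow> sat_label \<times> bool list list \<Rightarrow> bool" where
  "halts b u v \<equiv> (\<lambda>x. x = (S_Done b, [[], [], [], [], u, v]))"

text \<open>\<open>answers\<close> wants registers 0 to 3 empty at the end, so a failing run clears
  them one by one.\<close>

lemma run_fail:
  assumes "length w + length a + length c + length d + 4 \<le> t"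
  shows "sat_run n (halts False u v) t (S_Fail 0, [w, a, c, d, u, v])"
proof -
  let ?Q = "halts False u v"
  have "sat_run n ?Q 0 (S_Done False, [[], [], [], [], u, v])" by simp
  then have "sat_run n ?Q (length ([[], [], [], d, u, v] ! 3) + Suc 0) (S_Fail 3, [[], [], [], d, u, v])"
    by (intro ensures_clear[where l' = "S_Done False"]) (auto simp: fun_eq_iff)
  then have "sat_run n ?Q (length ([[], [], c, d, u, v] ! 2) + Suc (length d + 1)) (S_Fail 2, [[], [], c, d, u, v])"
    by (intro ensures_clear[where l' = "S_Fail 3"]) (auto simp: fun_eq_iff)
  then have "sat_run n ?Q (length ([[], a, c, d, u, v] ! 1) + Suc (length c + length d + 2))
      (S_Fail 1, [[], a, c, d, u, v])"
    by (intro ensures_clear[where l' = "S_Fail 2"]) (auto simp: fun_eq_iff add.commute numeral_eq_Suc elim: ensures_mono)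
  then have "sat_run n ?Q (length ([w, a, c, d, u, v] ! 0) + Suc (length a + length c + length d + 3))
      (S_Fail 0, [w, a, c, d, u, v])"
    by (intro ensures_clear[where l' = "S_Fail 1"]) (auto simp: fun_eq_iff elim: ensures_mono)
  then show ?thesis by (rule ensures_mono) (use assms in auto)
qed

lemma run_index:
  assumes "sat_run n Q t (S_Tok y, [w, False # replicate i True @ a, c, d, u, v])"
  shows "sat_run n Q (i + Suc t) (S_Index y, [replicate i True @ False # w, a, c, d, u, v])"
  using assms
proof (induction i arbitrary: a)
  case 0
  then show ?case
    by (simp, intro ensures_sstep) (auto simp: sstep_def push_def)
next
  case (Suc i)
  then show ?case
    by (simp, intro ensures_sstep) (auto simp: sstep_def push_def replicate_app_Cons_same)
qed

lemma run_tok: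
  assumes "sat_run n Q t (S_Tok y, [w, rev (str (plug y x)) @ a, c, d, u, v])"
  shows "sat_run n Q (length (str x) + t) (S_Tok y, [str x @ w, a, c, d, u, v])"
proof (cases x)
  case (T_Var i)
  show ?thesis
  proof (cases i)
    case 0
    then have eq: "x = T_Var 0" by (simp add: T_Var)
    show ?thesis using assms unfolding eq
      by - (simp, (rule ensures_sstep; simp add: sstep_def push_def)+)
  next
    case (Suc j)
    then have "sat_run n Q (j + Suc t) (S_Index y, [replicate j True @ False # w, False # False # a, c, d, u, v])"
      using assms T_Var by (intro run_index) simp
    then show ?thesis unfolding T_Var Suc
      by - (simp, (rule ensures_sstep; simp add: sstep_def push_def)+)
  qed
next
  case (T_Const b)
  show ?thesis using assms unfolding T_Const
    by - (simp, (rule ensures_sstep; simp add: sstep_def push_def)+)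
next
  case T_Not
  show ?thesis using assms unfolding T_Not
    by - (simp, (rule ensures_sstep; simp add: sstep_def push_def)+)
next
  case (T_Bin b)
  show ?thesis using assms unfolding T_Bin
    by - (simp, (rule ensures_sstep; simp add: sstep_def push_def)+)
qed

lemma run_toks:
  assumes "sat_run n Q t (S_Tok y, [w, rev (strs (map (plug y) ts)) @ a, c, d, u, v])"
  shows "sat_run n Q (length (strs ts) + t) (S_Tok y, [strs ts @ w, a, c, d, u, v])"
  using assms
proof (induction ts arbitrary: a)
  case (Cons x ts)
  have "sat_run n Q (length (strs ts) + t) (S_Tok y, [strs ts @ w, rev (str (plug y x)) @ a, c, d, u, v])"
    by (rule Cons.IH) (use Cons.prems in simp)
  from run_tok[OF this] show ?case by (simp add: add.assoc)
qed simp

lemma run_index_truncated: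
  assumes "sat_run n Q t (S_Fail 0, [[], replicate i True @ a, c, d, u, v])"
  shows "sat_run n Q (i + Suc t) (S_Index y, [replicate i True, a, c, d, u, v])"
  using assms
proof (induction i arbitrary: a)
  case 0
  then show ?case
    by (simp, intro ensures_sstep) (auto simp: sstep_def push_def)
next
  case (Suc i)
  then show ?case
    by (simp, intro ensures_sstep) (auto simp: sstep_def push_def replicate_app_Cons_same)
qed

lemma run_truncated:
  assumes "e \<in> truncated" and t: "2 * length e + length a + length c + length d + 10 \<le> t"
  shows "sat_run n (halts False u v) t (S_Tok y, [e, a, c, d, u, v])"
proof -
  let ?Q = "halts False u v"
  obtain k where k: "t = Suc (Suc (Suc k))" using t by (cases t; cases "t - 1"; cases "t - 2") auto
  have fail: "sat_run n ?Q j (S_Fail 0, [[], a, c, d, u, v])" if "k \<le> j" for j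
    by (rule run_fail) (use that t k in auto)
  consider "e = [False]" | "e = [False, True]" | "e = [True]" | "e = [True, True]"
    | i where "e = False # False # replicate i True"
    using assms(1) by (auto simp: truncated_def)
  then show ?thesis
  proof cases
    case 5
    have "sat_run n ?Q k (S_Var y, [replicate i True, a, c, d, u, v])"
    proof (cases i)
      case 0
      obtain j where j: "k = Suc j" using t k by (cases k) auto
      have "sat_run n ?Q j (S_Fail 0, [[], a, c, d, u, v])"
        by (rule run_fail) (use t k j in auto)
      then show ?thesis unfolding j 0
        by (intro ensures_sstep) (simp_all add: sstep_def)
    next
      case (Suc j)
      have "sat_run n ?Q (j + length a + length c + length d + 6)
          (S_Fail 0, [[], replicate j True @ False # False # a, c, d, u, v])"
        by (rule run_fail) auto
      from run_index_truncated[OF this]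
      have "sat_run n ?Q (Suc (j + Suc (j + length a + length c + length d + 6)))
          (S_Var y, [replicate i True, a, c, d, u, v])"
        unfolding Suc by (intro ensures_sstep) (simp_all add: sstep_def push_def)
      then show ?thesis by (rule ensures_mono) (use t k 5 Suc in auto)
    qed
    then have "sat_run n ?Q (Suc k) (S_Tok0 y, [False # replicate i True, a, c, d, u, v])"
      by (intro ensures_sstep) (simp_all add: sstep_def push_def)
    then have "sat_run n ?Q (Suc (Suc k)) (S_Tok y, [e, a, c, d, u, v])"
      unfolding 5 by (intro ensures_sstep) (simp_all add: sstep_def push_def)
    then show ?thesis by (rule ensures_mono) (auto simp: k)
  next
    case 1
    show ?thesis unfolding 1 k
      by (insert fail[of "Suc k"], (rule ensures_sstep; simp add: sstep_def push_def)+)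
  next
    case 2
    show ?thesis unfolding 2 k
      by (insert fail[of k], (rule ensures_sstep; simp add: sstep_def push_def)+)
  next
    case 3
    show ?thesis unfolding 3 k
      by (insert fail[of "Suc k"], (rule ensures_sstep; simp add: sstep_def push_def)+)
  next
    case 4
    show ?thesis unfolding 4 k
      by (insert fail[of k], (rule ensures_sstep; simp add: sstep_def push_def)+)
  qed
qed


section \<open>Runs: evaluation\<close>

text \<open>Token codes as kept in register 1, where the last token read lies on top and is reduced
  first. Variables are rejected before they get there; their value is a dummy.\<close>

fun stack_code :: "tok \<Rightarrow> bool list" where
  "stack_code (T_Var i) = []"
| "stack_code (T_Const b) = [False, b]"
| "stack_code T_Not = [True, False]"
| "stack_code (T_Bin d) = [True, True, d]"

lemma run_stack_tok:
  assumes "\<forall>i. x \<noteq> T_Var i" and "sat_run n Q t (E_Tok, [w, stack_code x @ a, c, d, u, v])"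
  shows "sat_run n Q (length (str x) + t) (E_Tok, [str x @ w, a, c, d, u, v])"
proof (cases x)
  case (T_Const b)
  show ?thesis using assms(2) unfolding T_Const
    by - (simp, (rule ensures_sstep; simp add: sstep_def push_def)+)
next
  case T_Not
  show ?thesis using assms(2) unfolding T_Not
    by - (simp, (rule ensures_sstep; simp add: sstep_def push_def)+)
next
  case (T_Bin b)
  show ?thesis using assms(2) unfolding T_Bin
    by - (simp, (rule ensures_sstep; simp add: sstep_def push_def)+)
qed (use assms in auto)

lemma run_stack_toks:
  assumes "\<forall>i. T_Var i \<notin> set ts"
    and "sat_run n Q t (E_Tok, [w, concat (map stack_code (rev ts)) @ a, c, d, u, v])"
  shows "sat_run n Q (length (strs ts) + t) (E_Tok, [strs ts @ w, a, c, d, u, v])"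
  using assms
proof (induction ts arbitrary: a)
  case (Cons x ts)
  have "sat_run n Q (length (strs ts) + t) (E_Tok, [strs ts @ w, stack_code x @ a, c, d, u, v])"
    by (rule Cons.IH) (use Cons.prems in auto)
  with Cons.prems(1) have "sat_run n Q (length (str x) + (length (strs ts) + t))
      (E_Tok, [str x @ strs ts @ w, a, c, d, u, v])"
    by (intro run_stack_tok) auto
  then show ?case by (simp add: add.assoc)
qed simp

lemma length_stack_code: "length (concat (map stack_code ts)) \<le> length (strs ts)"
proof (induction ts)
  case (Cons t ts)
  then show ?case by (cases t) auto
qed simp

lemma run_reduce:
  assumes "reduce x vs = Some vs'" and "sat_run n Q t (E_Reduce, [[], a, c, vs', u, v])"
  shows "sat_run n Q (t + 5) (E_Reduce, [[], stack_code x @ a, c, vs, u, v])"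
proof -
  have "\<exists>k\<le>t + 5. sat_run n Q k (E_Reduce, [[], stack_code x @ a, c, vs, u, v])"
    using assms(1)
  proof (cases rule: reduce.elims)
    case (1 b)
    have "sat_run n Q (Suc (Suc t)) (E_Reduce, [[], False # b # a, c, vs, u, v])"
      using assms(2) 1(2,3) by - ((rule ensures_sstep; simp add: sstep_def push_def)+)
    then show ?thesis using 1 by (intro exI[of _ "Suc (Suc t)"]) auto
  next
    case (2 b us)
    have "sat_run n Q (Suc (Suc (Suc t))) (E_Reduce, [[], True # False # a, c, b # us, u, v])"
      using assms(2) 2(3) by - ((rule ensures_sstep; simp add: sstep_def push_def)+)
    then show ?thesis using 2 by (intro exI[of _ "Suc (Suc (Suc t))"]) auto
  next
    case (3 d b b' us)
    have "sat_run n Q (Suc (Suc (Suc (Suc (Suc t)))))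
        (E_Reduce, [[], True # True # d # a, c, b # b' # us, u, v])"
      using assms(2) 3(3) by - ((rule ensures_sstep; simp add: sstep_def push_def)+)
    then show ?thesis using 3 by (intro exI[of _ "Suc (Suc (Suc (Suc (Suc t))))"]) auto
  qed auto
  then show ?thesis by (elim exE conjE) (erule (1) ensures_mono)
qed

lemma run_reduce_None:
  assumes "reduce x vs = None" "\<forall>i. x \<noteq> T_Var i" and t: "length a + length c + length vs + 10 \<le> t"
  shows "sat_run n (halts False u v) t (E_Reduce, [[], stack_code x @ a, c, vs, u, v])"
proof -
  define k where "k = length a + length c + length vs + 4"
  have fail: "sat_run n (halts False u v) k (S_Fail 0, [[], a, c, [], u, v])"
    by (rule run_fail) (simp add: k_def)
  consider "x = T_Not" "vs = []" | d where "x = T_Bin d" "vs = []" | d b where "x = T_Bin d" "vs = [b]"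
    using assms(1,2) by (cases x; cases vs; cases "tl vs") auto
  then have "\<exists>j\<le>t. sat_run n (halts False u v) j (E_Reduce, [[], stack_code x @ a, c, vs, u, v])"
  proof cases
    case 1
    have "sat_run n (halts False u v) (Suc (Suc (Suc k))) (E_Reduce, [[], True # False # a, c, [], u, v])"
      using fail by - ((rule ensures_sstep; simp add: sstep_def push_def)+)
    then show ?thesis using 1 t by (intro exI[of _ "Suc (Suc (Suc k))"]) (auto simp: k_def)
  next
    case 2
    have "sat_run n (halts False u v) (Suc (Suc (Suc (Suc k))))
        (E_Reduce, [[], True # True # d # a, c, [], u, v])"
      using fail by - ((rule ensures_sstep; simp add: sstep_def push_def)+)
    then show ?thesis using 2 t by (intro exI[of _ "Suc (Suc (Suc (Suc k)))"]) (auto simp: k_def)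
  next
    case 3
    have "sat_run n (halts False u v) (Suc (Suc (Suc (Suc (Suc k)))))
        (E_Reduce, [[], True # True # d # a, c, [b], u, v])"
      using fail by - ((rule ensures_sstep; simp add: sstep_def push_def)+)
    then show ?thesis using 3 t by (intro exI[of _ "Suc (Suc (Suc (Suc (Suc k))))"]) (auto simp: k_def)
  qed
  then show ?thesis by (elim exE conjE) (erule (1) ensures_mono)
qed

lemma run_reduce_all:
  assumes "\<forall>i. T_Var i \<notin> set ts"
    and "vs' = fold (\<lambda>t vs. Option.bind vs (reduce t)) ts (Some vs)"
  shows "sat_run n (halts (vs' = Some [True]) u v) (20 * length (concat (map stack_code ts)) + 2 * length vs + 20)
    (E_Reduce, [[], concat (map stack_code ts), [], vs, u, v])"
  using assms
proof (induction ts arbitrary: vs)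
  case Nil
  let ?Q = "halts (vs' = Some [True]) u v"
  consider "vs = []" | b where "vs = [b]" | b b' us where "vs = b # b' # us"
    by (cases vs; cases "tl vs") auto
  then show ?case
  proof cases
    case 1
    have fail: "sat_run n (halts False u v) k (S_Fail 0, [[], [], [], [], u, v])" if "4 \<le> k" for k
      by (rule run_fail) (use that in simp)
    have "sat_run n (halts False u v) (Suc (Suc k)) (E_Reduce, [[], [], [], [], u, v])" if "4 \<le> k" for k
      by (insert fail[OF that], (rule ensures_sstep; simp add: sstep_def)+)
    from this[of 18] show ?thesis using 1 Nil by simp
  next
    case 2
    have "sat_run n (halts b u v) (Suc (Suc (Suc 0))) (E_Reduce, [[], [], [], [b], u, v])"
      by ((rule ensures_sstep; simp add: sstep_def)+)
    then show ?thesis using 2 Nil by (auto elim: ensures_mono)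
  next
    case 3
    define k where "k = length us + 4"
    have "sat_run n (halts False u v) k (S_Fail 0, [[], [], [], us, u, v])"
      by (rule run_fail) (simp add: k_def)
    then have "sat_run n (halts False u v) (Suc (Suc (Suc k))) (E_Reduce, [[], [], [], vs, u, v])"
      unfolding 3 by - ((rule ensures_sstep; simp add: sstep_def)+)
    then show ?thesis using 3 Nil by (auto simp: k_def elim!: ensures_mono)
  qed
next
  case (Cons x ts)
  have x: "\<forall>i. x \<noteq> T_Var i" "\<forall>i. T_Var i \<notin> set ts" using Cons.prems(1) by auto
  let ?a = "concat (map stack_code ts)"
  \<comment> \<open>Two bits of code per token are budget enough for the five steps of a reduction
    and a stack that grows by one.\<close>
  have len: "2 \<le> length (stack_code x)" using x by (cases x) auto
  show ?case
  proof (cases "reduce x vs")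
    case None
    have "fold (\<lambda>t vs. Option.bind vs (reduce t)) ts None = None" by (induction ts) auto
    then have "vs' = None" using Cons.prems(2) None by simp
    moreover have "sat_run n (halts False u v) (20 * length (stack_code x @ ?a) + 2 * length vs + 20)
        (E_Reduce, [[], stack_code x @ ?a, [], vs, u, v])"
      by (rule run_reduce_None[OF None x(1)]) auto
    ultimately show ?thesis by simp
  next
    case (Some us)
    have le: "length us \<le> length vs + 1" using Some by (cases rule: reduce.elims) auto
    have "sat_run n (halts (vs' = Some [True]) u v) (20 * length ?a + 2 * length us + 20)
        (E_Reduce, [[], ?a, [], us, u, v])"
      by (rule Cons.IH[OF x(2)]) (use Cons.prems(2) Some in simp)
    from run_reduce[OF Some this] have "sat_run n (halts (vs' = Some [True]) u v)
        (20 * length ?a + 2 * length us + 20 + 5) (E_Reduce, [[], concat (map stack_code (x # ts)), [], vs, u, v])"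
      by simp
    then show ?thesis by (rule ensures_mono) (use len le in auto)
  qed
qed

text \<open>The first variable in the list makes \<open>E_Tok0\<close> fail on its second 0, in
  agreement with \<open>eval_toks_Var\<close>.\<close>

lemma run_eval:
  "sat_run n (halts (eval_toks ts = Some [True]) u v) (21 * length (strs ts) + 40)
    (E_Tok, [strs ts, [], [], [], u, v])"
proof (cases "\<exists>i. T_Var i \<in> set ts")
  case False
  let ?a = "concat (map stack_code (rev ts))"
  have "sat_run n (halts (eval_toks ts = Some [True]) u v) (20 * length ?a + 2 * length ([] :: bool list) + 20)
      (E_Reduce, [[], ?a, [], [], u, v])"
    by (rule run_reduce_all) (use False in \<open>auto simp: eval_toks_def foldr_conv_fold\<close>)
  then have "sat_run n (halts (eval_toks ts = Some [True]) u v) (Suc (20 * length ?a + 20))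
      (E_Tok, [[], ?a @ [], [], [], u, v])"
    by (intro ensures_sstep) (simp_all add: sstep_def)
  then have "sat_run n (halts (eval_toks ts = Some [True]) u v) (length (strs ts) + Suc (20 * length ?a + 20))
      (E_Tok, [strs ts @ [], [], [], [], u, v])"
    using False by (intro run_stack_toks) auto
  moreover have "length ?a \<le> length (strs ts)"
    using length_stack_code[of ts] by (simp add: length_concat rev_map[symmetric] sum_list_rev)
  ultimately show ?thesis by (auto elim: ensures_mono)
next
  case True
  then obtain us x ws where ts: "ts = us @ x # ws" "\<exists>i. x = T_Var i" "\<forall>y\<in>set us. \<not> (\<exists>i. y = T_Var i)"
    using split_list_first_prop[of ts "\<lambda>x. \<exists>i. x = T_Var i"] by auto
  then obtain i where x: "x = T_Var i" by blast
  let ?a = "concat (map stack_code (rev us))"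
  let ?w = "replicate i True @ False # strs ws"
  have la: "length ?a \<le> length (strs us)"
    using length_stack_code[of us] by (simp add: length_concat rev_map[symmetric] sum_list_rev)
  define k where "k = length ?w + length ?a + 4"
  have "sat_run n (halts False u v) k (S_Fail 0, [?w, ?a @ [], [], [], u, v])"
    by (rule run_fail) (simp add: k_def)
  then have "sat_run n (halts False u v) (Suc (Suc k)) (E_Tok, [False # False # ?w, ?a @ [], [], [], u, v])"
    by - ((rule ensures_sstep; simp add: sstep_def)+)
  then have "sat_run n (halts False u v) (length (strs us) + Suc (Suc k))
      (E_Tok, [strs us @ False # False # ?w, [], [], [], u, v])"
    using ts(3) by (intro run_stack_toks) auto
  then have "sat_run n (halts False u v) (21 * length (strs ts) + 40) (E_Tok, [strs ts, [], [], [], u, v])"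
    using la by (auto simp: ts(1) x k_def elim!: ensures_mono)
  moreover have "eval_toks ts = None" by (rule eval_toks_Var[of i]) (simp add: ts(1) x)
  ultimately show ?thesis by simp
qed

section \<open>Runs: rounds and rotations of the game\<close>

lemma length_plug: "length (strs (map (plug y) ts)) \<le> length (strs ts)"
proof (induction ts)
  case (Cons t ts)
  have "length (str (plug y t)) \<le> length (str t)" by (cases "(y, t)" rule: plug.cases) auto
  with Cons show ?case by simp
qed simp

lemma run_round:
  assumes len: "Suc (length ms) = n" and L: "length (unary (Suc m # ms) @ strs ts) \<le> L"
    and run: "\<And>y. y \<in> VAL n (unary (Suc m # ms) @ strs ts) \<Longrightarrow>
      sat_run n Q t (S_Check, [unary (m # ms) @ strs (map (plug y) ts), [], c, [], u, v])"
  shows "sat_run n Q (2 * L + 10 + t) (S_Check, [unary (Suc m # ms) @ strs ts, [], c, [], u, v])"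
proof -
  let ?s = "unary (Suc m # ms) @ strs ts"
  have drop: "sat_run n Q (2 * L + 5 + t) (S_Drop y, [?s, [], c, [], u, v])" if y: "y \<in> VAL n ?s" for y
  proof -
    let ?w = "unary (m # ms) @ strs (map (plug y) ts)"
    have "sat_run n Q (length (rev ?w) + Suc t) (S_Back, [[], rev ?w, c, [], u, v])"
      using run[OF y] by (intro ensures_transfer10[where ps = "[]"]) auto
    then have "sat_run n Q (Suc (length (rev ?w) + Suc t)) (S_Tok y, [[], rev ?w, c, [], u, v])"
      by (intro ensures_sstep) (simp_all add: sstep_def)
    then have "sat_run n Q (length (strs ts) + Suc (length (rev ?w) + Suc t))
        (S_Tok y, [strs ts @ [], rev (unary (m # ms)), c, [], u, v])"
      by (intro run_toks) simp
    then have "sat_run n Q (length (unary (m # ms)) + (length (strs ts) + Suc (length (rev ?w) + Suc t)))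
        (S_Skip y (length (m # ms)), [unary (m # ms) @ strs ts, [], c, [], u, v])"
      by (intro ensures_skip[where ps = "[]" and l' = "S_Tok y" and e = fail]) auto
    then have "sat_run n Q (Suc (length (unary (m # ms)) + (length (strs ts) + Suc (length (rev ?w) + Suc t))))
        (S_Drop y, [?s, [], c, [], u, v])"
      using len by (intro ensures_sstep) (simp_all add: sstep_def)
    then show ?thesis
      by (rule ensures_mono) (use L length_plug[of y ts] in auto)
  qed
  have "sat_run n Q (Suc (2 * L + 5 + t)) (l_query (sat_machine n), [?s, [], c, [], u, v])"
  proof (rule ensures_ask)
    show "VAL n ([?s, [], c, [], u, v] ! 0) \<noteq> {}" using len VAL_nonempty[of n] by simp
    show "sat_run n Q (2 * L + 5 + t) (if y then l_yes (sat_machine n) else l_no (sat_machine n), [?s, [], c, [], u, v])"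
      if "y \<in> VAL n ([?s, [], c, [], u, v] ! 0)" for y
      using that drop[of y] by (cases y) (auto simp del: unary_simps)
  qed auto
  then have "sat_run n Q (Suc (Suc (2 * L + 5 + t))) (S_Check, [?s, [], c, [], u, v])"
    by (intro ensures_sstep) (simp_all add: sstep_def push_def)
  then show ?thesis by (rule ensures_mono) auto
qed

lemma run_rotate:
  assumes len: "Suc (length ms) = n" and L: "length (unary (0 # ms) @ strs ts) \<le> L"
    and run: "sat_run n Q t (S_Count, [unary (ms @ [1]) @ strs (T_Not # ts), [], c, [], u, v])"
  shows "sat_run n Q (2 * L + 10 + t) (S_Check, [unary (0 # ms) @ strs ts, [], c, [], u, v])"
proof -
  let ?a = "unary ms @ [True, False, True, False]"
  have unrot: "sat_run n Q (length (rev ?a) + Suc t) (S_Unrotate, [strs ts, rev ?a, c, [], u, v])"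
    using run by (intro ensures_transfer10[where ps = "[]"]) auto
  have "\<exists>k\<le>2 * L + 10 + t. sat_run n Q k (S_Check, [unary (0 # ms) @ strs ts, [], c, [], u, v])"
  proof (cases "ms = []")
    case True
    have "n \<le> 1" using len True by simp
    have "sat_run n Q (Suc (length (rev ?a) + Suc t)) (S_Check, [unary (0 # ms) @ strs ts, [], c, [], u, v])"
      using unrot \<open>n \<le> 1\<close> True by (intro ensures_sstep) (simp_all add: sstep_def push_def)
    then show ?thesis by (intro exI conjI) (auto simp: True)
  next
    case False
    have "sat_run n Q (length (unary ms) + (length (rev ?a) + Suc t))
        (S_Rotate (length ms), [unary ms @ strs ts, [], c, [], u, v])"
      using unrot False
      by (intro ensures_skip[where ps = "map (Pair 1) [True, False, True, False]" and l' = S_Unrotate and e = fail])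
        (auto simp: push_def)
    then have "sat_run n Q (Suc (length (unary ms) + (length (rev ?a) + Suc t)))
        (S_Check, [unary (0 # ms) @ strs ts, [], c, [], u, v])"
      using len False by (intro ensures_sstep) (auto simp: sstep_def)
    then show ?thesis by (rule exI[of _ "Suc _", OF conjI[rotated]]) (use L in auto)
  qed
  then show ?thesis by (elim exE conjE) (erule (1) ensures_mono)
qed

text \<open>The unary code of 1 and the code of a negation are both 10.\<close>

lemma strs_Nots: "strs (replicate k T_Not) = unary (replicate k 1)"
  by (induction k) auto

lemma run_check_Suc:
  assumes "Suc (length ms) = n" "\<forall>k\<in>set (drop c ms). k = 1"
    and L: "length (unary (Suc m # ms) @ strs ts) + 3 * Suc c \<le> L" and D: "2 * L + 10 \<le> D"
    and IH: "\<And>ts. length (unary (m # ms) @ strs ts) + 3 * Suc c \<le> L \<Longrightarrow>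
      sat_run n (halts (pos_value n c (m # ms) ts) u v) ((m + k) * D)
        (S_Check, [unary (m # ms) @ strs ts, [], replicate c True, [], u, v])"
  shows "sat_run n (halts (pos_value n c (Suc m # ms) ts) u v) ((Suc m + k) * D)
    (S_Check, [unary (Suc m # ms) @ strs ts, [], replicate c True, [], u, v])"
proof -
  have "sat_run n (halts (pos_value n c (Suc m # ms) ts) u v) (2 * L + 10 + (m + k) * D)
    (S_Check, [unary (Suc m # ms) @ strs ts, [], replicate c True, [], u, v])"
  proof (rule run_round[OF assms(1)])
    fix y assume y: "y \<in> VAL n (unary (Suc m # ms) @ strs ts)"
    have "length (unary (m # ms) @ strs (map (plug y) ts)) + 3 * Suc c \<le> L"
      using L length_plug[of y ts] by simp
    from IH[OF this]
    show "sat_run n (halts (pos_value n c (Suc m # ms) ts) u v) ((m + k) * D)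
        (S_Check, [unary (m # ms) @ strs (map (plug y) ts), [], replicate c True, [], u, v])"
      unfolding pos_value_plug[OF y assms(1,2)] .
  qed (use L in simp)
  then show ?thesis by (rule ensures_mono) (use D in auto)
qed

text \<open>Induction on the rotations left and, inside, on the bits left in the first block.
  \<open>L\<close> reserves 3 bits for each of the \<open>c + 1\<close> coming rotations. The time
  allows one unit per remaining original bit and two per rotation, those of the last one also paying
  for the evaluation.\<close>

lemma run_check:
  assumes "Suc (length ms) = n" "c < n" "\<forall>k\<in>set (drop c ms). k = 1"
    and "length (unary (m # ms) @ strs ts) + 3 * Suc c \<le> L"
  shows "sat_run n (halts (pos_value n c (m # ms) ts) u v)
    ((m + sum_list (take c ms) + 2 * c + 2) * (60 * L + 100))
    (S_Check, [unary (m # ms) @ strs ts, [], replicate c True, [], u, v])"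
  using assms
proof (induction c arbitrary: m ms ts)
  case 0
  then show ?case
  proof (induction m arbitrary: ts)
    case 0
    let ?b = "pos_value n 0 (0 # ms) ts"
    \<comment> \<open>For \<open>c = 0\<close> all blocks but the exhausted one are dummies.\<close>
    have "replicate (length (ms @ [1])) 1 = ms @ [1]"
      by (rule replicate_length_same) (use 0 in auto)
    then have "ms @ [1] = replicate n 1" using 0(1) by simp
    then have eq: "unary (ms @ [1]) @ strs (T_Not # ts) = strs (replicate n T_Not @ T_Not # ts)"
      by (simp only: strs_Nots strs_simps(3))
    have "length (strs (replicate n T_Not @ T_Not # ts)) \<le> L + 3"
      using 0(4) unfolding eq[symmetric] by simp
    then have "21 * length (strs (replicate n T_Not @ T_Not # ts)) + 40 \<le> 21 * (L + 3) + 40"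
      by simp
    with run_eval[of n "replicate n T_Not @ T_Not # ts" u v]
    have "sat_run n (halts ?b u v) (21 * (L + 3) + 40)
        (E_Tok, [unary (ms @ [1]) @ strs (T_Not # ts), [], [], [], u, v])"
      unfolding pos_value_final[OF 0(1)] eq by (rule ensures_mono)
    then have "sat_run n (halts ?b u v) (Suc (21 * (L + 3) + 40))
        (S_Count, [unary (ms @ [1]) @ strs (T_Not # ts), [], [], [], u, v])"
      by (intro ensures_sstep) (simp_all add: sstep_def)
    from run_rotate[OF 0(1) _ this, of L] 0(4) show ?case by (auto elim!: ensures_mono)
  next
    case (Suc m)
    have "sat_run n (halts (pos_value n 0 (Suc m # ms) ts) u v) ((Suc m + 2) * (60 * L + 100))
        (S_Check, [unary (Suc m # ms) @ strs ts, [], replicate 0 True, [], u, v])"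
      by (rule run_check_Suc[where L = L]) (use Suc in auto)
    then show ?case by simp
  qed
next
  case (Suc c)
  then obtain k ks where ms: "ms = k # ks" by (cases ms) auto
  have ks: "Suc (length (ks @ [1])) = n" "\<forall>k\<in>set (drop c (ks @ [1])). k = 1" "c \<le> length ks"
    using Suc.prems by (auto simp: ms)
  define D where "D = 60 * L + 100"
  have "sat_run n (halts (pos_value n (Suc c) (m # ms) ts) u v)
      ((m + (k + sum_list (take c ks) + 2 * c + 4)) * D)
      (S_Check, [unary (m # ms) @ strs ts, [], replicate (Suc c) True, [], u, v])"
    using Suc.prems
  proof (induction m arbitrary: ts)
    case 0
    let ?b = "pos_value n (Suc c) (0 # ms) ts"
    let ?s = "unary (ms @ [1]) @ strs (T_Not # ts)"
    let ?t = "(k + sum_list (take c (ks @ [1])) + 2 * c + 2) * D"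
    \<comment> \<open>A rotation deletes the 0 of the used-up block and inserts 1010, a net growth
      of 3 bits.\<close>
    have L: "length ?s + 3 * Suc c \<le> L" using 0(4) by simp
    have top: "sat_run n (halts ?b u v) (Suc (?t + D)) (S_Top, [?s, [], replicate c True, [], u, v])"
    proof (cases k)
      case 0
      \<comment> \<open>The block about to become first still falls under positivity in
        \<open>valid_pos (Suc c)\<close>, so rejecting length 0 is correct.\<close>
      have b: "\<not> ?b" by (auto simp: pos_value_def valid_pos_def ms 0)
      obtain w where w: "?s = False # w" by (simp add: ms 0)
      have "length w + c + 4 \<le> D" using L unfolding w by (simp add: D_def)
      then have "sat_run n (halts False u v) (?t + D) (S_Fail 0, [w, [], replicate c True, [], u, v])"
        by (intro run_fail) simp
      then show ?thesis unfolding w using b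
        by (intro ensures_sstep) (simp_all add: sstep_def)
    next
      case (Suc k')
      have "length (unary (k # ks @ [1]) @ strs (T_Not # ts)) + 3 * Suc c \<le> L"
        using L by (simp add: ms)
      from Suc.IH[OF ks(1) _ ks(2) this] Suc.prems(2)
      have "sat_run n (halts (pos_value n c (ms @ [1]) (T_Not # ts)) u v) ?t
          (S_Check, [?s, [], replicate c True, [], u, v])"
        by (simp add: ms D_def)
      moreover have "pos_value n c (ms @ [1]) (T_Not # ts) = ?b"
        by (rule pos_value_rotate) (use 0 ks Suc in \<open>auto simp: ms\<close>)
      ultimately have "sat_run n (halts ?b u v) ?t (S_Check, [?s, [], replicate c True, [], u, v])"
        by simp
      then have "sat_run n (halts ?b u v) (?t + D) (S_Check, [?s, [], replicate c True, [], u, v])"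
        by (rule ensures_mono) auto
      then show ?thesis
        by (intro ensures_sstep) (simp_all add: sstep_def push_def ms Suc)
    qed
    then have "sat_run n (halts ?b u v) (Suc (Suc (?t + D)))
        (S_Count, [?s, [], replicate (Suc c) True, [], u, v])"
      by (intro ensures_sstep) (simp_all add: sstep_def)
    from run_rotate[OF 0(1) _ this, of L] 0(4)
    have "sat_run n (halts ?b u v) (2 * L + 10 + Suc (Suc (?t + D)))
        (S_Check, [unary (0 # ms) @ strs ts, [], replicate (Suc c) True, [], u, v])"
      by simp
    then show ?case
      by (rule ensures_mono) (use ks(3) in \<open>auto simp: D_def algebra_simps\<close>)
  next
    case (Suc m)
    show ?case
      by (rule run_check_Suc[where L = L]) (use Suc in \<open>auto simp: D_def\<close>)
  qed
  moreover have "m + sum_list (take (Suc c) ms) + 2 * Suc c + 2 =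
      m + (k + sum_list (take c ks) + 2 * c + 4)" by (simp add: ms)
  ultimately show ?case unfolding D_def by (simp only:)
qed

text \<open>The first pass over the string runs into the defect, whatever the answer
  \<open>y\<close> was.\<close>

lemma run_malformed:
  assumes "malformed n w" and n: "1 \<le> n"
  shows "sat_run n (halts False u v) (5 * length w + length c + 40) (S_Skip y n, [w, [], c, [], u, v])"
  using assms(1) unfolding malformed_def
proof (elim disjE exE conjE)
  fix ms ts e assume ms: "length ms = n" and w: "w = unary ms @ strs ts @ e" and e: "e \<in> truncated"
  let ?ts = "strs (map (plug y) ts)"
  let ?t = "2 * length e + length (rev ?ts @ rev (unary ms)) + length c + 10"
  have "sat_run n (halts False u v) ?t (S_Tok y, [e, rev ?ts @ rev (unary ms), c, [], u, v])"
    by (rule run_truncated[OF e]) simp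
  then have tok: "sat_run n (halts False u v) (length (strs ts) + ?t) (S_Tok y, [strs ts @ e, rev (unary ms), c, [], u, v])"
    by (rule run_toks)
  have "sat_run n (halts False u v) (length (unary ms) + (length (strs ts) + ?t))
      (S_Skip y (length ms), [unary ms @ strs ts @ e, [], c, [], u, v])"
    using tok ms n by (intro ensures_skip[where ps = "[]" and l' = "S_Tok y" and e = fail]) auto
  then show ?thesis unfolding ms w
    by (rule ensures_mono) (use length_plug[of y ts] in auto)
next
  fix ms j assume ms: "length ms < n" and w: "w = unary ms @ replicate j True"
  let ?a = "rev (unary ms @ replicate j True)"
  have "sat_run n (halts False u v) (length ?a + length c + 4) (S_Fail 0, [[], ?a @ [], c, [], u, v])"
    by (rule run_fail) simp
  then have "sat_run n (halts False u v) (length (unary ms) + j + Suc (length ?a + length c + 4))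
      (S_Skip y n, [w, [], c, [], u, v])"
    unfolding w using ms by (intro ensures_skip_exhausted[where ps' = "[]" and l'' = "S_Fail 0"]) auto
  then show ?thesis by (rule ensures_mono) (simp add: w)
qed

lemma funpow_push:
  "(push (2, b) ^^ k) [w, a, c, d, u, v] = [w, a, replicate k b @ c, d, u, v]"
  by (induction k) (auto simp: push_def)

lemma answers_sat_machine:
  assumes n: "1 \<le> n"
  shows "answers (sat_machine n) (VAL n) (SAT n) ([:2 * n + 10, 1:] * [:180 * n + 200, 60:])"
proof -
  have ex: "\<exists>b\<in>SAT n s. sat_run n (halts b u v) ((length s + 2 * n + 9) * (60 * length s + 180 * n + 200))
      (S_Top, [s, [], replicate (n - 1) True, [], u, v])" for s u v
    using well_or_malformed[of n s]
  proof (elim disjE exE conjE)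
    fix ms0 ts assume ms0: "length ms0 = n" and s: "s = unary ms0 @ strs ts"
    then obtain m ms where ms: "ms0 = m # ms" using n by (cases ms0) auto
    have len: "length (m # ms) = n" using ms0 ms by simp
    let ?b = "1 \<le> m \<and> pos_value n (n - 1) (m # ms) ts"
    have "sat_run n (halts ?b u v) ((length s + 2 * n + 9) * (60 * length s + 180 * n + 200))
      (S_Top, [s, [], replicate (n - 1) True, [], u, v])"
    proof (cases m)
      case 0
      have "sat_run n (halts False u v) (length s + n + 4)
          (S_Fail 0, [unary ms @ strs ts, [], replicate (n - 1) True, [], u, v])"
        by (rule run_fail) (simp add: s ms 0)
      then have "sat_run n (halts False u v) (Suc (length s + n + 4)) (S_Top, [s, [], replicate (n - 1) True, [], u, v])"
        unfolding s ms 0 by (intro ensures_sstep) (simp_all add: sstep_def)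
      then show ?thesis using 0 by (auto elim!: ensures_mono simp: algebra_simps)
    next
      case (Suc m')
      \<comment> \<open>The \<open>n\<close> rotations lengthen the string by 3 bits each.\<close>
      let ?L = "length s + 3 * n"
      have "sat_run n (halts (pos_value n (n - 1) (m # ms) ts) u v)
          ((m + sum_list (take (n - 1) ms) + 2 * (n - 1) + 2) * (60 * ?L + 100))
          (S_Check, [unary (m # ms) @ strs ts, [], replicate (n - 1) True, [], u, v])"
        by (rule run_check) (use len n in \<open>auto simp: s ms\<close>)
      moreover have "(m + sum_list (take (n - 1) ms) + 2 * (n - 1) + 2) * (60 * ?L + 100) \<le>
          (length s + 2 * n) * (60 * length s + 180 * n + 200)"
      proof (rule mult_le_mono)
        have "sum_list ks \<le> length (unary ks)" for ks by (induction ks) auto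
        from this[of "m # ms"] show "m + sum_list (take (n - 1) ms) + 2 * (n - 1) + 2 \<le> length s + 2 * n"
          using len n by (auto simp: s ms)
      qed auto
      ultimately have "sat_run n (halts (pos_value n (n - 1) (m # ms) ts) u v)
          ((length s + 2 * n) * (60 * length s + 180 * n + 200))
          (S_Check, [unary (m # ms) @ strs ts, [], replicate (n - 1) True, [], u, v])"
        by (rule ensures_mono)
      then have "sat_run n (halts ?b u v) ((length s + 2 * n) * (60 * length s + 180 * n + 200))
          (S_Check, [s, [], replicate (n - 1) True, [], u, v])"
        by (simp add: s ms Suc)
      then have "sat_run n (halts ?b u v) (Suc ((length s + 2 * n) * (60 * length s + 180 * n + 200)))
          (S_Top, [s, [], replicate (n - 1) True, [], u, v])"
        by (intro ensures_sstep) (simp_all add: sstep_def push_def s ms Suc)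
      then show ?thesis by (rule ensures_mono) (auto simp: algebra_simps)
    qed
    then show ?thesis using SAT_unary_strs[OF len, of ts] by (simp add: s ms)
  next
    assume mal: "malformed n s"
    have "sat_run n (halts False u v) (Suc (Suc (Suc (Suc (5 * length s + n + 60)))))
      (S_Top, [s, [], replicate (n - 1) True, [], u, v])"
    proof (cases "\<exists>w. s = True # w")
      case True
      then obtain w where w: "s = True # w" by blast
      let ?c = "replicate (n - 1) True"
      have drop: "sat_run n (halts False u v) (Suc (5 * length s + n + 60)) (S_Drop y, [s, [], ?c, [], u, v])" for y
      proof -
        have "sat_run n (halts False u v) (5 * length w + length ?c + 40) (S_Skip y n, [w, [], ?c, [], u, v])"
          by (rule run_malformed[OF malformed_tl[OF mal[unfolded w] n] n])
        then have "sat_run n (halts False u v) (Suc (5 * length w + length ?c + 40)) (S_Drop y, [s, [], ?c, [], u, v])"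
          unfolding w by (intro ensures_sstep) (simp_all add: sstep_def)
        then show ?thesis by (rule ensures_mono) (auto simp: w)
      qed
      have "sat_run n (halts False u v) (Suc (Suc (5 * length s + n + 60)))
          (l_query (sat_machine n), [s, [], ?c, [], u, v])"
        by (rule ensures_ask) (use VAL_nonempty[OF n] drop in auto)
      then have "sat_run n (halts False u v) (Suc (Suc (Suc (5 * length s + n + 60)))) (S_Check, [s, [], ?c, [], u, v])"
        unfolding w by (intro ensures_sstep) (simp_all add: sstep_def push_def)
      then show ?thesis
        unfolding w by (intro ensures_sstep) (simp_all add: sstep_def push_def)
    next
      case False
      have "sat_run n (halts False u v) (Suc (Suc (Suc (5 * length s + n + 60))))
          (S_Fail 0, [tl s, [], replicate (n - 1) True, [], u, v])"
        by (rule run_fail) auto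
      then show ?thesis
        by (intro ensures_sstep; cases s) (use False in \<open>auto simp: sstep_def\<close>)
    qed
    then have "sat_run n (halts False u v) ((length s + 2 * n + 9) * (60 * length s + 180 * n + 200))
      (S_Top, [s, [], replicate (n - 1) True, [], u, v])"
      by (rule ensures_mono) (auto simp: algebra_simps)
    then show ?thesis by (intro bexI[of _ False]) (simp_all add: SAT_malformed[OF mal])
  qed
  have top: "sat_run n (\<lambda>c. \<exists>b\<in>SAT n s. c = (S_Done b, [[], [], [], [], u, v]))
      ((length s + 2 * n + 9) * (60 * length s + 180 * n + 200))
      (S_Top, [s, [], replicate (n - 1) True, [], u, v])" for s u v
  proof -
    obtain b where "b \<in> SAT n s" "sat_run n (halts b u v)
        ((length s + 2 * n + 9) * (60 * length s + 180 * n + 200))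
        (S_Top, [s, [], replicate (n - 1) True, [], u, v])"
      using ex[of s u v] by blast
    from this(2) show ?thesis by (rule ensures_mono) (use \<open>b \<in> SAT n s\<close> in auto)
  qed
  have init: "sat_run n (\<lambda>c. \<exists>b\<in>SAT n s. c = (S_Done b, [[], [], [], [], u, v]))
      (Suc ((length s + 2 * n + 9) * (60 * length s + 180 * n + 200)))
      (S_Init, [s, [], [], [], u, v])" for s u v
    using top[of s u v] by (intro ensures_sstep) (simp_all add: sstep_def funpow_push)
  have poly: "Suc ((length s + 2 * n + 9) * (60 * length s + 180 * n + 200)) \<le>
      poly ([:2 * n + 10, 1:] * [:180 * n + 200, 60:]) (length s)" for s :: "bool list"
    by (simp add: algebra_simps)
  show ?thesis unfolding answers_def sat_machine_sel
  proof (intro allI)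
    fix s u v
    from init[of s u v] poly[of s]
    show "sat_run n (\<lambda>c. \<exists>y\<in>SAT n s. c = (if y then S_Done True else S_Done False, [[], [], [], [], u, v]))
        (poly ([:2 * n + 10, 1:] * [:180 * n + 200, 60:]) (length s)) (S_Init, [s, [], [], [], u, v])"
      by (rule ensures_mono) auto
  qed
qed

theorem theorem11:
  fixes n :: nat
  assumes "1 \<le> n"
  shows "Phat (VAL n) = Phat (SAT n)"
  \<comment> \<open>This line gives the inclusion of \<open>Phat (VAL n)\<close> in
    \<open>Phat (SAT n)\<close>, the next one the converse.\<close>
  using turing_reduces_subroutine[OF _ wf_val_machine answers_val_machine[OF assms]]
    turing_reduces_subroutine[OF _ wf_sat_machine answers_sat_machine[OF assms]]
  by (auto simp: Phat_def)

end
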